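(* Let $Z=(Z^+,Z^-)$ be a planar piecewise vector field with switching set $\Sigma=\{y=0\}$ satisfying hypothesis (H1) stated in the context, with half-return maps $\varphi^\pm:[0,x_0)\to\mathbb{R}$, associated signs $\delta,\mu\in\{-1,1\}$, and let $Z_b(x,y)=Z^+(x-b,y)$ for $y>0$, $Z_b(x,y)=Z^-(x,y)$ for $y<0$, $b\in\mathbb{R}$. Suppose that $\varphi^\pm$ are of class $C^k$ for some $k\in\mathbb{Z}_{\geqslant1}\cup\{\infty\}$, and write $$\varphi^\pm(x)=\sum_{i=1}^{k}\alpha_i^\pm x^i+o(x^k),\qquad V_i=\delta(\alpha_i^+-\alpha_i^-).$$ If $V_i\neq0$ for some $i\in\{1,\dots,k\}$, then there is $b_0>0$ such that for each $b$ with $0<\mu b<b_0$, $Z_b$ has exactly one crossing periodic orbit in a neighborhood of the origin. Furthermore, let $N\in\{1,\dots,k\}$ be the minimal index such that $V_N\neq0$. Then this periodic orbit is a hyperbolic stable (resp. unstable) crossing limit cycle if $V_N<0$ (resp. $V_N>0$), and its position is given by $$x(b)=\sqrt[N]{\frac{1-\alpha_1^+}{|V_N|}}\,\sqrt[N]{|b|}+o\bigl(\sqrt[N]{|b|}\bigr).$$ Moreover, if $N<k$ (in particular if $k=\infty$), then this formula is replaced by $$x(b)=\sqrt[N]{\frac{1-\alpha_1^+}{|V_N|}}\,\sqrt[N]{|b|}+O\Bigl(\sqrt[N]{|b|}^{\,2}\Bigr).$$ In addition to that, if $\mu b<0$, then there is no periodic orbit passing through $\Sigma_0=[0,x_0)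\times\{0\}$.
   Context: Setting. Let $\Sigma=\{(x,y)\in\mathbb{R}^2: y=0\}$ and $\Sigma^\pm=\{(x,y)\in\mathbb{R}^2:\pm y\geqslant 0\}$. Consider $Z(x,y)=Z^+(x,y)$ if $y>0$ and $Z(x,y)=Z^-(x,y)$ if $y<0$, where $Z^\pm=(P^\pm,Q^\pm)$ are well defined and locally Lipschitz on $\Sigma^\pm$. Let $\psi^\pm(t;x,y)$ be the solution of $Z^\pm$ with $\psi^\pm(0;x,y)=(x,y)$. Hypothesis (H1): there are $x_0>0$ and continuous functions $\tau^\pm:(0,x_0)\to\mathbb{R}$ such that for every $x\in(0,x_0)$: (i) $\psi^\pm(\tau^\pm(x);x,0)\in\Sigma$; (ii) $\tau^+(x)\tau^-(x)<0$; (iii) $\psi^\pm(t;x,0)\in\Sigma^\pm\setminus\Sigma$ for every $t$ in the open interval bounded by $0$ and $\tau^\pm(x)$; (iv) $\varphi^\pm(x)<0$, where $(\varphi^\pm(x),0):=\psi^\pm(\tau^\pm(x);x,0)$; (v) $\varphi^+(x)\neq\varphi^-(x)$; (vi) $\varphi^\pm$ can be continuously extended to $x=0$ with $\varphi^\pm(0)=0$. Signs: $\delta=1$ if $\tau^+(x)<0<\tau^-(x)$ and $\delta=-1$ if $\tau^-(x)<0<\tau^+(x)$ (independent of $x\in(0,x_0)$). Displacement function: $\Delta_0(x)=\delta(\varphi^+(x)-\varphi^-(x))$. Let $\sigma=\operatorname{sign}(\Delta_0(x))\in\{-1,1\}$ (independent of $x\in(0,x_0)$) and $\mu=-\sigma\delta$.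 Conventions: a function on $[a,c)$ is of class $C^k$ if it is the restriction of a $C^k$ function on $(a-\varepsilon,c)$ for some $\varepsilon>0$. If $k=\infty$, $o(x^k)$ denotes a flat term and $i,N$ range over positive integers. Note that $\varphi^\pm\leqslant0$ implies $\alpha_1^\pm\leqslant0$. Terminology: a crossing periodic orbit of $Z_b$ is a periodic orbit obtained by concatenating an orbit arc of the upper vector field $Z^+(x-b,y)$ in $\Sigma^+$ and an orbit arc of $Z^-$ in $\Sigma^-$, crossing $\Sigma$ without sliding. A limit cycle is an isolated periodic orbit; it is hyperbolic if the derivative of its first return map at the corresponding fixed point is different from $1$. The position of the limit cycle is the number $x(b)>0$ such that it passes through $(x(b),0)\in\Sigma$.
   Formalization: The last claim is proved for -b0 < μb < 0 (false for large |b|, as (H1) is local) and for crossing periodic orbits (an orbit of Z^- alone may graze the origin); an infinite derivative of the first return map counts as different from 1. *)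

theory Defs
  imports "HOL-Analysis.Analysis" "HOL-Library.Landau_Symbols" "HOL-Library.Extended_Nat"
begin

type_synonym plane_field = "real \<times> real \<Rightarrow> real \<times> real"

definition switch_line :: "(real \<times> real) set" where
  "switch_line = {p. snd p = 0}"

definition upper_half :: "(real \<times> real) set" where
  "upper_half = {p. snd p \<ge> 0}"

definition lower_half :: "(real \<times> real) set" where
  "lower_half = {p. snd p \<le> 0}"

text \<open>A piecewise vector field is represented by the pair of its two components; only the values of
  the first one on \<^const>\<open>upper_half\<close> and of the second one on \<^const>\<open>lower_half\<close> matter.\<close>

definition locally_lipschitz_field :: "(real \<times> real) set \<Rightarrow> plane_field \<Rightarrow> bool" where
  "locally_lipschitz_field S F \<longleftrightarrow> local_lipschitz (UNIV :: real set) S (\<lambda>_. F)"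

definition solution_on :: "plane_field \<Rightarrow> (real \<times> real) set \<Rightarrow> real set \<Rightarrow> (real \<Rightarrow> real \<times> real) \<Rightarrow> bool" where
  "solution_on F S J \<gamma> \<longleftrightarrow>
     (\<forall>t\<in>J. \<gamma> t \<in> S \<and> (\<gamma> has_vector_derivative F (\<gamma> t)) (at t within J))"

text \<open>The solution of \<open>F\<close> in the half-plane \<open>S\<close> starting at \<open>(u, 0)\<close> is at \<open>(v, 0)\<close> at the
  (possibly negative) time \<open>T\<close>, and is off the switching line at all times strictly between \<open>0\<close> and
  \<open>T\<close>. For locally Lipschitz \<open>F\<close> the curve \<open>\<gamma>\<close> is unique on the time interval
  concerned, so \<open>\<gamma> t\<close> is \<open>\<psi>(t; u, 0)\<close> there.\<close>

definition orbit_arc ::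
  "plane_field \<Rightarrow> (real \<times> real) set \<Rightarrow> real \<Rightarrow> real \<Rightarrow> real \<Rightarrow> (real \<Rightarrow> real \<times> real) \<Rightarrow> bool" where
  "orbit_arc F S u T v \<gamma> \<longleftrightarrow>
     solution_on F S (closed_segment 0 T) \<gamma> \<and> \<gamma> 0 = (u, 0) \<and> \<gamma> T = (v, 0) \<and>
     (\<forall>t\<in>open_segment 0 T. \<gamma> t \<in> S - switch_line)"

definition H1 ::
  "plane_field \<Rightarrow> plane_field \<Rightarrow> real \<Rightarrow> (real \<Rightarrow> real) \<Rightarrow> (real \<Rightarrow> real) \<Rightarrow>
   (real \<Rightarrow> real) \<Rightarrow> (real \<Rightarrow> real) \<Rightarrow> bool" where
  "H1 Zp Zm x0 \<tau>p \<tau>m \<phi>p \<phi>m \<longleftrightarrow>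
     x0 > 0 \<and> continuous_on {0<..<x0} \<tau>p \<and> continuous_on {0<..<x0} \<tau>m \<and>
     (\<forall>x\<in>{0<..<x0}.
        (\<exists>\<gamma>. orbit_arc Zp upper_half x (\<tau>p x) (\<phi>p x) \<gamma>) \<and>
        (\<exists>\<gamma>. orbit_arc Zm lower_half x (\<tau>m x) (\<phi>m x) \<gamma>) \<and>
        \<tau>p x * \<tau>m x < 0 \<and> \<phi>p x < 0 \<and> \<phi>m x < 0 \<and> \<phi>p x \<noteq> \<phi>m x) \<and>
     \<phi>p 0 = 0 \<and> (\<phi>p \<longlongrightarrow> 0) (at_right 0) \<and>
     \<phi>m 0 = 0 \<and> (\<phi>m \<longlongrightarrow> 0) (at_right 0)"

text \<open>Under \<^const>\<open>H1\<close> the signs below do not depend on \<open>x\<close>, so the negation of each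
  condition amounts to the opposite strict inequalities on the whole interval.\<close>

definition delta_sign :: "real \<Rightarrow> (real \<Rightarrow> real) \<Rightarrow> (real \<Rightarrow> real) \<Rightarrow> real" where
  "delta_sign x0 \<tau>p \<tau>m = (if \<forall>x\<in>{0<..<x0}. \<tau>p x < 0 \<and> 0 < \<tau>m x then 1 else - 1)"

definition displacement :: "real \<Rightarrow> (real \<Rightarrow> real) \<Rightarrow> (real \<Rightarrow> real) \<Rightarrow> real \<Rightarrow> real" where
  "displacement \<delta> \<phi>p \<phi>m x = \<delta> * (\<phi>p x - \<phi>m x)"

definition sigma_sign :: "real \<Rightarrow> (real \<Rightarrow> real) \<Rightarrow> real" where
  "sigma_sign x0 \<Delta> = (if \<forall>x\<in>{0<..<x0}. \<Delta> x > 0 then 1 else - 1)"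

definition translate_field :: "real \<Rightarrow> plane_field \<Rightarrow> plane_field" where
  "translate_field b F = (\<lambda>(x, y). F (x - b, y))"

definition C_on_open :: "enat \<Rightarrow> real set \<Rightarrow> (real \<Rightarrow> real) \<Rightarrow> bool" where
  "C_on_open k S g \<longleftrightarrow>
     (\<forall>i. enat i < k \<longrightarrow> (deriv ^^ i) g differentiable_on S) \<and>
     (\<forall>i. enat i \<le> k \<longrightarrow> continuous_on S ((deriv ^^ i) g))"

definition C_half_open :: "enat \<Rightarrow> real \<Rightarrow> real \<Rightarrow> (real \<Rightarrow> real) \<Rightarrow> bool" where
  "C_half_open k a c f \<longleftrightarrow>
     (\<exists>\<epsilon>>0. \<exists>g. C_on_open k {a - \<epsilon><..<c} g \<and> (\<forall>x\<in>{a..<c}. g x = f x))"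

text \<open>For finite \<open>k\<close> the instance \<open>n = k\<close> is the expansion up to \<open>o(x\<^sup>k)\<close> and implies
  the others; for \<open>k = \<infinity>\<close> this says that the formal series agrees with \<open>f\<close> up to a flat
  term.\<close>

definition expansion_at_0 :: "enat \<Rightarrow> (nat \<Rightarrow> real) \<Rightarrow> (real \<Rightarrow> real) \<Rightarrow> bool" where
  "expansion_at_0 k \<alpha> f \<longleftrightarrow>
     (\<forall>n. enat n \<le> k \<longrightarrow>
        (\<lambda>x. f x - (\<Sum>i=1..n. \<alpha> i * x ^ i)) \<in> o[at_right 0](\<lambda>x. x ^ n))"

text \<open>A crossing periodic orbit leaves \<open>(u, 0)\<close> along an arc in the open upper half-plane, arrives
  at \<open>(v, 0)\<close>, and returns along an arc in the open lower half-plane. Passing from one open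
  half-plane to the other at both points is what crossing without sliding means here;
  \<open>Q\<^sup>+ Q\<^sup>- > 0\<close> is not demanded at these points, since \<^const>\<open>H1\<close> allows
  tangencies there (of the type \<open>y = t\<^sup>3\<close>). The condition \<open>u \<noteq> v\<close> excludes a figure eight
  made of two closed orbits that touch the line at one point.\<close>

definition crossing_periodic_orbit ::
  "plane_field \<Rightarrow> plane_field \<Rightarrow> (real \<times> real) set \<Rightarrow> bool" where
  "crossing_periodic_orbit Fp Fm \<Gamma> \<longleftrightarrow>
     (\<exists>u v S T \<gamma> \<eta>. u \<noteq> v \<and> S > 0 \<and> T > 0 \<and>
        orbit_arc Fp upper_half u S v \<gamma> \<and> orbit_arc Fm lower_half v T u \<eta> \<and>
        \<Gamma> = \<gamma> ` {0..S} \<union> \<eta> ` {0..T})"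

definition crossing_limit_cycle ::
  "plane_field \<Rightarrow> plane_field \<Rightarrow> (real \<times> real) set \<Rightarrow> bool" where
  "crossing_limit_cycle Fp Fm \<Gamma> \<longleftrightarrow>
     crossing_periodic_orbit Fp Fm \<Gamma> \<and>
     (\<exists>W. open W \<and> \<Gamma> \<subseteq> W \<and>
        (\<forall>\<Gamma>'. crossing_periodic_orbit Fp Fm \<Gamma>' \<and> \<Gamma>' \<subseteq> W \<longrightarrow> \<Gamma>' = \<Gamma>))"

definition half_return ::
  "plane_field \<Rightarrow> (real \<times> real) set \<Rightarrow> real \<Rightarrow> real \<Rightarrow> bool" where
  "half_return F S u v \<longleftrightarrow> (\<exists>T>0. \<exists>\<gamma>. orbit_arc F S u T v \<gamma>)"

definition first_return :: "plane_field \<Rightarrow> plane_field \<Rightarrow> real \<Rightarrow> real \<Rightarrow> bool" where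
  "first_return Fp Fm u w \<longleftrightarrow>
     (\<exists>v. half_return Fp upper_half u v \<and> half_return Fm lower_half v w) \<or>
     (\<exists>v. half_return Fm lower_half u v \<and> half_return Fp upper_half v w)"

definition first_return_map ::
  "plane_field \<Rightarrow> plane_field \<Rightarrow> real \<Rightarrow> (real \<Rightarrow> real) \<Rightarrow> bool" where
  "first_return_map Fp Fm x \<pi> \<longleftrightarrow>
     \<pi> x = x \<and> (\<forall>\<^sub>F u in nhds x. \<forall>w. first_return Fp Fm u w \<longleftrightarrow> w = \<pi> u)"

text \<open>The first return map is a composition of one half-return map with the inverse of the other, so
  its derivative is infinite where the derivative of the latter vanishes (a tangency as
  above). An infinite derivative counts as different from \<open>1\<close>; equivalently, the inverse of the
  first return map has derivative \<open>0\<close>.\<close>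

definition hyperbolic_at :: "plane_field \<Rightarrow> plane_field \<Rightarrow> real \<Rightarrow> bool" where
  "hyperbolic_at Fp Fm x \<longleftrightarrow>
     (\<exists>\<pi>. first_return_map Fp Fm x \<pi> \<and>
        ((\<exists>d. d \<noteq> 1 \<and> (\<pi> has_real_derivative d) (at x)) \<or>
         filterlim (\<lambda>u. (\<pi> u - \<pi> x) / (u - x)) at_top (at x)))"

text \<open>Asymptotic stability of the fixed point of the first return map.\<close>

definition stable_at :: "plane_field \<Rightarrow> plane_field \<Rightarrow> real \<Rightarrow> bool" where
  "stable_at Fp Fm x \<longleftrightarrow>
     (\<exists>\<pi>. first_return_map Fp Fm x \<pi> \<and>
        (\<forall>e>0. \<exists>d>0. \<forall>u. \<bar>u - x\<bar> < d \<longrightarrow>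
           (\<forall>n. \<bar>(\<pi> ^^ n) u - x\<bar> < e) \<and> (\<lambda>n. (\<pi> ^^ n) u) \<longlonglongrightarrow> x))"

text \<open>Unstable means that all nearby orbits approach the cycle in backward time, which is
  stronger than the mere failure of stability.\<close>

definition unstable_at :: "plane_field \<Rightarrow> plane_field \<Rightarrow> real \<Rightarrow> bool" where
  "unstable_at Fp Fm x \<longleftrightarrow> stable_at (\<lambda>p. - Fp p) (\<lambda>p. - Fm p) x"

end

theory Submission
  imports Defs
begin

text \<open>
  Reversing time if necessary, let the lower half-return map \<open>\<phi>m\<close> follow the flow and the upper one
  \<open>\<phi>p\<close> run against it. Orbit arcs in one half-plane cannot have interlaced endpoints (two plane paths
  with interlaced endpoints on a line meet, and then uniqueness identifies the arcs), and no point
  near the origin can be passed by an arc against the given direction. Hence the crossing periodic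
  orbits of the translated system near the origin are exactly the solutions of
  \<open>\<phi>m x = b + \<phi>p (x - b)\<close>.

  This equation says that the increasing functions \<open>x - \<phi>m x\<close> and \<open>w - \<phi>p w\<close> agree at \<open>x\<close> and
  \<open>w = x - b\<close>, so \<open>b\<close> is a function of \<open>x\<close>. Its sign is that of \<open>\<mu>\<close>, by the mean value theorem it is
  asymptotic to \<open>(\<phi>m x - \<phi>p x) / (1 - \<alpha>p 1)\<close>, and it is strictly monotone near \<open>0\<close> because
  \<open>\<phi>p' (x - b) - \<phi>m' x\<close> has the sign of the leading coefficient. Inverting it gives existence,
  uniqueness and the expansion of \<open>x b\<close>; the same sign compares the two derivatives whose quotient
  is the multiplier of the cycle.\<close>

section \<open>Orbit arcs in a half-plane\<close>

text \<open>At b = 0 the equation for the position degenerates: \<open>\<phi>m x - \<phi>p x\<close>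
  vanishes at the origin to order \<open>N\<close>, so for \<open>N > 1\<close> it cannot be solved
  for x by the implicit function theorem. It can always be solved for b, because
  \<open>w - \<phi>p w\<close> has derivative at least 1 for w > 0. The whole degeneracy is then
  carried by one real function of x, strictly monotone for small x > 0, and the N-th root in the
  formula is its inverse to leading order.

  A point could then a priori be the end of one arc and the start of another, while (H1) speaks only
  of the arcs that start on the interval from 0 to \<open>x0\<close>; an arbitrary periodic orbit
  near the origin has to be shown to consist of these. For the same reason a half-return map may
  have derivative 0, so its inverse is handled by monotonicity, and contraction is applied to that
  one of the two mutually inverse return maps whose multiplier lies in [0, 1).\<close>

definition half_plane :: "real \<Rightarrow> (real \<times> real) set" where
  "half_plane s = {p. 0 \<le> s * snd p}"

lemma upper_half_eq: "upper_half = half_plane 1"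
  and lower_half_eq: "lower_half = half_plane (- 1)"
  by (auto simp: upper_half_def lower_half_def half_plane_def)

definition reverse_field :: "plane_field \<Rightarrow> plane_field" where
  "reverse_field F = (\<lambda>p. - F p)"

lemma reverse_reverse_field [simp]: "reverse_field (reverse_field F) = F"
  by (simp add: reverse_field_def)

section \<open>Solutions in a half-plane: change of time and uniqueness\<close>

lemma solution_on_subset:
  "solution_on F S J \<gamma> \<Longrightarrow> J' \<subseteq> J \<Longrightarrow> solution_on F S J' \<gamma>"
  unfolding solution_on_def by (blast intro: has_vector_derivative_within_subset)

lemma solution_on_shift:
  assumes "solution_on F S {0..T} \<gamma>" "0 \<le> a" "a \<le> T"
  shows "solution_on F S {0..T - a} (\<lambda>t. \<gamma> (a + t))"
  unfolding solution_on_def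
proof (intro ballI conjI)
  fix t assume t: "t \<in> {0..T - a}"
  then have at: "a + t \<in> {0..T}" using assms by auto
  show "\<gamma> (a + t) \<in> S" using assms(1) at by (auto simp: solution_on_def)
  have "(\<gamma> has_vector_derivative F (\<gamma> (a + t))) (at (a + t) within {0..T})"
    using assms(1) at by (auto simp: solution_on_def)
  then have d: "(\<gamma> has_vector_derivative F (\<gamma> (a + t))) (at (a + t) within (+) a ` {0..T - a})"
    by (rule has_vector_derivative_within_subset) (use assms in auto)
  have "((+) a has_vector_derivative 1) (at t within {0..T - a})"
    by (auto intro!: derivative_eq_intros)
  from vector_diff_chain_within[OF this d]
  show "((\<lambda>t. \<gamma> (a + t)) has_vector_derivative F (\<gamma> (a + t))) (at t within {0..T - a})"
    by (simp add: o_def)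
qed

lemma solution_on_reverse:
  assumes "solution_on F S {0..T} \<gamma>"
  shows "solution_on (reverse_field F) S {0..T} (\<lambda>t. \<gamma> (T - t))"
  unfolding solution_on_def
proof (intro ballI conjI)
  fix t assume t: "t \<in> {0..T}"
  then have at: "T - t \<in> {0..T}" by auto
  show "\<gamma> (T - t) \<in> S" using assms(1) at by (auto simp: solution_on_def)
  have "(\<gamma> has_vector_derivative F (\<gamma> (T - t))) (at (T - t) within {0..T})"
    using assms(1) at by (auto simp: solution_on_def)
  then have d: "(\<gamma> has_vector_derivative F (\<gamma> (T - t))) (at (T - t) within (-) T ` {0..T})"
    by (rule has_vector_derivative_within_subset) auto
  have "((-) T has_vector_derivative - 1) (at t within {0..T})"
    by (auto intro!: derivative_eq_intros)
  from vector_diff_chain_within[OF this d]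
  show "((\<lambda>t. \<gamma> (T - t)) has_vector_derivative reverse_field F (\<gamma> (T - t))) (at t within {0..T})"
    by (simp add: o_def reverse_field_def)
qed

lemma solution_on_continuous:
  "solution_on F S J \<gamma> \<Longrightarrow> continuous_on J \<gamma>"
  unfolding solution_on_def continuous_on_eq_continuous_within
  by (blast intro: has_vector_derivative_continuous)

text \<open>Gronwall's argument. The two traces form a compact subset of \<open>S\<close>, on which
  the local Lipschitz condition gives one constant \<open>L\<close>, so the squared distance grows
  at most at the rate \<open>2 * L\<close>. Only values of the field on \<open>S\<close> enter, so
  the curves may touch the boundary of a half-plane.\<close>

lemma solution_on_unique:
  assumes lip: "locally_lipschitz_field S F"
    and g: "solution_on F S {0..T} \<gamma>" and h: "solution_on F S {0..T} \<eta>"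
    and eq: "\<gamma> 0 = \<eta> 0" and t: "t \<in> {0..T}"
  shows "\<gamma> t = \<eta> t"
proof -
  define K where "K = \<gamma> ` {0..T} \<union> \<eta> ` {0..T}"
  have cg: "continuous_on {0..T} \<gamma>" and ch: "continuous_on {0..T} \<eta>"
    using g h by (auto intro: solution_on_continuous)
  have cK: "compact K" unfolding K_def by (intro compact_Un compact_continuous_image cg ch) auto
  have KS: "K \<subseteq> S" using g h by (auto simp: K_def solution_on_def)
  have "local_lipschitz ({0} :: real set) K (\<lambda>_. F)"
    by (rule local_lipschitz_subset[OF lip[unfolded locally_lipschitz_field_def]]) (use KS in auto)
  from local_lipschitz_compact_implies_lipschitz[OF this cK]
  obtain L where L: "L-lipschitz_on K F" by auto
  \<comment> \<open>The exponential weight turns the growth bound into monotonicity.\<close>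
  define f where "f r = ((\<gamma> r - \<eta> r) \<bullet> (\<gamma> r - \<eta> r)) * exp (- (2 * L * r))" for r
  have "f t \<le> f 0"
  proof (rule DERIV_nonpos_imp_decreasing_open[of 0 t f])
    show "0 \<le> t" using t by auto
    show "continuous_on {0..t} f" unfolding f_def
      by (intro continuous_intros continuous_on_subset[OF cg] continuous_on_subset[OF ch])
        (use t in auto)
    fix r assume r: "0 < r" "r < t"
    then have rT: "r \<in> {0..T}" and r': "0 < r" "r < T" using t by auto
    have dg: "(\<gamma> has_vector_derivative F (\<gamma> r)) (at r)"
      using g rT at_within_Icc_at[OF r'] unfolding solution_on_def by metis
    have dh: "(\<eta> has_vector_derivative F (\<eta> r)) (at r)"
      using h rT at_within_Icc_at[OF r'] unfolding solution_on_def by metis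
    let ?w = "\<gamma> r - \<eta> r" and ?F = "F (\<gamma> r) - F (\<eta> r)"
    have dw: "((\<lambda>r. \<gamma> r - \<eta> r) has_derivative (\<lambda>x. x *\<^sub>R ?F)) (at r)"
      using has_vector_derivative_diff[OF dg dh] by (simp add: has_vector_derivative_def)
    have "((\<lambda>r. (\<gamma> r - \<eta> r) \<bullet> (\<gamma> r - \<eta> r)) has_derivative (\<lambda>x. ?w \<bullet> (x *\<^sub>R ?F) + (x *\<^sub>R ?F) \<bullet> ?w)) (at r)"
      by (rule has_derivative_inner[OF dw dw])
    then have dq: "((\<lambda>r. (\<gamma> r - \<eta> r) \<bullet> (\<gamma> r - \<eta> r)) has_real_derivative 2 * (?w \<bullet> ?F)) (at r)"
      unfolding has_field_derivative_def
      by (rule has_derivative_eq_rhs) (auto simp: inner_commute algebra_simps fun_eq_iff)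
    have de: "((\<lambda>r. exp (- (2 * L * r))) has_real_derivative - (2 * L) * exp (- (2 * L * r))) (at r)"
      by (auto intro!: derivative_eq_intros)
    from DERIV_mult[OF dq de] have df: "(f has_real_derivative (2 * (?w \<bullet> ?F) - 2 * L * (?w \<bullet> ?w)) * exp (- (2 * L * r))) (at r)"
      unfolding f_def by (rule DERIV_cong) (simp add: left_diff_distrib)
    have "?w \<bullet> ?F \<le> norm ?w * norm ?F" by (rule norm_cauchy_schwarz)
    also have "\<dots> \<le> norm ?w * (L * norm ?w)"
      using lipschitz_onD[OF L, of "\<gamma> r" "\<eta> r"] rT
      by (intro mult_left_mono) (auto simp: K_def dist_norm)
    also have "\<dots> = L * (?w \<bullet> ?w)" by (simp add: dot_square_norm power2_eq_square)
    finally have "2 * (?w \<bullet> ?F) - 2 * L * (?w \<bullet> ?w) \<le> 0" by simp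
    then have "(2 * (?w \<bullet> ?F) - 2 * L * (?w \<bullet> ?w)) * exp (- (2 * L * r)) \<le> 0"
      by (rule mult_nonpos_nonneg) simp
    then show "\<exists>y. (f has_real_derivative y) (at r) \<and> y \<le> 0" using df by blast
  qed
  also have "f 0 = 0" using eq by (simp add: f_def)
  finally have "(\<gamma> t - \<eta> t) \<bullet> (\<gamma> t - \<eta> t) \<le> 0"
    by (simp add: f_def mult_le_0_iff)
  then show ?thesis
    by (metis antisym inner_eq_zero_iff inner_ge_zero right_minus_eq)
qed

section \<open>Arcs traversed in forward time, their reversal and translation\<close>

definition pos_arc ::
  "plane_field \<Rightarrow> real \<Rightarrow> real \<Rightarrow> real \<Rightarrow> real \<Rightarrow> (real \<Rightarrow> real \<times> real) \<Rightarrow> bool" where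
  "pos_arc F s u T v \<gamma> \<longleftrightarrow> 0 < T \<and> solution_on F (half_plane s) {0..T} \<gamma> \<and>
     \<gamma> 0 = (u, 0) \<and> \<gamma> T = (v, 0) \<and> (\<forall>t\<in>{0<..<T}. 0 < s * snd (\<gamma> t))"

lemma pos_arc_iff:
  assumes "s \<noteq> 0"
  shows "pos_arc F s u T v \<gamma> \<longleftrightarrow> 0 < T \<and> orbit_arc F (half_plane s) u T v \<gamma>"
proof -
  have "p \<in> half_plane s - switch_line \<longleftrightarrow> 0 < s * snd p" for p
    using assms by (auto simp: half_plane_def switch_line_def less_le)
  then show ?thesis
    by (auto simp: pos_arc_def orbit_arc_def closed_segment_eq_real_ivl open_segment_eq_real_ivl)
qed

lemma half_return_iff:
  "s \<noteq> 0 \<Longrightarrow> half_return F (half_plane s) u v \<longleftrightarrow> (\<exists>T \<gamma>. pos_arc F s u T v \<gamma>)"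
  by (auto simp: half_return_def pos_arc_iff)

lemma pos_arc_reverse:
  assumes "pos_arc F s u T v \<gamma>"
  shows "pos_arc (reverse_field F) s v T u (\<lambda>t. \<gamma> (T - t))"
  using assms unfolding pos_arc_def by (auto intro: solution_on_reverse)

lemma half_return_reverse:
  assumes "s \<noteq> 0"
  shows "half_return (reverse_field F) (half_plane s) u v \<longleftrightarrow> half_return F (half_plane s) v u"
  unfolding half_return_iff[OF assms]
  using pos_arc_reverse[of F] pos_arc_reverse[of "reverse_field F"] reverse_reverse_field by metis

text \<open>In (H1) one of the two arcs from a point is traversed in negative time. Moving the
  origin of time to its end makes it a forward arc from \<open>v\<close> back to \<open>u\<close>,
  the only form used afterwards.\<close>

lemma half_return_negative_time:
  assumes s: "s \<noteq> 0" and T: "T < 0" and a: "orbit_arc F (half_plane s) u T v \<gamma>"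
  shows "half_return F (half_plane s) v u"
proof -
  have seg: "closed_segment 0 T = {T..0}" "open_segment 0 T = {T<..<0}"
    using T by (auto simp: closed_segment_eq_real_ivl open_segment_eq_real_ivl)
  have p: "p \<in> half_plane s - switch_line \<longleftrightarrow> 0 < s * snd p" for p
    using s by (auto simp: half_plane_def switch_line_def less_le)
  have sol: "solution_on F (half_plane s) {0..- T} (\<lambda>t. \<gamma> (T + t))"
    unfolding solution_on_def
  proof (intro ballI conjI)
    fix t assume t: "t \<in> {0..- T}"
    show "\<gamma> (T + t) \<in> half_plane s"
      using a t by (auto simp: orbit_arc_def solution_on_def seg)
    have "(\<gamma> has_vector_derivative F (\<gamma> (T + t))) (at (T + t) within {T..0})"
      using a t by (auto simp: orbit_arc_def solution_on_def seg)
    then have d: "(\<gamma> has_vector_derivative F (\<gamma> (T + t))) (at (T + t) within (+) T ` {0..- T})"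
      by (rule has_vector_derivative_within_subset) auto
    have "((+) T has_vector_derivative 1) (at t within {0..- T})"
      by (auto intro!: derivative_eq_intros)
    from vector_diff_chain_within[OF this d]
    show "((\<lambda>t. \<gamma> (T + t)) has_vector_derivative F (\<gamma> (T + t))) (at t within {0..- T})"
      by (simp add: o_def)
  qed
  have "pos_arc F s v (- T) u (\<lambda>t. \<gamma> (T + t))"
    unfolding pos_arc_def
  proof (intro conjI ballI sol)
    fix t assume "t \<in> {0<..<- T}"
    then have "\<gamma> (T + t) \<in> half_plane s - switch_line"
      using a by (auto simp: orbit_arc_def seg)
    then show "0 < s * snd (\<gamma> (T + t))" by (simp only: p)
  qed (use a T in \<open>auto simp: orbit_arc_def\<close>)
  then show ?thesis using half_return_iff[OF s] by blast
qed

lemma solution_on_translate: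
  "solution_on (translate_field b F) (half_plane s) J \<gamma> \<longleftrightarrow>
   solution_on F (half_plane s) J (\<lambda>t. \<gamma> t - (b, 0))"
proof -
  have "((\<lambda>t. \<gamma> t - (b, 0)) has_vector_derivative y) (at t within J) \<longleftrightarrow>
      (\<gamma> has_vector_derivative y) (at t within J)" for t y
    using has_vector_derivative_diff_const[of \<gamma> "(b,0)" y "at t within J"] by simp
  then show ?thesis
    by (simp add: solution_on_def translate_field_def half_plane_def case_prod_beta minus_prod_def)
qed

lemma pos_arc_translate:
  "pos_arc (translate_field b F) s u T v \<gamma> \<longleftrightarrow> pos_arc F s (u - b) T (v - b) (\<lambda>t. \<gamma> t - (b, 0))"
proof -
  have "\<gamma> t = (w, 0) \<longleftrightarrow> \<gamma> t - (b, 0) = (w - b, 0)" for t w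
    by (cases "\<gamma> t") auto
  then show ?thesis
    by (simp add: pos_arc_def solution_on_translate)
qed

lemma half_return_translate:
  assumes "s \<noteq> 0"
  shows "half_return (translate_field b F) (half_plane s) u v \<longleftrightarrow> half_return F (half_plane s) (u - b) (v - b)"
  unfolding half_return_iff[OF assms] pos_arc_translate
proof
  assume "\<exists>T \<gamma>. pos_arc F s (u - b) T (v - b) \<gamma>"
  then obtain T \<gamma> where "pos_arc F s (u - b) T (v - b) \<gamma>" by blast
  then have "pos_arc F s (u - b) T (v - b) (\<lambda>t. (\<gamma> t + (b, 0)) - (b, 0))"
    by (simp only: add_diff_cancel)
  then show "\<exists>T \<gamma>. pos_arc F s (u - b) T (v - b) (\<lambda>t. \<gamma> t - (b, 0))"
    by (intro exI[of _ T] exI[of _ "\<lambda>t. \<gamma> t + (b, 0)"])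
qed blast

section \<open>Uniqueness of arcs, and arcs that meet\<close>

locale half_field =
  fixes F :: plane_field and s :: real
  assumes s: "s \<noteq> 0" and lip: "locally_lipschitz_field (half_plane s) F"
begin

lemma reverse: "half_field (reverse_field F) s"
  using s lip local_lipschitz_minus[of UNIV "half_plane s" "\<lambda>_. F"]
  by (auto simp: half_field_def locally_lipschitz_field_def reverse_field_def)

text \<open>If one curve came back to the line before the other, uniqueness would put the other on
  the line strictly inside its time interval. The common start may lie on the line or off it; the
  second case serves for what remains of two arcs after a common point.\<close>

lemma exit_unique:
  assumes g: "solution_on F (half_plane s) {0..T} \<gamma>" "0 < T" "\<forall>t\<in>{0<..<T}. 0 < s * snd (\<gamma> t)" "snd (\<gamma> T) = 0"
    and h: "solution_on F (half_plane s) {0..R} \<eta>" "0 < R" "\<forall>t\<in>{0<..<R}. 0 < s * snd (\<eta> t)" "snd (\<eta> R) = 0"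
    and eq: "\<gamma> 0 = \<eta> 0"
  shows "T = R \<and> (\<forall>t\<in>{0..T}. \<gamma> t = \<eta> t)"
proof -
  have agree: "\<gamma> t = \<eta> t" if "0 \<le> t" "t \<le> T" "t \<le> R" for t
    by (rule solution_on_unique[OF lip, where T = "min T R"])
      (use that eq in \<open>auto intro: solution_on_subset[OF g(1)] solution_on_subset[OF h(1)]\<close>)
  have "T = R"
  proof (rule linorder_cases[of T R])
    assume "T < R"
    then show ?thesis using agree[of T] g h by force
  next
    assume "R < T"
    then show ?thesis using agree[of R] g h by force
  qed
  then show ?thesis using agree by auto
qed

lemma pos_arc_unique:
  assumes "pos_arc F s u T v \<gamma>" "pos_arc F s u R w \<eta>"
  shows "T = R" "v = w" "\<forall>t\<in>{0..T}. \<gamma> t = \<eta> t"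
proof -
  have *: "T = R \<and> (\<forall>t\<in>{0..T}. \<gamma> t = \<eta> t)"
    using assms by (intro exit_unique) (auto simp: pos_arc_def)
  then show "T = R" "\<forall>t\<in>{0..T}. \<gamma> t = \<eta> t" by auto
  have "\<gamma> T = \<eta> R" using * assms by (auto simp: pos_arc_def)
  then show "v = w" using assms by (auto simp: pos_arc_def)
qed

lemma pos_arc_image_unique:
  assumes "pos_arc F s u T v \<gamma>" "pos_arc F s u R w \<eta>"
  shows "\<gamma> ` {0..T} = \<eta> ` {0..R}"
  using pos_arc_unique[OF assms] by auto

lemma half_return_unique:
  "half_return F (half_plane s) u v \<Longrightarrow> half_return F (half_plane s) u w \<Longrightarrow> v = w"
  unfolding half_return_iff[OF s] using pos_arc_unique(2) by blast

lemma half_return_unique_start: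
  "half_return F (half_plane s) u v \<Longrightarrow> half_return F (half_plane s) w v \<Longrightarrow> u = w"
  using half_field.half_return_unique[OF reverse] half_return_reverse[OF s] by blast

text \<open>Both arcs are restarted at the common point, and \<open>exit_unique\<close> applies to
  the remainders.\<close>

lemma pos_arcs_meet_end:
  assumes a: "pos_arc F s u T v \<gamma>" and b: "pos_arc F s u' R v' \<eta>"
    and t: "0 < t" "t < T" and r: "0 < r" "r < R" and eq: "\<gamma> t = \<eta> r"
  shows "v = v'"
proof -
  have *: "T - t = R - r \<and> (\<forall>x\<in>{0..T-t}. \<gamma> (t + x) = \<eta> (r + x))"
    using a b t r eq
    by (intro exit_unique) (auto simp: pos_arc_def intro!: solution_on_shift)
  then have "\<gamma> (t + (T - t)) = \<eta> (r + (R - r))"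
    using t by (metis atLeastAtMost_iff diff_ge_0_iff_ge less_imp_le order_refl)
  then show ?thesis using a b by (auto simp: pos_arc_def)
qed

lemma pos_arcs_meet:
  assumes a: "pos_arc F s u T v \<gamma>" and b: "pos_arc F s u' R v' \<eta>"
    and t: "0 < t" "t < T" and r: "0 < r" "r < R" and eq: "\<gamma> t = \<eta> r"
  shows "u = u'" "v = v'"
proof -
  show "v = v'" using assms by (rule pos_arcs_meet_end)
  show "u = u'"
    by (rule half_field.pos_arcs_meet_end[OF reverse pos_arc_reverse[OF a] pos_arc_reverse[OF b], of "T - t" "R - r"])
      (use t r eq in auto)
qed

text \<open>Brings an arc into the form required by the Fashoda meet theorem: a path in
  \<open>real^2\<close> in the closed upper half-plane, running from its left to its right end. The
  factor \<open>s\<close> folds both half-planes into one, and the path is reversed when the arc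
  runs leftwards.\<close>

lemma half_return_path:
  assumes "half_return F (half_plane s) p q"
  obtains f :: "real \<Rightarrow> real^2" and \<gamma> T where "pos_arc F s p T q \<gamma>" "path f"
    "pathstart f = vector [min p q, 0]" "pathfinish f = vector [max p q, 0]"
    "path_image f = (\<lambda>z. vector [fst z, s * snd z]) ` \<gamma> ` {0..T}"
proof -
  obtain T \<gamma> where a: "pos_arc F s p T q \<gamma>" using assms half_return_iff[OF s] by blast
  define m :: "real \<times> real \<Rightarrow> real^2" where "m z = vector [fst z, s * snd z]" for z
  define f where "f t = m (\<gamma> (T * t))" for t
  have m: "continuous_on A m" for A
  proof -
    have "m = (\<lambda>z. \<chi> i. if i = 1 then fst z else s * snd z)"
      by (auto simp: m_def fun_eq_iff vec_eq_iff forall_2)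
    moreover have "continuous_on A (\<lambda>z. if i = 1 then fst z else s * snd z)" for i :: 2
      by (cases "i = 1") (auto intro!: continuous_intros)
    ultimately show ?thesis by (auto intro!: continuous_on_vec_lambda)
  qed
  have T: "0 < T" and c: "continuous_on {0..T} \<gamma>"
    using a by (auto simp: pos_arc_def intro: solution_on_continuous)
  have im: "(*) T ` {0..1} = {0..T}"
    using T by (simp add: image_mult_atLeastAtMost)
  have "continuous_on {0..1} f"
    unfolding f_def
    by (rule continuous_on_compose2[OF m continuous_on_compose2[OF c]])
      (use im in \<open>auto intro!: continuous_intros\<close>)
  then have f: "path f" by (simp add: path_def)
  have pi: "path_image f = m ` \<gamma> ` {0..T}"
    unfolding path_image_def f_def im[symmetric] by (auto simp: image_image)
  have ps: "pathstart f = vector [p, 0]" "pathfinish f = vector [q, 0]"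
    using a by (auto simp: pathstart_def pathfinish_def f_def m_def pos_arc_def)
  show thesis
  proof (cases "p \<le> q")
    case True
    show ?thesis
      by (rule that[OF a f]) (use True ps pi in \<open>auto simp: m_def\<close>)
  next
    case False
    show ?thesis
      by (rule that[OF a, of "reversepath f"]) (use False ps pi f in \<open>auto simp: m_def\<close>)
  qed
qed

lemma half_returns_not_interlaced:
  assumes a: "half_return F (half_plane s) p q" and b: "half_return F (half_plane s) p' q'"
    and "min p q < min p' q'" "min p' q' < max p q" "max p q < max p' q'"
  shows False
proof -
  let ?m = "\<lambda>z. vector [fst z, s * snd z] :: real^2"
  from a obtain f :: "real \<Rightarrow> real^2" and \<gamma> T where f: "pos_arc F s p T q \<gamma>" "path f"
    "pathstart f = vector [min p q, 0]" "pathfinish f = vector [max p q, 0]"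
    "path_image f = ?m ` \<gamma> ` {0..T}" by (rule half_return_path)
  from b obtain g :: "real \<Rightarrow> real^2" and \<eta> R where g: "pos_arc F s p' R q' \<eta>" "path g"
    "pathstart g = vector [min p' q', 0]" "pathfinish g = vector [max p' q', 0]"
    "path_image g = ?m ` \<eta> ` {0..R}" by (rule half_return_path)
  have "bounded (path_image f \<union> path_image g)"
    using f(2) g(2) by (simp add: bounded_path_image)
  then obtain B where B: "\<And>z. z \<in> path_image f \<union> path_image g \<Longrightarrow> norm z \<le> B"
    unfolding bounded_iff by blast
  have nn: "0 \<le> z $ 2" if "z \<in> path_image f \<union> path_image g" for z
    using that f(1,5) g(1,5)
    by (auto simp: pos_arc_def solution_on_def half_plane_def)
  \<comment> \<open>A box whose lower edge lies on the axis: the four ends are on that edge in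
    alternating order.\<close>
  have box: "z \<in> cbox (vector [- B, 0]) (vector [B, B])" if "z \<in> path_image f \<union> path_image g" for z
    using B[OF that] nn[OF that] component_le_norm_cart[of z 1] component_le_norm_cart[of z 2]
    by (auto simp: mem_box_cart forall_2)
  obtain z where "z \<in> path_image f" "z \<in> path_image g"
    by (rule fashoda_interlace[OF f(2) g(2), of "vector [- B, 0]" "vector [B, B]"])
    (use box in blast, use box in blast, simp_all only: f(3,4) g(3,4) vector_2 assms(3-))
  then obtain t r where t: "t \<in> {0..T}" and r: "r \<in> {0..R}" and "?m (\<gamma> t) = ?m (\<eta> r)"
    using f(5) g(5) by auto
  then have "fst (\<gamma> t) = fst (\<eta> r)" "s * snd (\<gamma> t) = s * snd (\<eta> r)"
    by (metis vector_2(1), metis vector_2(2))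
  then have eq: "\<gamma> t = \<eta> r" using s by (simp add: prod_eq_iff)
  \<comment> \<open>A point of an arc is off the line exactly at interior times. So the common point
    is interior to both arcs, and then their ends coincide, or it is an end of both, against the
    strict order of the four ends.\<close>
  have tT: "0 < s * snd (\<gamma> t) \<longleftrightarrow> t \<in> {0<..<T}" and rR: "0 < s * snd (\<eta> r) \<longleftrightarrow> r \<in> {0<..<R}"
    using t r f(1) g(1) by (auto simp: pos_arc_def less_le)
  show False
  proof (cases "0 < s * snd (\<gamma> t)")
    case True
    then have "p = p'" using pos_arcs_meet(1)[OF f(1) g(1)] eq tT rR by auto
    moreover have "q = q'" using pos_arcs_meet(2)[OF f(1) g(1)] eq tT rR True by auto
    ultimately show False using assms by auto
  next
    case False
    then have "t = 0 \<or> t = T" "r = 0 \<or> r = R" using tT rR t r eq by auto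
    then show False using eq f(1) g(1) assms(3-) by (auto simp: pos_arc_def)
  qed
qed

text \<open>Otherwise \<open>s * snd\<close> would have a negative one-sided derivative at time 0
  and the arc would leave the half-plane at once. The inequality is not strict because an arc may
  start tangentially.\<close>

lemma pos_arc_start_direction:
  assumes "pos_arc F s u T v \<gamma>"
  shows "0 \<le> s * snd (F (u, 0))"
proof (rule ccontr)
  assume "\<not> ?thesis"
  then have neg: "s * snd (F (u, 0)) < 0" by simp
  have T: "0 < T" using assms by (simp add: pos_arc_def)
  have "(\<gamma> has_vector_derivative F (u, 0)) (at 0 within {0..T})"
    using assms T unfolding pos_arc_def solution_on_def by (metis atLeastAtMost_iff less_imp_le order_refl)
  then have "((\<lambda>t. s * snd (\<gamma> t)) has_vector_derivative s * snd (F (u, 0))) (at 0 within {0..T})"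
    unfolding has_vector_derivative_def
    by (auto intro!: derivative_eq_intros)
  then have "((\<lambda>t. s * snd (\<gamma> t)) has_real_derivative s * snd (F (u, 0))) (at 0 within {0..T})"
    by (simp add: has_real_derivative_iff_has_vector_derivative)
  from has_real_derivative_neg_dec_right[OF this neg]
  obtain d where d: "d > 0" "\<And>h. 0 < h \<Longrightarrow> 0 + h \<in> {0..T} \<Longrightarrow> h < d \<Longrightarrow> s * snd (\<gamma> (0 + h)) < s * snd (\<gamma> 0)"
    by blast
  have "s * snd (\<gamma> (min d T / 2)) < s * snd (\<gamma> 0)"
    using d(2)[of "min d T / 2"] d(1) T by auto
  moreover have "0 < s * snd (\<gamma> (min d T / 2))" "s * snd (\<gamma> 0) = 0"
    using assms d(1) T by (auto simp: pos_arc_def)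
  ultimately show False by simp
qed

end

section \<open>Arcs passing the line in a prescribed direction\<close>

context half_field
begin

text \<open>If an arc arrived at \<open>p\<close>, the field would be horizontal and nonzero at \<open>p\<close>. An arc departing
  from a point slightly upstream of \<open>p\<close> then starts under the arriving arc and is above the line when
  it has passed \<open>p\<close>, so the two arcs cross and, by uniqueness, both end at \<open>p\<close>.\<close>

lemma no_arrival_among_departures:
  assumes e: "0 < e"
    and out: "\<And>x. \<bar>x - p\<bar> < e \<Longrightarrow> \<exists>q. half_return F (half_plane s) x q \<and> e \<le> \<bar>q - p\<bar>"
    and arr: "half_return F (half_plane s) q p"
  shows False
proof -
  from out[of p] e obtain p' where "half_return F (half_plane s) p p'" by auto
  then obtain Tp \<gamma>p where gp: "pos_arc F s p Tp p' \<gamma>p" using half_return_iff[OF s] by blast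
  from arr obtain T c where c: "pos_arc F s q T p c" using half_return_iff[OF s] by blast
  have pS: "(p, 0) \<in> half_plane s" by (simp add: half_plane_def)
  have "0 \<le> s * snd (F (p, 0))" by (rule pos_arc_start_direction[OF gp])
  moreover have "0 \<le> s * snd (reverse_field F (p, 0))"
    by (rule half_field.pos_arc_start_direction[OF reverse pos_arc_reverse[OF c]])
  \<comment> \<open>The departing arc gives one inequality for the vertical component, the reversed
    arriving arc the opposite one.\<close>
  ultimately have Q0: "snd (F (p, 0)) = 0"
    using s by (auto simp: reverse_field_def)
  define g where "g = fst (F (p, 0))"
  \<comment> \<open>At an equilibrium the constant solution would be the only one starting at
    \<open>p\<close>, and no arc could depart.\<close>
  have "g \<noteq> 0"
  proof
    assume "g = 0"
    then have F0: "F (p, 0) = 0" using Q0 by (simp add: g_def prod_eq_iff)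
    have Tp: "0 < Tp" using gp by (simp add: pos_arc_def)
    have const: "solution_on F (half_plane s) {0..Tp} (\<lambda>_. (p, 0))"
      using pS F0 by (auto simp: solution_on_def)
    have "\<gamma>p (Tp / 2) = (p, 0)"
      by (rule solution_on_unique[OF lip _ const]) (use gp Tp in \<open>auto simp: pos_arc_def\<close>)
    then show False using gp Tp by (auto simp: pos_arc_def dest!: bspec[of _ _ "Tp / 2"])
  qed
  define k where "k = sgn g"
  have kk: "k * k = 1" and kg: "0 < k * g" using \<open>g \<noteq> 0\<close> by (auto simp: k_def sgn_if)
  have k1: "\<bar>k\<bar> = 1" using \<open>g \<noteq> 0\<close> by (auto simp: k_def sgn_if)
  have contF: "continuous_on (half_plane s) F"
    using local_lipschitz_continuous_on[OF lip[unfolded locally_lipschitz_field_def]] by auto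
  \<comment> \<open>Positivity of \<open>E\<close> says that the velocity points in the direction
    \<open>k\<close> at less than 45 degrees to the axis. By continuity this persists within
    distance \<open>r0\<close> of \<open>p\<close>.\<close>
  define E where "E z = k * fst (F z) - \<bar>snd (F z)\<bar>" for z
  have "continuous_on (half_plane s) E"
    unfolding E_def by (intro continuous_intros contF)
  moreover have E0: "0 < E (p, 0)" using Q0 kg by (simp add: E_def g_def)
  ultimately obtain r0 where r0: "r0 > 0" "\<And>z. z \<in> half_plane s \<Longrightarrow> dist z (p, 0) < r0 \<Longrightarrow> dist (E z) (E (p, 0)) < E (p, 0)"
    using pS unfolding continuous_on_iff by meson
  define r where "r = min r0 e / 2"
  have r: "0 < r" "r < e" "r < r0" using r0(1) e by (auto simp: r_def)
  have Epos: "\<bar>snd (F z)\<bar> < k * fst (F z)" if "z \<in> half_plane s" "dist z (p, 0) < r0" for z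
    using r0(2)[OF that] by (simp add: E_def dist_real_def abs_less_iff)
  have T: "0 < T" and csol: "solution_on F (half_plane s) {0..T} c"
    and cT: "c T = (p, 0)" and cpos: "\<And>t. 0 < t \<Longrightarrow> t < T \<Longrightarrow> 0 < s * snd (c t)"
    using c by (auto simp: pos_arc_def)
  have comp_deriv: "((\<lambda>t. k * fst (\<eta> t) + m * snd (\<eta> t)) has_real_derivative
      k * fst (F (\<eta> t)) + m * snd (F (\<eta> t))) (at t)"
    if "solution_on F (half_plane s) {0..R} \<eta>" "0 < t" "t < R" for \<eta> R t m
  proof -
    have "(\<eta> has_vector_derivative F (\<eta> t)) (at t)"
      using that at_within_Icc_at[of 0 t R] unfolding solution_on_def
      by (metis atLeastAtMost_iff less_imp_le)
    then show ?thesis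
      unfolding has_real_derivative_iff_has_vector_derivative has_vector_derivative_def
      by (auto intro!: derivative_eq_intros simp: algebra_simps)
  qed
  have contc: "continuous_on {0..T} c" using csol by (rule solution_on_continuous)
  obtain h where h: "0 < h" "h < T" "\<And>t. T - h \<le> t \<Longrightarrow> t \<le> T \<Longrightarrow> dist (c t) (p, 0) < r0"
  proof -
    obtain d where d: "d > 0" "\<And>t. t \<in> {0..T} \<Longrightarrow> dist t T < d \<Longrightarrow> dist (c t) (c T) < r0"
      using contc r0(1) T unfolding continuous_on_iff by (metis atLeastAtMost_iff less_imp_le order_refl)
    show ?thesis
      by (rule that[of "min d T / 2"]) (use d T cT in \<open>auto simp: dist_real_def\<close>)
  qed
  \<comment> \<open>Along the last piece of the arriving arc the abscissa, counted in the direction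
    \<open>k\<close>, increases strictly. That piece is therefore a graph over the axis, and
    \<open>g'\<close> recovers the time from the abscissa.\<close>
  define \<xi> where "\<xi> t = k * fst (c t)" for t
  have \<xi>cont: "continuous_on {T-h..T} \<xi>"
    unfolding \<xi>_def by (intro continuous_intros continuous_on_subset[OF contc]) (use h in auto)
  have \<xi>mono: "\<xi> a < \<xi> b" if "T - h \<le> a" "a < b" "b \<le> T" for a b
  proof (rule DERIV_pos_imp_increasing_open[OF \<open>a < b\<close>])
    show "continuous_on {a..b} \<xi>" by (rule continuous_on_subset[OF \<xi>cont]) (use that in auto)
    fix t assume t: "a < t" "t < b"
    have "c t \<in> half_plane s" using csol t that h by (auto simp: solution_on_def)
    then have "0 < k * fst (F (c t))" using Epos[of "c t"] h(3)[of t] t that by force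
    moreover have "(\<xi> has_real_derivative k * fst (F (c t))) (at t)"
      using comp_deriv[OF csol, of t 0] t that h by (simp add: \<xi>_def[abs_def])
    ultimately show "\<exists>y. (\<xi> has_real_derivative y) (at t) \<and> 0 < y" by blast
  qed
  have \<xi>T: "\<xi> T = k * p" by (simp add: \<xi>_def cT)
  define g' where "g' = the_inv_into {T-h..T} \<xi>"
  have inj: "inj_on \<xi> {T-h..T}"
    by (rule inj_onI) (metis \<xi>mono atLeastAtMost_iff less_irrefl linorder_neqE_linordered_idom)
  have g'\<xi>: "g' (\<xi> t) = t" if "t \<in> {T-h..T}" for t
    unfolding g'_def using the_inv_into_f_f[OF inj that] .
  have g'cont: "continuous_on (\<xi> ` {T-h..T}) g'"
    by (rule continuous_on_inv[OF \<xi>cont]) (auto simp: g'\<xi>)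
  have img: "y \<in> \<xi> ` {T-h..T}" if "\<xi> (T - h) \<le> y" "y \<le> k * p" for y
    using IVT'[of \<xi> "T - h" y T] that \<xi>T \<xi>cont h by force
  \<comment> \<open>The bound \<open>r / 4\<close> lets the departing arc pass \<open>p\<close>
    before it can leave the ball of radius \<open>r\<close>; the second bound places its start
    within the range of abscissas of the graph.\<close>
  define \<epsilon> where "\<epsilon> = min (r / 4) ((k * p - \<xi> (T - h)) / 2)"
  have \<epsilon>: "0 < \<epsilon>" "4 * \<epsilon> \<le> r" "\<xi> (T - h) < k * p - \<epsilon>"
    using r \<xi>mono[of "T-h" T] h \<xi>T by (auto simp: \<epsilon>_def min_def field_simps)
  define x where "x = p - k * \<epsilon>"
  have kx: "k * x = k * p - \<epsilon>" using kk by (simp add: x_def right_diff_distrib flip: mult.assoc)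
  have xp: "\<bar>x - p\<bar> = \<epsilon>" using k1 \<epsilon> by (simp add: x_def abs_mult)
  from out[of x] xp \<epsilon> r obtain q' where "half_return F (half_plane s) x q'" and q': "e \<le> \<bar>q' - p\<bar>"
    by auto
  then obtain R \<gamma> where a: "pos_arc F s x R q' \<gamma>" using half_return_iff[OF s] by blast
  have R: "0 < R" and sol: "solution_on F (half_plane s) {0..R} \<gamma>"
    and \<gamma>0: "\<gamma> 0 = (x, 0)" and \<gamma>R: "\<gamma> R = (q', 0)"
    and \<gamma>pos: "\<And>t. 0 < t \<Longrightarrow> t < R \<Longrightarrow> 0 < s * snd (\<gamma> t)"
    using a by (auto simp: pos_arc_def)
  have cont\<gamma>: "continuous_on {0..R} \<gamma>" using sol by (rule solution_on_continuous)
  \<comment> \<open>\<open>m = 1\<close> and \<open>m = - 1\<close> bound the height by the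
    horizontal distance covered; \<open>m = 0\<close> gives monotonicity of the abscissa.\<close>
  have comp_mono: "k * fst (\<gamma> 0) + m * snd (\<gamma> 0) \<le> k * fst (\<gamma> t) + m * snd (\<gamma> t)"
    if t: "0 \<le> t" "t \<le> R" and in_ball: "\<And>t'. 0 \<le> t' \<Longrightarrow> t' < t \<Longrightarrow> dist (\<gamma> t') (p, 0) < r" and m: "\<bar>m\<bar> \<le> 1" for t m
  proof (rule DERIV_nonneg_imp_increasing_open[of 0 t])
    show "continuous_on {0..t} (\<lambda>t. k * fst (\<gamma> t) + m * snd (\<gamma> t))"
      by (intro continuous_intros continuous_on_subset[OF cont\<gamma>]) (use t in auto)
    fix y assume y: "0 < y" "y < t"
    have "\<gamma> y \<in> half_plane s" using sol y t by (auto simp: solution_on_def)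
    then have *: "\<bar>snd (F (\<gamma> y))\<bar> < k * fst (F (\<gamma> y))" using Epos[of "\<gamma> y"] in_ball[of y] y r by force
    have "\<bar>m * snd (F (\<gamma> y))\<bar> \<le> \<bar>snd (F (\<gamma> y))\<bar>"
      using m by (simp add: abs_mult mult_left_le_one_le)
    then have "0 \<le> k * fst (F (\<gamma> y)) + m * snd (F (\<gamma> y))" using * by linarith
    then show "\<exists>d. ((\<lambda>t. k * fst (\<gamma> t) + m * snd (\<gamma> t)) has_real_derivative d) (at y) \<and> 0 \<le> d"
      using comp_deriv[OF sol, of y m] y t by force
  qed (use t in auto)
  define D where "D t = dist (\<gamma> t) (p, 0)" for t
  have Dcont: "continuous_on {0..R} D" unfolding D_def by (intro continuous_intros cont\<gamma>)
  \<comment> \<open>The first time at distance \<open>r\<close> from \<open>p\<close>. It exists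
    because the arc ends at distance at least \<open>e > r\<close>.\<close>
  obtain t2 where t2: "0 < t2" "t2 \<le> R" "D t2 = r" "\<And>t. 0 \<le> t \<Longrightarrow> t < t2 \<Longrightarrow> D t < r"
  proof -
    let ?C = "{t \<in> {0..R}. r \<le> D t}"
    have "closed ?C"
      by (intro continuous_closed_preimage_constant continuous_on_closed_Collect_le) 
         (use Dcont in \<open>auto intro!: continuous_intros\<close>)
    moreover have "R \<in> ?C"
      using q' r R \<gamma>R by (auto simp: D_def dist_prod_def dist_real_def)
    moreover have "bdd_below ?C" by (rule bdd_belowI[of _ 0]) auto
    ultimately have *: "Inf ?C \<in> ?C" by (intro closed_contains_Inf) auto
    have before: "D t < r" if "0 \<le> t" "t < Inf ?C" for t
    proof (rule ccontr)
      assume "\<not> D t < r"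
      then have "t \<in> ?C" using that * by auto
      then have "Inf ?C \<le> t" using \<open>bdd_below ?C\<close> by (rule cInf_lower)
      then show False using that by simp
    qed
    have D0: "D 0 < r" using \<gamma>0 xp \<epsilon> by (simp add: D_def dist_prod_def dist_real_def)
    then have pos: "0 < Inf ?C" using * by (cases "Inf ?C = 0") auto
    have "D (Inf ?C) \<le> r"
    proof (rule ccontr)
      assume "\<not> D (Inf ?C) \<le> r"
      then have "\<exists>t. 0 \<le> t \<and> t \<le> Inf ?C \<and> D t = r"
        using D0 * by (intro IVT') (auto intro: continuous_on_subset[OF Dcont])
      then obtain t where "0 \<le> t" "t \<le> Inf ?C" "D t = r" by blast
      then show False using before[of t] \<open>\<not> D (Inf ?C) \<le> r\<close> by (cases "t = Inf ?C") auto
    qed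
    then show ?thesis using that[of "Inf ?C"] * pos before by auto
  qed
  define X where "X = k * fst (\<gamma> t2) - k * x"
  have "\<bar>snd (\<gamma> t2)\<bar> \<le> X"
    using comp_mono[of t2 1] comp_mono[of t2 "-1"] t2 \<gamma>0 by (auto simp: X_def D_def)
  moreover have "r \<le> \<bar>fst (\<gamma> t2) - p\<bar> + \<bar>snd (\<gamma> t2)\<bar>"
    using t2(3) norm_Pair_le[of "fst (\<gamma> t2) - p" "snd (\<gamma> t2)"]
    by (cases "\<gamma> t2") (auto simp: D_def dist_norm)
  moreover have "\<bar>fst (\<gamma> t2) - p\<bar> = \<bar>k * fst (\<gamma> t2) - k * p\<bar>"
    using k1 by (simp add: abs_mult flip: right_diff_distrib)
  moreover have "k * fst (\<gamma> t2) - k * p = X - \<epsilon>" by (simp add: X_def kx)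
  \<comment> \<open>Had the arc not passed \<open>p\<close>, its height and its horizontal distance
    to \<open>p\<close> would both be at most \<open>\<epsilon>\<close>, which is incompatible with
    \<open>4 * \<epsilon> \<le> r\<close>.\<close>
  ultimately have past: "k * p < k * fst (\<gamma> t2)" using \<epsilon> by linarith
  have "continuous_on {0..t2} (\<lambda>t. k * fst (\<gamma> t))"
    by (intro continuous_intros continuous_on_subset[OF cont\<gamma>]) (use t2 in auto)
  then obtain t1 where t1: "0 \<le> t1" "t1 \<le> t2" "k * fst (\<gamma> t1) = k * p"
    using IVT'[of "\<lambda>t. k * fst (\<gamma> t)" 0 "k * p" t2] past kx \<epsilon> \<gamma>0 t2 by auto
  have t1': "0 < t1" "t1 < R"
    using t1 past kx \<gamma>0 t2 \<epsilon> by (auto simp: less_le)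
  have range: "\<xi> (T - h) \<le> k * fst (\<gamma> t) \<and> k * fst (\<gamma> t) \<le> k * p" if "0 \<le> t" "t \<le> t1" for t
  proof
    show "\<xi> (T - h) \<le> k * fst (\<gamma> t)"
      using comp_mono[of t 0] that t1 t2 \<gamma>0 kx \<epsilon> by (auto simp: D_def)
    have "k * fst (\<gamma> t) \<le> k * fst (\<gamma> t1)"
    proof (rule DERIV_nonneg_imp_increasing_open[OF that(2)])
      show "continuous_on {t..t1} (\<lambda>t. k * fst (\<gamma> t))"
        by (intro continuous_intros continuous_on_subset[OF cont\<gamma>]) (use that t1 t2 in auto)
      fix y assume y: "t < y" "y < t1"
      have "\<gamma> y \<in> half_plane s" using sol y that t1' by (auto simp: solution_on_def)
      then have "0 \<le> k * fst (F (\<gamma> y))"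
        using Epos[of "\<gamma> y"] t2(4)[of y] y that t1 r by (force simp: D_def)
      then show "\<exists>d. ((\<lambda>t. k * fst (\<gamma> t)) has_real_derivative d) (at y) \<and> 0 \<le> d"
        using comp_deriv[OF sol, of y 0] y that t1' by force
    qed
    then show "k * fst (\<gamma> t) \<le> k * p" using t1 by simp
  qed
  \<comment> \<open>Height of the arriving arc minus height of the departing one at the same
    abscissa, counted away from the line. It is positive at the start of the departing arc and
    negative over \<open>p\<close>, so the arcs meet in between.\<close>
  define f where "f t = s * snd (c (g' (k * fst (\<gamma> t)))) - s * snd (\<gamma> t)" for t
  have sub: "(\<lambda>t. k * fst (\<gamma> t)) ` {0..t1} \<subseteq> \<xi> ` {T-h..T}"
    using range img by fastforce
  have g'range: "g' y \<in> {T-h..T}" if "y \<in> \<xi> ` {T-h..T}" for y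
    using that g'\<xi> by auto
  have contf: "continuous_on {0..t1} f"
  proof -
    have c1: "continuous_on {0..t1} (\<lambda>t. k * fst (\<gamma> t))"
      by (intro continuous_intros continuous_on_subset[OF cont\<gamma>]) (use t1' in auto)
    have c2: "continuous_on {0..t1} (\<lambda>t. g' (k * fst (\<gamma> t)))"
      by (rule continuous_on_compose2[OF g'cont c1 sub])
    have "continuous_on {0..t1} (\<lambda>t. c (g' (k * fst (\<gamma> t))))"
    proof (rule continuous_on_compose2[OF contc c2], rule image_subsetI)
      fix t assume "t \<in> {0..t1}"
      then have "g' (k * fst (\<gamma> t)) \<in> {T-h..T}" using sub by (intro g'range) blast
      then show "g' (k * fst (\<gamma> t)) \<in> {0..T}" using h by simp
    qed
    then show ?thesis
      unfolding f_def by (intro continuous_intros continuous_on_subset[OF cont\<gamma>]) (use t1' in auto)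
  qed
  have meet: "\<exists>t. T - h \<le> t \<and> t \<le> T \<and> g' y = t \<and> \<xi> t = y" if "\<xi> (T - h) \<le> y" "y \<le> k * p" for y
    using img[OF that] g'\<xi> by fastforce
  have f0: "0 < f 0"
  proof -
    have "\<xi> (T - h) \<le> k * x" "k * x \<le> k * p" using kx \<epsilon> by auto
    from meet[OF this] obtain t where t: "T - h \<le> t" "t \<le> T" "g' (k * x) = t" "\<xi> t = k * x" by blast
    then have "t \<noteq> T" using \<xi>T kx \<epsilon> by auto
    then show ?thesis using t h cpos[of t] \<gamma>0 by (simp add: f_def)
  qed
  have f1: "f t1 < 0"
  proof -
    have "g' (k * p) = T" using g'\<xi>[of T] h \<xi>T by simp
    then show ?thesis unfolding f_def t1(3) using cT \<gamma>pos[OF t1'] by simp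
  qed
  obtain t where t: "0 \<le> t" "t \<le> t1" "f t = 0"
    using IVT2'[of f t1 0 0] contf f0 f1 t1' by auto
  then have t': "0 < t" "t < R" using f0 t1' by (auto simp: less_le)
  from meet[of "k * fst (\<gamma> t)"] range[OF t(1,2)] obtain \<sigma> where
    \<sigma>: "T - h \<le> \<sigma>" "\<sigma> \<le> T" "g' (k * fst (\<gamma> t)) = \<sigma>" "\<xi> \<sigma> = k * fst (\<gamma> t)" by blast
  have "snd (c \<sigma>) = snd (\<gamma> t)" using t(3) \<sigma> s by (simp add: f_def)
  moreover have "fst (c \<sigma>) = fst (\<gamma> t)" using \<sigma>(4) kk by (auto simp: \<xi>_def)
  ultimately have eq: "\<gamma> t = c \<sigma>" by (simp add: prod_eq_iff)
  have "\<sigma> \<noteq> T" using \<gamma>pos[OF t'] eq cT by auto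
  then have "q' = p" using \<sigma> h eq t' by (intro pos_arcs_meet(2)[OF a c, of t \<sigma>]) auto
  then show False using q' e by simp
qed

lemma no_departure_among_arrivals:
  assumes e: "0 < e"
    and out: "\<And>x. \<bar>x - p\<bar> < e \<Longrightarrow> \<exists>q. half_return F (half_plane s) q x \<and> e \<le> \<bar>q - p\<bar>"
  shows "\<not> half_return F (half_plane s) p q"
  using half_field.no_arrival_among_departures[OF reverse e, of p q] out
  unfolding half_return_reverse[OF s] by blast

end

section \<open>Classification of the arcs near the origin\<close>

definition map_region :: "(real \<Rightarrow> real) \<Rightarrow> real \<Rightarrow> real set" where
  "map_region \<phi> x0 = {0..<x0} \<union> \<phi> ` {0<..<x0}"

text \<open>In an oriented system the lower field fits with time forward and the upper one with time
  reversed, so that in both half-planes arcs depart from the positive side and arrive on the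
  negative side.\<close>

locale return_family = half_field +
  fixes \<phi> :: "real \<Rightarrow> real" and x0 :: real
  assumes x0: "0 < x0"
    and arc: "\<And>x. 0 < x \<Longrightarrow> x < x0 \<Longrightarrow> half_return F (half_plane s) x (\<phi> x)"
    and neg: "\<And>x. 0 < x \<Longrightarrow> x < x0 \<Longrightarrow> \<phi> x < 0"
    and zero: "\<phi> 0 = 0"
    and cont: "continuous_on {0..<x0} \<phi>"
begin

text \<open>If \<open>\<phi> y\<close> were not below \<open>\<phi> x\<close>, the intermediate
  value theorem would provide some \<open>z \<le> x\<close> with the same arrival point as
  \<open>y\<close>, against uniqueness in backward time.\<close>

lemma strictly_decreasing:
  assumes "0 \<le> x" "x < y" "y < x0"
  shows "\<phi> y < \<phi> x"
proof (rule ccontr)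
  assume n: "\<not> \<phi> y < \<phi> x"
  then have x: "0 < x" using assms neg[of y] zero by (cases "x = 0") auto
  have "\<exists>z. 0 \<le> z \<and> z \<le> x \<and> \<phi> z = \<phi> y"
    using n neg[of y] zero x assms
    by (intro IVT2') (auto intro: continuous_on_subset[OF cont])
  then obtain z where z: "0 \<le> z" "z \<le> x" "\<phi> z = \<phi> y" by blast
  then have "0 < z" using zero neg[of y] assms by (cases "z = 0") auto
  then have "z = y" using half_return_unique_start[of z "\<phi> z" y] arc[of z] arc[of y] z assms by auto
  then show False using z assms by simp
qed

lemma tendsto_0: "(\<phi> \<longlongrightarrow> 0) (at_right 0)"
proof -
  have "(\<phi> \<longlongrightarrow> \<phi> 0) (at 0 within {0..<x0})" using cont x0 by (auto simp: continuous_on_def)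
  then have "(\<phi> \<longlongrightarrow> \<phi> 0) (at 0 within {0..x0 / 2})"
    by (rule tendsto_within_subset) (use x0 in auto)
  then show ?thesis using x0 zero at_within_Icc_at_right[of 0 "x0 / 2"] by simp
qed

lemma isCont: "0 < x \<Longrightarrow> x < x0 \<Longrightarrow> isCont \<phi> x"
  by (rule continuous_on_interior[OF cont]) simp

lemma exists_preimage:
  assumes "\<phi> x < y" "y < 0" "0 < x" "x < x0"
  shows "\<exists>z. 0 < z \<and> z < x \<and> \<phi> z = y"
proof -
  have "\<exists>z. 0 \<le> z \<and> z \<le> x \<and> \<phi> z = y"
    using assms zero by (intro IVT2') (auto intro: continuous_on_subset[OF cont])
  then obtain z where "0 \<le> z" "z \<le> x" "\<phi> z = y" by blast
  then show ?thesis using assms zero by (intro exI[of _ z]) (auto simp: less_le)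
qed

text \<open>The ends of a small arc of the family lie on either side of the origin and close to it,
  so they interlace with the ends of any arc that has exactly one end there. A loop, with
  \<open>p = q\<close>, escapes this argument.\<close>

lemma no_arc_at_origin:
  assumes "half_return F (half_plane s) p q" "p \<noteq> q"
  shows "p \<noteq> 0 \<and> q \<noteq> 0"
proof (rule ccontr)
  assume "\<not> ?thesis"
  then obtain u where u: "u \<noteq> 0" "min p q = min 0 u" "max p q = max 0 u"
    using assms(2) by (metis max.commute min.commute)
  show False
  proof (cases "0 < u")
    case True
    define x where "x = min u x0 / 2"
    have x: "0 < x" "x < u" "x < x0" using True x0 by (auto simp: x_def min_def field_simps)
    show False
      by (rule half_returns_not_interlaced[OF arc[OF x(1,3)] assms(1)])
        (use u True x neg[of x] in auto)
  next
    case False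
    have "\<forall>\<^sub>F x in at_right 0. u < \<phi> x" using tendsto_0 False u by (intro order_tendstoD) auto
    moreover have "\<forall>\<^sub>F x in at_right 0. x \<in> {0<..<x0}" using x0 by (rule eventually_at_right_real)
    ultimately have "\<forall>\<^sub>F x in at_right 0. u < \<phi> x \<and> x \<in> {0<..<x0}" by (rule eventually_conj)
    then obtain x where x: "u < \<phi> x" "0 < x" "x < x0"
      using eventually_happens[of _ "at_right (0::real)"] by (auto simp: trivial_limit_at_right_real)
    show False
      by (rule half_returns_not_interlaced[OF assms(1) arc[OF x(2,3)]])
        (use u False x neg[of x] in auto)
  qed
qed

text \<open>All points near \<open>q\<close> are starts of arcs that end on the negative side, hence
  at distance more than \<open>q\<close> from \<open>q\<close>.\<close>

lemma no_arrival:
  assumes "0 < q" "q < x0"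
  shows "\<not> half_return F (half_plane s) p q"
proof
  assume "half_return F (half_plane s) p q"
  then show False
  proof (rule no_arrival_among_departures[rotated 2])
    show "0 < min q (x0 - q)" using assms by simp
    fix x assume "\<bar>x - q\<bar> < min q (x0 - q)"
    then have x: "0 < x" "x < x0" by auto
    show "\<exists>q'. half_return F (half_plane s) x q' \<and> min q (x0 - q) \<le> \<bar>q' - q\<bar>"
      using arc[OF x] neg[OF x] assms by (intro exI[of _ "\<phi> x"]) auto
  qed
qed

text \<open>By monotonicity and continuity \<open>\<phi>\<close> covers a neighbourhood of
  \<open>\<phi> x\<close>, so all points there are arrival points of arcs from the positive side.
  The auxiliary \<open>y\<close> beyond \<open>x\<close> provides the part of the neighbourhood to
  the left.\<close>

lemma no_departure:
  assumes "0 < x" "x < x0"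
  shows "\<not> half_return F (half_plane s) (\<phi> x) q"
proof -
  define y where "y = (x + x0) / 2"
  have y: "x < y" "y < x0" using assms by (auto simp: y_def)
  define e where "e = min (\<phi> x - \<phi> y) (- \<phi> x)"
  have e: "0 < e" using strictly_decreasing[of x y] neg[of x] y assms by (auto simp: e_def)
  show ?thesis
  proof (rule no_departure_among_arrivals[OF e])
    fix w assume w: "\<bar>w - \<phi> x\<bar> < e"
    have "\<phi> y < w" "w < 0" using w by (auto simp: e_def)
    then obtain z where z: "0 < z" "z < y" "\<phi> z = w" using exists_preimage[of y w] y assms by auto
    show "\<exists>q. half_return F (half_plane s) q w \<and> e \<le> \<bar>q - \<phi> x\<bar>"
      using arc[of z] z y assms neg[of x] by (intro exI[of _ z]) (auto simp: e_def)
  qed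
qed

text \<open>A positive end can only be a start and an end in the image of \<open>\<phi>\<close> can
  only be an arrival; uniqueness in the respective direction of time then identifies the
  arc.\<close>

lemma arc_classification:
  assumes a: "half_return F (half_plane s) p q" and ne: "p \<noteq> q"
    and reg: "p \<in> map_region \<phi> x0 \<or> q \<in> map_region \<phi> x0"
  shows "0 < p \<and> p < x0 \<and> q = \<phi> p"
proof -
  have 0: "p \<noteq> 0" "q \<noteq> 0" using no_arc_at_origin[OF a ne] by auto
  show ?thesis
    using reg
  proof
    assume "p \<in> map_region \<phi> x0"
    then consider "0 < p" "p < x0" | x where "0 < x" "x < x0" "p = \<phi> x"
      using 0 by (auto simp: map_region_def less_le)
    then show ?thesis
    proof cases
      case 1
      then show ?thesis using half_return_unique[OF a arc] by blast
    next
      case 2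
      then show ?thesis using no_departure a by blast
    qed
  next
    assume "q \<in> map_region \<phi> x0"
    then consider "0 < q" "q < x0" | x where "0 < x" "x < x0" "q = \<phi> x"
      using 0 by (auto simp: map_region_def less_le)
    then show ?thesis
    proof cases
      case 1
      then show ?thesis using no_arrival a by blast
    next
      case 2
      then have "p = x" using half_return_unique_start[OF a, of x] arc by auto
      then show ?thesis using 2 by simp
    qed
  qed
qed

lemma ball_in_map_region: "\<exists>r>0. \<forall>p. \<bar>p\<bar> < r \<longrightarrow> p \<in> map_region \<phi> x0"
proof -
  define x where "x = x0 / 2"
  have x: "0 < x" "x < x0" using x0 by (auto simp: x_def)
  have "p \<in> map_region \<phi> x0" if p: "\<bar>p\<bar> < min x (- \<phi> x)" for p
  proof (cases "0 \<le> p")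
    case False
    then obtain z where "0 < z" "z < x" "\<phi> z = p" using exists_preimage[of x p] p x by auto
    then show ?thesis using x by (auto simp: map_region_def)
  qed (use p x in \<open>auto simp: map_region_def\<close>)
  then show ?thesis using x neg[of x] by (intro exI[of _ "min x (- \<phi> x)"]) auto
qed

end

section \<open>Implicitly defined return maps\<close>

lemma strictly_decreasing_inverse:
  fixes B :: "real \<Rightarrow> real"
  assumes w: "w \<in> {l<..<r}" and cont: "continuous_on {l<..<r} B"
    and dec: "\<And>x y. l < x \<Longrightarrow> x < y \<Longrightarrow> y < r \<Longrightarrow> B y < B x"
  obtains G e where "0 < e" "\<And>y. \<bar>y - B w\<bar> < e \<Longrightarrow> G y \<in> {l<..<r} \<and> B (G y) = y"
    "G (B w) = w" "isCont G (B w)"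
proof -
  define d where "d = min (w - l) (r - w) / 2"
  have d: "0 < d" "l < w - d" "w + d < r" using w by (auto simp: d_def min_def field_simps)
  define G where "G = the_inv_into {w-d..w+d} B"
  have inj: "inj_on B {w-d..w+d}"
  proof (rule linorder_inj_onI')
    fix i j assume "i \<in> {w-d..w+d}" "j \<in> {w-d..w+d}" "i < j"
    then show "B i \<noteq> B j" using dec[of i j] d by auto
  qed
  have GB: "G (B z) = z" if "\<bar>z - w\<bar> \<le> d" for z
    unfolding G_def by (rule the_inv_into_f_f[OF inj]) (use that in auto)
  have 1: "isCont G (B w)"
  proof (rule isCont_inverse_function[of d w G B, OF d(1) GB])
    fix z assume "\<bar>z - w\<bar> \<le> d"
    then have "z \<in> {l<..<r}" using d by auto
    then show "isCont B z" using cont by (simp add: continuous_on_eq_continuous_at)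
  qed
  define e where "e = min (B w - B (w + d)) (B (w - d) - B w)"
  have e: "0 < e" using dec[of w "w + d"] dec[of "w - d" w] d by (auto simp: e_def)
  have 2: "G y \<in> {l<..<r} \<and> B (G y) = y" if y: "\<bar>y - B w\<bar> < e" for y
  proof -
    have "\<exists>z. w - d \<le> z \<and> z \<le> w + d \<and> B z = y"
      using y d by (intro IVT2') (auto simp: e_def intro: continuous_on_subset[OF cont])
    then obtain z where "w - d \<le> z" "z \<le> w + d" "B z = y" by blast
    then show ?thesis using GB[of z] d by auto
  qed
  show thesis using that[OF e 2 GB[of w] 1] d by simp
qed

text \<open>\<open>\<kappa>\<close> is \<open>A\<close> followed by the local inverse of
  \<open>B\<close>. Strict monotonicity of \<open>B\<close>, rather than a nonzero derivative,
  carries existence and continuity, because the derivative of a half-return map may vanish at a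
  tangency.\<close>

lemma solve_decreasing:
  fixes A B :: "real \<Rightarrow> real"
  assumes w: "w \<in> {l<..<r}" and cont: "continuous_on {l<..<r} B"
    and dec: "\<And>x y. l < x \<Longrightarrow> x < y \<Longrightarrow> y < r \<Longrightarrow> B y < B x"
    and A: "isCont A x" and eq: "A x = B w"
  obtains \<kappa> where "\<kappa> x = w" "isCont \<kappa> x" "\<forall>\<^sub>F u in nhds x. \<forall>w. w \<in> {l<..<r} \<and> A u = B w \<longleftrightarrow> w = \<kappa> u"
    "\<And>a b. (A has_real_derivative a) (at x) \<Longrightarrow> (B has_real_derivative b) (at w) \<Longrightarrow> b \<noteq> 0 \<Longrightarrow>
       (\<kappa> has_real_derivative a / b) (at x)"
proof -
  obtain G e where G: "0 < e" "\<And>y. \<bar>y - B w\<bar> < e \<Longrightarrow> G y \<in> {l<..<r} \<and> B (G y) = y"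
    "G (B w) = w" "isCont G (B w)"
    by (rule strictly_decreasing_inverse[OF w cont dec]) blast+
  have inj: "u = v" if "u \<in> {l<..<r}" "v \<in> {l<..<r}" "B u = B v" for u v
    using dec[of u v] dec[of v u] that by (cases u v rule: linorder_cases) auto
  show thesis
  proof (rule that[of "\<lambda>u. G (A u)"])
    show "G (A x) = w" using G eq by simp
    show "isCont (\<lambda>u. G (A u)) x" using isCont_o2[OF A] G(4) eq by simp
    have "(A \<longlongrightarrow> A x) (nhds x)" using A by (simp add: isCont_def tendsto_at_iff_tendsto_nhds)
    then have "\<forall>\<^sub>F u in nhds x. dist (A u) (A x) < e" using G(1) by (rule tendstoD)
    then show "\<forall>\<^sub>F u in nhds x. \<forall>w. w \<in> {l<..<r} \<and> A u = B w \<longleftrightarrow> w = G (A u)"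
    proof eventually_elim
      case (elim u)
      then have "G (A u) \<in> {l<..<r} \<and> B (G (A u)) = A u" using G(2) eq by (simp add: dist_real_def)
      then show ?case using inj by metis
    qed
    fix a b assume a: "(A has_real_derivative a) (at x)" and b: "(B has_real_derivative b) (at w)" "b \<noteq> 0"
    have "(G has_real_derivative inverse b) (at (B w))"
      by (rule DERIV_inverse_function[where f = B and a = "B w - e" and b = "B w + e"])
        (use G b in \<open>auto simp: abs_less_iff\<close>)
    then have "((\<lambda>u. G (A u)) has_real_derivative inverse b * a) (at x)"
      using a eq DERIV_chain2 by metis
    then show "((\<lambda>u. G (A u)) has_real_derivative a / b) (at x)" by (simp add: field_simps)
  qed
qed

text \<open>With a relation in place of the fields, reversing time amounts to exchanging the two
  arguments, and the same statements serve for a return map and its inverse.\<close>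

definition rel_return_map :: "(real \<Rightarrow> real \<Rightarrow> bool) \<Rightarrow> real \<Rightarrow> (real \<Rightarrow> real) \<Rightarrow> bool" where
  "rel_return_map R x \<pi> \<longleftrightarrow> \<pi> x = x \<and> (\<forall>\<^sub>F u in nhds x. \<forall>w. R u w \<longleftrightarrow> w = \<pi> u)"

definition rel_hyperbolic :: "(real \<Rightarrow> real \<Rightarrow> bool) \<Rightarrow> real \<Rightarrow> bool" where
  "rel_hyperbolic R x \<longleftrightarrow>
     (\<exists>\<pi>. rel_return_map R x \<pi> \<and>
        ((\<exists>d. d \<noteq> 1 \<and> (\<pi> has_real_derivative d) (at x)) \<or>
         filterlim (\<lambda>u. (\<pi> u - \<pi> x) / (u - x)) at_top (at x)))"

definition rel_stable :: "(real \<Rightarrow> real \<Rightarrow> bool) \<Rightarrow> real \<Rightarrow> bool" where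
  "rel_stable R x \<longleftrightarrow>
     (\<exists>\<pi>. rel_return_map R x \<pi> \<and>
        (\<forall>e>0. \<exists>d>0. \<forall>u. \<bar>u - x\<bar> < d \<longrightarrow>
           (\<forall>n. \<bar>(\<pi> ^^ n) u - x\<bar> < e) \<and> (\<lambda>n. (\<pi> ^^ n) u) \<longlonglongrightarrow> x))"

text \<open>Any \<open>q\<close> strictly between \<open>\<bar>d\<bar>\<close> and 1 is a
  contraction factor towards \<open>x\<close> on a small interval, which the iterates never
  leave.\<close>

lemma contraction_iterates:
  fixes \<pi> :: "real \<Rightarrow> real"
  assumes fp: "\<pi> x = x" and d: "(\<pi> has_real_derivative d) (at x)" "\<bar>d\<bar> < 1" and e: "0 < e"
  shows "\<exists>r>0. \<forall>u. \<bar>u - x\<bar> < r \<longrightarrow> (\<forall>n. \<bar>(\<pi> ^^ n) u - x\<bar> < e) \<and> (\<lambda>n. (\<pi> ^^ n) u) \<longlonglongrightarrow> x"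
proof -
  define q where "q = (\<bar>d\<bar> + 1) / 2"
  have q: "0 \<le> q" "q < 1" "\<bar>d\<bar> < q" using d(2) by (auto simp: q_def)
  have "((\<lambda>u. \<bar>(\<pi> u - \<pi> x) / (u - x)\<bar>) \<longlongrightarrow> \<bar>d\<bar>) (at x)"
    using d(1) unfolding has_field_derivative_iff by (intro tendsto_rabs)
  then have "\<forall>\<^sub>F u in at x. \<bar>(\<pi> u - \<pi> x) / (u - x)\<bar> < q" using q(3) by (rule order_tendstoD)
  then obtain r0 where r0: "r0 > 0" "\<And>u. u \<noteq> x \<Longrightarrow> dist u x < r0 \<Longrightarrow> \<bar>(\<pi> u - \<pi> x) / (u - x)\<bar> < q"
    unfolding eventually_at by auto
  have contr: "\<bar>\<pi> u - x\<bar> \<le> q * \<bar>u - x\<bar>" if "\<bar>u - x\<bar> < r0" for u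
  proof (cases "u = x")
    case False
    then have "\<bar>\<pi> u - x\<bar> / \<bar>u - x\<bar> < q" using r0(2)[of u] that fp by (simp add: dist_real_def abs_divide)
    then show ?thesis using False by (simp add: divide_simps)
  qed (simp add: fp)
  have iter: "\<bar>(\<pi> ^^ n) u - x\<bar> \<le> q ^ n * \<bar>u - x\<bar>" if "\<bar>u - x\<bar> < r0" for u n
  proof (induction n)
    case (Suc n)
    have "q ^ n * \<bar>u - x\<bar> \<le> 1 * \<bar>u - x\<bar>" using q by (intro mult_right_mono power_le_one) auto
    then have "\<bar>(\<pi> ^^ n) u - x\<bar> \<le> \<bar>u - x\<bar>" using Suc by simp
    then have "\<bar>(\<pi> ^^ n) u - x\<bar> < r0" using that by (rule le_less_trans)
    then have "\<bar>\<pi> ((\<pi> ^^ n) u) - x\<bar> \<le> q * \<bar>(\<pi> ^^ n) u - x\<bar>" by (rule contr)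
    also have "\<dots> \<le> q * (q ^ n * \<bar>u - x\<bar>)" using Suc q by (intro mult_left_mono) auto
    finally show ?case by simp
  qed simp
  show ?thesis
  proof (intro exI[of _ "min r0 e"] conjI allI impI)
    fix u assume u: "\<bar>u - x\<bar> < min r0 e"
    show "\<bar>(\<pi> ^^ n) u - x\<bar> < e" for n
    proof -
      have "q ^ n * \<bar>u - x\<bar> \<le> 1 * \<bar>u - x\<bar>" using q by (intro mult_right_mono power_le_one) auto
      then have "\<bar>(\<pi> ^^ n) u - x\<bar> \<le> \<bar>u - x\<bar>" using iter[of u n] u by simp
      then show ?thesis using u by simp
    qed
    have "(\<lambda>n. q ^ n * \<bar>u - x\<bar>) \<longlonglongrightarrow> 0 * \<bar>u - x\<bar>"
      using q by (intro tendsto_mult tendsto_const LIMSEQ_power_zero) auto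
    then have lim: "(\<lambda>n. q ^ n * \<bar>u - x\<bar>) \<longlonglongrightarrow> 0" by simp
    have "\<forall>\<^sub>F n in sequentially. norm ((\<pi> ^^ n) u - x) \<le> q ^ n * \<bar>u - x\<bar>"
      using iter[of u] u by simp
    from Lim_null_comparison[OF this lim]
    have "(\<lambda>n. (\<pi> ^^ n) u - x) \<longlonglongrightarrow> 0" .
    then show "(\<lambda>n. (\<pi> ^^ n) u) \<longlonglongrightarrow> x" by (simp add: LIM_zero_iff)
  qed (use r0(1) e in auto)
qed

text \<open>The relation \<open>A u = B w\<close> defines mutually inverse local maps with
  multipliers \<open>a / b\<close> and \<open>b / a\<close>. As \<open>b < a \<le> 0\<close>, the
  first lies in [0, 1); the second is greater than 1, or infinite when \<open>a = 0\<close>.\<close>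

lemma implicit_return_map:
  fixes A B :: "real \<Rightarrow> real" and R :: "real \<Rightarrow> real \<Rightarrow> bool"
  assumes x: "x \<in> {l<..<r}" "x \<in> {l'<..<r'}"
    and contA: "continuous_on {l<..<r} A" and contB: "continuous_on {l'<..<r'} B"
    and decA: "\<And>x y. l < x \<Longrightarrow> x < y \<Longrightarrow> y < r \<Longrightarrow> A y < A x"
    and decB: "\<And>x y. l' < x \<Longrightarrow> x < y \<Longrightarrow> y < r' \<Longrightarrow> B y < B x"
    and eq: "A x = B x"
    and a: "(A has_real_derivative a) (at x)" "a \<le> 0"
    and b: "(B has_real_derivative b) (at x)" "b < a"
    and R: "\<forall>\<^sub>F u in nhds x. \<forall>w. R u w \<longleftrightarrow> w \<in> {l'<..<r'} \<and> A u = B w"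
    and R': "\<forall>\<^sub>F w in nhds x. \<forall>u. R u w \<longleftrightarrow> u \<in> {l<..<r} \<and> A u = B w"
  shows "rel_stable R x" "rel_hyperbolic R x" "rel_hyperbolic (\<lambda>u w. R w u) x"
proof -
  have cA: "isCont A x" and cB: "isCont B x" using a b DERIV_isCont by blast+
  obtain \<kappa> where \<kappa>: "\<kappa> x = x" "\<forall>\<^sub>F u in nhds x. \<forall>w. w \<in> {l'<..<r'} \<and> A u = B w \<longleftrightarrow> w = \<kappa> u"
    "\<And>a b. (A has_real_derivative a) (at x) \<Longrightarrow> (B has_real_derivative b) (at x) \<Longrightarrow> b \<noteq> 0 \<Longrightarrow>
       (\<kappa> has_real_derivative a / b) (at x)"
    by (rule solve_decreasing[OF x(2) contB decB cA eq]) blast+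
  have map: "rel_return_map R x \<kappa>"
    unfolding rel_return_map_def
  proof
    show "\<forall>\<^sub>F u in nhds x. \<forall>w. R u w \<longleftrightarrow> w = \<kappa> u"
      using R \<kappa>(2) by eventually_elim metis
  qed (rule \<kappa>(1))
  have d\<kappa>: "(\<kappa> has_real_derivative a / b) (at x)" using \<kappa>(3) a b by auto
  have ab: "\<bar>a / b\<bar> < 1" using a(2) b(2) by (simp add: abs_divide)
  show "rel_stable R x"
    unfolding rel_stable_def using map contraction_iterates[OF \<kappa>(1) d\<kappa> ab] by blast
  have "a / b \<noteq> 1" using ab by auto
  then show "rel_hyperbolic R x"
    unfolding rel_hyperbolic_def using map d\<kappa> by blast
  obtain \<pi> where \<pi>: "\<pi> x = x" "isCont \<pi> x" "\<forall>\<^sub>F w in nhds x. \<forall>u. u \<in> {l<..<r} \<and> B w = A u \<longleftrightarrow> u = \<pi> w"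
    "\<And>b a. (B has_real_derivative b) (at x) \<Longrightarrow> (A has_real_derivative a) (at x) \<Longrightarrow> a \<noteq> 0 \<Longrightarrow>
       (\<pi> has_real_derivative b / a) (at x)"
    by (rule solve_decreasing[OF x(1) contA decA cB eq[symmetric]]) blast+
  have map': "rel_return_map (\<lambda>u w. R w u) x \<pi>"
    unfolding rel_return_map_def
  proof
    show "\<forall>\<^sub>F w in nhds x. \<forall>u. R u w \<longleftrightarrow> u = \<pi> w"
      using R' \<pi>(3) by eventually_elim metis
  qed (rule \<pi>(1))
  show "rel_hyperbolic (\<lambda>u w. R w u) x"
  proof (cases "a = 0")
    case False
    then have "b / a \<noteq> 1" using b by auto
    then show ?thesis unfolding rel_hyperbolic_def using map' \<pi>(4)[OF b(1) a(1) False] by blast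
  next
    case True
    have ev: "\<forall>\<^sub>F w in at x. \<pi> w \<in> {l<..<r} \<and> B w = A (\<pi> w) \<and> w \<in> {l'<..<r'} \<and> w \<noteq> x"
    proof -
      have "\<forall>\<^sub>F w in at x. w \<in> {l'<..<r'}" using x(2) by (intro eventually_at_in_open') auto
      moreover have "\<forall>\<^sub>F w in at x. w \<noteq> x" by (simp add: eventually_at_filter)
      moreover have "\<forall>\<^sub>F w in at x. \<forall>u. u \<in> {l<..<r} \<and> B w = A u \<longleftrightarrow> u = \<pi> w"
        using \<pi>(3) eventually_nhds_conv_at by blast
      ultimately show ?thesis by eventually_elim blast
    qed
    have ne: "\<pi> w \<noteq> x" if "B w = A (\<pi> w)" "w \<in> {l'<..<r'}" "w \<noteq> x" for w
      using that eq x decB[of w x] decB[of x w] by (cases w x rule: linorder_cases) auto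
    have lim\<pi>: "filterlim \<pi> (at x) (at x)"
      unfolding filterlim_at
    proof
      show "\<forall>\<^sub>F w in at x. \<pi> w \<in> UNIV \<and> \<pi> w \<noteq> x" using ev by eventually_elim (use ne in auto)
      show "filterlim \<pi> (nhds x) (at x)" using \<pi>(1,2) by (simp add: isCont_def)
    qed
    have "((\<lambda>u. (A u - A x) / (u - x)) \<longlongrightarrow> 0) (at x)"
      using a(1) True by (simp add: has_field_derivative_iff)
    then have den: "((\<lambda>w. - ((A (\<pi> w) - A x) / (\<pi> w - x))) \<longlongrightarrow> - 0) (at x)"
      by (intro tendsto_minus filterlim_compose[OF _ lim\<pi>])
    have num: "((\<lambda>w. - ((B w - B x) / (w - x))) \<longlongrightarrow> - b) (at x)"
      using b(1) by (intro tendsto_minus) (simp add: has_field_derivative_iff)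
    \<comment> \<open>The sign matters: only a denominator tending to 0 from above makes the
      quotient below tend to \<open>at_top\<close>.\<close>
    have pos: "\<forall>\<^sub>F w in at x. 0 < - ((A (\<pi> w) - A x) / (\<pi> w - x))"
      using ev
    proof eventually_elim
      case (elim w)
      then have "\<pi> w \<noteq> x" using ne by blast
      then show ?case
        using elim x decA[of "\<pi> w" x] decA[of x "\<pi> w"]
        by (cases "\<pi> w" x rule: linorder_cases) (auto simp: divide_pos_neg divide_neg_pos)
    qed
    \<comment> \<open>The difference quotient of \<open>\<pi>\<close> at \<open>w\<close> is that of
      \<open>B\<close> at \<open>w\<close> divided by that of \<open>A\<close> at
      \<open>\<pi> w\<close>; the former tends to \<open>b < 0\<close>, the latter to 0.\<close>
    have "filterlim (\<lambda>w. - ((B w - B x) / (w - x)) / - ((A (\<pi> w) - A x) / (\<pi> w - x))) at_top (at x)"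
      by (rule LIM_at_top_divide[OF num _ _ pos]) (use den b True in auto)
    moreover have "\<forall>\<^sub>F w in at x. - ((B w - B x) / (w - x)) / - ((A (\<pi> w) - A x) / (\<pi> w - x)) = (\<pi> w - \<pi> x) / (w - x)"
      using ev
    proof eventually_elim
      case (elim w)
      then have *: "\<pi> w \<noteq> x" "w \<noteq> x" using ne by blast+
      have "B w \<noteq> B x"
        using elim x decB[of w x] decB[of x w] by (cases w x rule: linorder_cases) auto
      moreover have "A (\<pi> w) = B w" "A x = B x" using elim eq by auto
      ultimately show ?case using * \<pi>(1) by (simp add: divide_simps)
    qed
    ultimately have "filterlim (\<lambda>w. (\<pi> w - \<pi> x) / (w - x)) at_top (at x)"
      by (rule filterlim_cong[OF refl refl, THEN iffD1, rotated])
    then show ?thesis unfolding rel_hyperbolic_def using map' by blast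
  qed
qed

section \<open>Expansions and derivatives\<close>

text \<open>The Lagrange remainder contains \<open>G n\<close> at an intermediate point, and by the
  limit at 0 this differs little from \<open>G n 0\<close>.\<close>

lemma taylor_smallo:
  fixes G :: "nat \<Rightarrow> real \<Rightarrow> real"
  assumes r: "0 < r"
    and der: "\<And>i t. i < n \<Longrightarrow> 0 \<le> t \<Longrightarrow> t < r \<Longrightarrow> (G i has_real_derivative G (Suc i) t) (at t)"
    and lim: "(G n \<longlongrightarrow> G n 0) (at_right 0)"
  shows "(\<lambda>x. G 0 x - (\<Sum>i\<le>n. G i 0 / fact i * x ^ i)) \<in> o[at_right 0](\<lambda>x. x ^ n)"
proof (rule landau_o.smallI)
  fix c :: real assume c: "0 < c"
  have "\<forall>\<^sub>F t in at_right 0. dist (G n t) (G n 0) < c" using lim c by (rule tendstoD)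
  then obtain d where d: "0 < d" "\<And>t. 0 < t \<Longrightarrow> t < d \<Longrightarrow> \<bar>G n t - G n 0\<bar> < c"
    unfolding eventually_at_right_field by (auto simp: dist_real_def)
  have "\<bar>G 0 x - (\<Sum>i\<le>n. G i 0 / fact i * x ^ i)\<bar> \<le> c * \<bar>x ^ n\<bar>" if x: "0 < x" "x < min d r" for x
  proof (cases "n = 0")
    case True
    then show ?thesis using d(2)[of x] x by simp
  next
    case False
    have "\<exists>t. 0 < t \<and> t < x \<and> G 0 x = (\<Sum>m<n. G m 0 / fact m * x ^ m) + G n t / fact n * x ^ n"
      by (rule Maclaurin) (use False x der in auto)
    then obtain t where t: "0 < t" "t < x" "G 0 x = (\<Sum>m<n. G m 0 / fact m * x ^ m) + G n t / fact n * x ^ n"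
      by blast
    have "{..n} = insert n {..<n}" by auto
    then have "G 0 x - (\<Sum>i\<le>n. G i 0 / fact i * x ^ i) = (G n t - G n 0) / fact n * x ^ n"
      using t(3) by (simp add: diff_divide_distrib left_diff_distrib)
    moreover have "\<bar>(G n t - G n 0) / fact n\<bar> \<le> c"
    proof -
      have "\<bar>(G n t - G n 0) / fact n\<bar> \<le> \<bar>G n t - G n 0\<bar> / 1"
        unfolding abs_divide by (intro divide_left_mono) auto
      then show ?thesis using d(2)[of t] t x by auto
    qed
    then have "\<bar>(G n t - G n 0) / fact n\<bar> * \<bar>x ^ n\<bar> \<le> c * \<bar>x ^ n\<bar>" by (rule mult_right_mono) simp
    ultimately show ?thesis by (simp only: abs_mult)
  qed
  then show "\<forall>\<^sub>F x in at_right 0. norm (G 0 x - (\<Sum>i\<le>n. G i 0 / fact i * x ^ i)) \<le> c * norm (x ^ n)"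
    unfolding eventually_at_right_field using d(1) r by (intro exI[of _ "min d r"]) auto
qed

text \<open>Once the coefficients below \<open>n\<close> agree, the two expansions differ by
  \<open>(\<beta> n - \<alpha> n) * x ^ n\<close>, which is small relative to \<open>x ^ n\<close>
  only if it vanishes. This identifies the prescribed coefficients with the Taylor
  coefficients.\<close>

lemma expansion_unique:
  fixes \<alpha> \<beta> :: "nat \<Rightarrow> real"
  assumes a: "\<And>n. n \<le> N \<Longrightarrow> (\<lambda>x. f x - (\<Sum>i=1..n. \<alpha> i * x ^ i)) \<in> o[at_right 0](\<lambda>x. x ^ n)"
    and b: "\<And>n. n \<le> N \<Longrightarrow> (\<lambda>x. f x - (\<Sum>i\<le>n. \<beta> i * x ^ i)) \<in> o[at_right 0](\<lambda>x. x ^ n)"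
    and 0: "\<beta> 0 = 0" and n: "1 \<le> n" "n \<le> N"
  shows "\<alpha> n = \<beta> n"
  using n
proof (induction n rule: less_induct)
  case (less n)
  have split: "{1..n} = insert n {1..<n}" "{..n} = insert n (insert 0 {1..<n})" using less.prems by auto
  have "(\<Sum>i=1..<n. \<alpha> i * x ^ i) = (\<Sum>i=1..<n. \<beta> i * x ^ i)" for x
    by (rule sum.cong) (use less in auto)
  then have "(\<lambda>x. (f x - (\<Sum>i=1..n. \<alpha> i * x ^ i)) - (f x - (\<Sum>i\<le>n. \<beta> i * x ^ i))) = (\<lambda>x. (\<beta> n - \<alpha> n) * x ^ n)"
    unfolding split using less.prems 0 by (auto simp: algebra_simps)
  moreover have "(\<lambda>x. (f x - (\<Sum>i=1..n. \<alpha> i * x ^ i)) - (f x - (\<Sum>i\<le>n. \<beta> i * x ^ i))) \<in> o[at_right 0](\<lambda>x. x ^ n)"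
    using less.prems by (intro sum_in_smallo(2) a b)
  ultimately have small: "(\<lambda>x. (\<beta> n - \<alpha> n) * x ^ n) \<in> o[at_right 0](\<lambda>x. x ^ n)" by simp
  have nz: "\<forall>\<^sub>F x in at_right (0::real). x ^ n \<noteq> 0"
    using eventually_at_right_less[of 0] by eventually_elim simp
  show ?case
  proof (rule ccontr)
    assume "\<alpha> n \<noteq> \<beta> n"
    then have "(\<lambda>x. x ^ n) \<in> o[at_right 0](\<lambda>x::real. x ^ n)"
      using small by (simp add: landau_o.small.cmult_in_iff)
    then have "\<forall>\<^sub>F x in at_right (0::real). x ^ n = 0" by (simp add: landau_o.small_refl_iff)
    then have "\<forall>\<^sub>F x in at_right (0::real). False" using nz by eventually_elim simp
    then show False by simp
  qed
qed

text \<open>\<open>G i\<close> is the i-th derivative of an extension. As the extension reaches to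
  the left of 0, derivatives at 0 are two-sided.\<close>

lemma C_half_open_derivatives:
  assumes "C_half_open k 0 c f"
  obtains G :: "nat \<Rightarrow> real \<Rightarrow> real" where
    "\<And>i x. enat i < k \<Longrightarrow> 0 \<le> x \<Longrightarrow> x < c \<Longrightarrow> (G i has_real_derivative G (Suc i) x) (at x)"
    "\<And>i. enat i \<le> k \<Longrightarrow> continuous_on {0..<c} (G i)"
    "\<And>x. 0 \<le> x \<Longrightarrow> x < c \<Longrightarrow> G 0 x = f x"
proof -
  from assms obtain \<epsilon> g where e: "\<epsilon> > 0" and g: "C_on_open k {0 - \<epsilon><..<c} g"
    and eq: "\<forall>x\<in>{0..<c}. g x = f x" unfolding C_half_open_def by blast
  show thesis
  proof (rule that[of "\<lambda>i. (deriv ^^ i) g"])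
    fix i x assume i: "enat i < k" and x: "0 \<le> x" "x < c"
    have "(deriv ^^ i) g differentiable_on {0 - \<epsilon><..<c}" using g i by (simp add: C_on_open_def)
    then have "(deriv ^^ i) g differentiable at x"
      using x e differentiable_on_eq_differentiable_at[of "{0 - \<epsilon><..<c}" "(deriv ^^ i) g"] by auto
    then show "((deriv ^^ i) g has_real_derivative (deriv ^^ Suc i) g x) (at x)"
      by (simp add: DERIV_deriv_iff_real_differentiable)
  next
    fix i assume "enat i \<le> k"
    then have "continuous_on {0 - \<epsilon><..<c} ((deriv ^^ i) g)" using g by (simp add: C_on_open_def)
    then show "continuous_on {0..<c} ((deriv ^^ i) g)" by (rule continuous_on_subset) (use e in auto)
  qed (use eq in auto)
qed

text \<open>An expansion with small-o remainder cannot in general be differentiated term by term.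
  Here it can: the given coefficients are the Taylor coefficients, and the derivative has its own
  Taylor expansion, one order shorter. The Lipschitz bounds come from the bounded second derivative,
  hence the restriction to \<open>2 \<le> k\<close>.\<close>

lemma expansion_of_derivative:
  assumes C: "C_half_open k 0 c f" and c: "0 < c" and k: "1 \<le> k"
    and exp: "expansion_at_0 k \<alpha> f" and f0: "f 0 = 0"
  shows "\<exists>f'. (\<forall>x. 0 < x \<longrightarrow> x < c \<longrightarrow> (f has_real_derivative f' x) (at x)) \<and>
    continuous_on {0..<c} f \<and> (f' \<longlongrightarrow> \<alpha> 1) (at_right 0) \<and>
    (\<forall>n. 1 \<le> n \<longrightarrow> enat n \<le> k \<longrightarrow>
       (\<lambda>x. f' x - (\<Sum>i<n. real (i + 1) * \<alpha> (i + 1) * x ^ i)) \<in> o[at_right 0](\<lambda>x. x ^ (n - 1))) \<and>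
    (2 \<le> k \<longrightarrow> (\<exists>L r. 0 < r \<and>
       (\<forall>x\<in>{0<..<r}. \<bar>f' x - \<alpha> 1\<bar> \<le> L * x \<and> (\<forall>y\<in>{0<..<r}. \<bar>f' x - f' y\<bar> \<le> L * \<bar>x - y\<bar>))))"
proof -
  from C_half_open_derivatives[OF C] obtain G where
    G: "\<And>i x. enat i < k \<Longrightarrow> 0 \<le> x \<Longrightarrow> x < c \<Longrightarrow> (G i has_real_derivative G (Suc i) x) (at x)"
    and Gc: "\<And>i. enat i \<le> k \<Longrightarrow> continuous_on {0..<c} (G i)"
    and G0: "\<And>x. 0 \<le> x \<Longrightarrow> x < c \<Longrightarrow> G 0 x = f x" by metis
  have lim: "(G i \<longlongrightarrow> G i 0) (at_right 0)" if "enat i \<le> k" for i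
  proof -
    have "(G i \<longlongrightarrow> G i 0) (at 0 within {0..<c})" using Gc[OF that] c by (auto simp: continuous_on_def)
    then have "(G i \<longlongrightarrow> G i 0) (at 0 within {0..c / 2})"
      by (rule tendsto_within_subset) (use c in auto)
    then show ?thesis using c at_within_Icc_at_right[of 0 "c / 2"] by simp
  qed
  have near: "\<forall>\<^sub>F x in at_right 0. 0 < x \<and> x < c"
    using eventually_at_right_real[OF c] by eventually_elim auto
  have k0: "enat 0 < k" "enat 1 \<le> k"
    using k by (cases k; simp add: one_enat_def; fail)+
  have coeff: "\<alpha> n = G n 0 / fact n" if n: "1 \<le> n" "enat n \<le> k" for n
  proof (rule expansion_unique[of n f \<alpha> "\<lambda>n. G n 0 / fact n"])
    fix m assume "m \<le> n"
    then have m: "enat m \<le> k" using n by (meson enat_ord_simps(1) order_trans)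
    show "(\<lambda>x. f x - (\<Sum>i=1..m. \<alpha> i * x ^ i)) \<in> o[at_right 0](\<lambda>x. x ^ m)"
      using exp m by (simp add: expansion_at_0_def)
    have "enat i < k" if "i < m" for i using that m by (meson enat_ord_simps(2) less_le_trans)
    then have "(\<lambda>x. G 0 x - (\<Sum>i\<le>m. G i 0 / fact i * x ^ i)) \<in> o[at_right 0](\<lambda>x. x ^ m)"
      by (intro taylor_smallo[of c] G lim[OF m] c)
    moreover have ev: "\<forall>\<^sub>F x in at_right 0. G 0 x - (\<Sum>i\<le>m. G i 0 / fact i * x ^ i) = f x - (\<Sum>i\<le>m. G i 0 / fact i * x ^ i)"
      using near by eventually_elim (simp add: G0)
    ultimately show "(\<lambda>x. f x - (\<Sum>i\<le>m. G i 0 / fact i * x ^ i)) \<in> o[at_right 0](\<lambda>x. x ^ m)"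
      using landau_o.small.in_cong[OF ev] by simp
  next
    show "G 0 0 / fact 0 = 0" using G0[of 0] c f0 by simp
  qed (use n in simp_all)
  have a1: "\<alpha> 1 = G 1 0" using coeff[of 1] k0 by simp
  show ?thesis
  proof (rule exI[of _ "G 1"], intro conjI allI impI)
    fix x assume x: "0 < x" "x < c"
    have "(G 0 has_real_derivative G 1 x) (at x)" using G[of 0 x] k0 x by simp
    then show "(f has_real_derivative G 1 x) (at x)"
      by (rule has_field_derivative_transform_within_open[where S = "{0<..<c}"]) (use x G0 in auto)
  next
    show "continuous_on {0..<c} f"
      using Gc[of 0] k0 G0 by (subst continuous_on_cong[of _ "{0..<c}" _ "G 0"]) auto
    show "(G 1 \<longlongrightarrow> \<alpha> 1) (at_right 0)" using lim[of 1] k0 a1 by simp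
  next
    fix n :: nat assume n: "1 \<le> n" "enat n \<le> k"
    have lt: "enat (Suc i) < k" if "i < n - 1" for i
    proof -
      have "enat (Suc i) < enat n" using that by simp
      then show ?thesis using n(2) by (rule less_le_trans)
    qed
    have "(\<lambda>x. G (Suc 0) x - (\<Sum>i\<le>n - 1. G (Suc i) 0 / fact i * x ^ i)) \<in> o[at_right 0](\<lambda>x. x ^ (n - 1))"
      using n by (intro taylor_smallo[of c "n - 1" "\<lambda>i. G (Suc i)"] G lt c) (simp_all add: lim)
    moreover have "(\<Sum>i\<le>n - 1. G (Suc i) 0 / fact i * x ^ i) = (\<Sum>i<n. real (i + 1) * \<alpha> (i + 1) * x ^ i)" for x
    proof (rule sum.cong)
      show "{..n - 1} = {..<n}" using n by auto
      fix i assume "i \<in> {..<n}"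
      then have "enat (i + 1) \<le> enat n" by simp
      then have "enat (i + 1) \<le> k" using n(2) by (rule order_trans)
      then have "\<alpha> (i + 1) = G (i + 1) 0 / fact (i + 1)" by (intro coeff) simp_all
      then have "G (Suc i) 0 / fact i = real (i + 1) * \<alpha> (i + 1)" by (simp add: divide_simps mult_ac)
      then show "G (Suc i) 0 / fact i * x ^ i = real (i + 1) * \<alpha> (i + 1) * x ^ i" by (rule arg_cong)
    qed
    ultimately show "(\<lambda>x. G 1 x - (\<Sum>i<n. real (i + 1) * \<alpha> (i + 1) * x ^ i)) \<in> o[at_right 0](\<lambda>x. x ^ (n - 1))" by simp
  next
    assume k2: "2 \<le> k"
    then have k2': "enat 2 \<le> k" "enat 1 < k"
      by (cases k; simp add: numeral_eq_enat one_enat_def; fail)+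
    have "compact (G 2 ` {0..c / 2})"
      by (intro compact_continuous_image continuous_on_subset[OF Gc[OF k2'(1)]]) (use c in auto)
    then have "bounded (G 2 ` {0..c / 2})" by (rule compact_imp_bounded)
    then obtain L where L: "\<And>x. x \<in> {0..c / 2} \<Longrightarrow> \<bar>G 2 x\<bar> \<le> L"
      unfolding bounded_iff by (metis imageI real_norm_def)
    have lip: "\<bar>G 1 x - G 1 y\<bar> \<le> L * \<bar>x - y\<bar>" if "x \<in> {0..c / 2}" "y \<in> {0..c / 2}" for x y
    proof -
      have "norm (G 1 x - G 1 y) \<le> L * norm (x - y)"
      proof (rule field_differentiable_bound[of "{0..c / 2}" "G 1" "G 2"])
        fix z assume z: "z \<in> {0..c / 2}"
        then have "(G 1 has_real_derivative G 2 z) (at z)" using G[of 1 z] k2' c by (simp add: numeral_2_eq_2)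
        then show "(G 1 has_real_derivative G 2 z) (at z within {0..c / 2})" by (rule has_field_derivative_at_within)
        show "norm (G 2 z) \<le> L" using L z by simp
      qed (use that in auto)
      then show ?thesis by simp
    qed
    show "\<exists>L r. 0 < r \<and> (\<forall>x\<in>{0<..<r}. \<bar>G 1 x - \<alpha> 1\<bar> \<le> L * x \<and> (\<forall>y\<in>{0<..<r}. \<bar>G 1 x - G 1 y\<bar> \<le> L * \<bar>x - y\<bar>))"
    proof (rule exI[of _ L], rule exI[of _ "c / 2"], intro conjI ballI)
      fix x assume x: "x \<in> {0<..<c / 2}"
      show "\<bar>G 1 x - \<alpha> 1\<bar> \<le> L * x" using lip[of x 0] x a1 by auto
    next
      fix x y assume x: "x \<in> {0<..<c / 2}" and "y \<in> {0<..<c / 2}"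
      then show "\<bar>G 1 x - G 1 y\<bar> \<le> L * \<bar>x - y\<bar>" using lip x by auto
    qed (use c in auto)
  qed
qed

section \<open>The translation as a function of the position\<close>

text \<open>\<open>root N t\<close> lies between \<open>t\<close> and 1. Hence taking roots does not
  enlarge the relative error of the position.\<close>

lemma abs_one_minus_root_le:
  assumes "1 \<le> N" "0 \<le> t"
  shows "\<bar>1 - root N t\<bar> \<le> \<bar>1 - t\<bar>"
proof -
  define u where "u = root N t"
  have u: "0 \<le> u" "u ^ N = t" using assms by (auto simp: u_def)
  show ?thesis
  proof (cases "u \<le> 1")
    case True
    then have "u ^ N \<le> u ^ 1" using u assms by (intro power_decreasing) auto
    then show ?thesis using True u by (simp add: u_def[symmetric])
  next
    case False
    then have "u ^ 1 \<le> u ^ N" using assms by (intro power_increasing) auto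
    then show ?thesis using False u by (simp add: u_def[symmetric])
  qed
qed

text \<open>The distance between the endpoints of an orbit arc is not changed by a translation. Hence
  \<open>x\<close> is the position of a periodic orbit of the field translated by \<open>b\<close> iff the arcs of the two
  half-return maps \<open>h\<close> at \<open>x\<close> and \<open>f\<close> at \<open>x - b\<close> have equal width; \<open>partner x\<close> is the point \<open>x - b\<close>.\<close>

locale half_map_pair =
  fixes f h f' h' :: "real \<Rightarrow> real" and x0 s c \<alpha> :: real and N :: nat
  assumes x0: "0 < x0" and s: "s = 1 \<or> s = - 1"
    and f0: "f 0 = 0" and h0: "h 0 = 0"
    and contf: "continuous_on {0..<x0} f" and conth: "continuous_on {0..<x0} h"
    and df: "\<And>x. 0 < x \<Longrightarrow> x < x0 \<Longrightarrow> (f has_real_derivative f' x) (at x)"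
    and dh: "\<And>x. 0 < x \<Longrightarrow> x < x0 \<Longrightarrow> (h has_real_derivative h' x) (at x)"
    and decf: "\<And>x y. 0 \<le> x \<Longrightarrow> x < y \<Longrightarrow> y < x0 \<Longrightarrow> f y < f x"
    and dech: "\<And>x y. 0 \<le> x \<Longrightarrow> x < y \<Longrightarrow> y < x0 \<Longrightarrow> h y < h x"
    and sep: "\<And>x. 0 < x \<Longrightarrow> x < x0 \<Longrightarrow> 0 < s * (f x - h x)"
    and N: "1 \<le> N" and sc: "0 < s * c"
    and exp: "(\<lambda>x. f x - h x - c * x ^ N) \<in> o[at_right 0](\<lambda>x. x ^ N)"
    and exp': "(\<lambda>x. f' x - h' x - N * c * x ^ (N - 1)) \<in> o[at_right 0](\<lambda>x. x ^ (N - 1))"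
    and lim_f': "(f' \<longlongrightarrow> \<alpha>) (at_right 0)"
    and lip_f': "2 \<le> N \<Longrightarrow> \<exists>L r. 0 < r \<and> (\<forall>x\<in>{0<..<r}. \<forall>y\<in>{0<..<r}. \<bar>f' x - f' y\<bar> \<le> L * \<bar>x - y\<bar>)"
begin

lemma near_0: "\<forall>\<^sub>F x in at_right 0. 0 < x \<and> x < x0"
  using eventually_at_right_real[OF x0] by eventually_elim auto

lemma f'_nonpos: "0 < x \<Longrightarrow> x < x0 \<Longrightarrow> f' x \<le> 0"
proof (rule ccontr)
  assume x: "0 < x" "x < x0" and "\<not> f' x \<le> 0"
  then obtain d where d: "d > 0" "\<And>h. 0 < h \<Longrightarrow> h < d \<Longrightarrow> f x < f (x + h)"
    using DERIV_pos_inc_right[OF df[OF x]] by auto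
  define u where "u = min d (x0 - x) / 2"
  have "0 < u" "u < d" "x + u < x0" using d(1) x by (auto simp: u_def min_def field_simps)
  then show False using d(2)[of u] decf[of x "x + u"] x by auto
qed

lemma \<alpha>_nonpos: "\<alpha> \<le> 0"
proof (rule tendsto_upperbound[OF lim_f'])
  show "\<forall>\<^sub>F x in at_right 0. f' x \<le> 0" using near_0 by eventually_elim (simp add: f'_nonpos)
qed simp

section \<open>The partner point and the translation parameter\<close>

lemma gap_expands: "0 \<le> x \<Longrightarrow> x \<le> y \<Longrightarrow> y < x0 \<Longrightarrow> y - x \<le> (y - f y) - (x - f x)"
  using decf[of x y] by (cases "x = y") auto

lemma gap_inj: "0 \<le> x \<Longrightarrow> x < x0 \<Longrightarrow> 0 \<le> y \<Longrightarrow> y < x0 \<Longrightarrow> x - f x = y - f y \<Longrightarrow> x = y"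
  by (rule linorder_cases[of x y]) (use decf[of x y] decf[of y x] in linarith)+

definition partners :: "real \<Rightarrow> real \<Rightarrow> bool" where
  "partners x w \<longleftrightarrow> 0 < x \<and> x < x0 \<and> 0 < w \<and> w < x0 \<and> w - f w = x - h x"

definition partner :: "real \<Rightarrow> real" where
  "partner x = (SOME w. partners x w)"

lemma partner_eqI: "partners x w \<Longrightarrow> partner x = w"
  unfolding partner_def by (rule some_equality) (auto simp: partners_def intro: gap_inj)

lemma tendsto_0:
  assumes "continuous_on {0..<x0} g" shows "(g \<longlongrightarrow> g 0) (at_right (0::real))"
proof -
  have "(g \<longlongrightarrow> g 0) (at 0 within {0..<x0})" using assms x0 by (auto simp: continuous_on_def)
  then have "(g \<longlongrightarrow> g 0) (at 0 within {0..x0 / 2})"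
    by (rule tendsto_within_subset) (use x0 in auto)
  then show ?thesis using x0 at_within_Icc_at_right[of 0 "x0 / 2"] by simp
qed

text \<open>The widths \<open>x - h x\<close> tend to 0, so they are eventually attained by the
  continuous function \<open>w - f w\<close>, which starts at 0.\<close>

lemma partners_near_0: "\<forall>\<^sub>F x in at_right 0. partners x (partner x)"
proof -
  define x1 where "x1 = x0 / 2"
  have x1: "0 < x1" "x1 < x0" using x0 by (auto simp: x1_def)
  have contx1: "continuous_on {0..x1} (\<lambda>w. w - f w)"
    by (intro continuous_intros continuous_on_subset[OF contf]) (use x1 in auto)
  have "((\<lambda>x. x - h x) \<longlongrightarrow> 0 - 0) (at_right 0)"
    using tendsto_0[OF conth] h0 by (intro tendsto_diff tendsto_ident_at) auto
  moreover have "0 < x1 - f x1" using gap_expands[of 0 x1] x1 f0 by simp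
  ultimately have "\<forall>\<^sub>F x in at_right 0. x - h x < x1 - f x1" by (intro order_tendstoD) auto
  then show ?thesis using near_0
  proof eventually_elim
    case (elim x)
    have "0 < x - h x" using dech[of 0 x] h0 elim by auto
    then have "\<exists>w. 0 \<le> w \<and> w \<le> x1 \<and> w - f w = x - h x"
      using elim x1 f0 contx1 \<open>0 < x - h x\<close> by (intro IVT') auto
    then obtain w where w: "0 \<le> w" "w \<le> x1" "w - f w = x - h x" by blast
    then have "partners x w" using \<open>0 < x - h x\<close> f0 x1 elim by (auto simp: partners_def less_le)
    then show ?case using partner_eqI by metis
  qed
qed

definition shift :: "real \<Rightarrow> real" where "shift x = x - partner x"

text \<open>The values of \<open>w - f w\<close> at \<open>partner x\<close> and at \<open>x\<close>
  differ by \<open>f x - h x\<close>. This function is increasing and expands distances, so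
  \<open>partner x - x\<close> has the sign of \<open>f x - h x\<close>, which is that of
  \<open>s\<close>, and at most its absolute value.\<close>

lemma shift_bounds:
  assumes "partners x (partner x)"
  shows "s * shift x < 0" "\<bar>shift x\<bar> \<le> \<bar>f x - h x\<bar>"
proof -
  let ?w = "partner x"
  have w: "0 < x" "x < x0" "0 < ?w" "?w < x0" "?w - f ?w = x - h x" using assms by (auto simp: partners_def)
  have g: "(?w - f ?w) - (x - f x) = f x - h x" using w by simp
  have ne: "0 < s * (f x - h x)" using sep w by simp
  show "\<bar>shift x\<bar> \<le> \<bar>f x - h x\<bar>"
    using gap_expands[of x ?w] gap_expands[of ?w x] w by (auto simp: shift_def abs_if)
  show "s * shift x < 0"
    using s ne gap_expands[of x ?w] gap_expands[of ?w x] w by (cases "x \<le> ?w") (auto simp: shift_def less_le)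
qed

text \<open>Implicit differentiation of \<open>w - f w = x - h x\<close>. The denominator is
  negative because \<open>f'\<close> is nonpositive, so the numerator alone decides the
  sign.\<close>

lemma shift_deriv:
  assumes p: "partners x (partner x)"
  shows "(shift has_real_derivative (f' (partner x) - h' x) / (f' (partner x) - 1)) (at x)"
proof -
  let ?w = "partner x" and ?B = "\<lambda>w. f w - w" and ?A = "\<lambda>x. h x - x"
  have w: "0 < x" "x < x0" "?w \<in> {0<..<x0}" "?A x = ?B ?w" using p by (auto simp: partners_def)
  have dA: "(?A has_real_derivative h' x - 1) (at x)" using dh w by (auto intro!: derivative_eq_intros)
  have dB: "(?B has_real_derivative f' ?w - 1) (at ?w)" using df w by (auto intro!: derivative_eq_intros)
  have nz: "f' ?w - 1 < 0" using f'_nonpos[of ?w] w by auto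
  have contB: "continuous_on {0<..<x0} ?B"
    by (intro continuous_intros continuous_on_subset[OF contf]) auto
  have decB: "?B v < ?B u" if "0 < u" "u < v" "v < x0" for u v
    using decf[of u v] that by auto
  obtain \<kappa> where \<kappa>: "\<kappa> x = ?w" "\<forall>\<^sub>F u in nhds x. \<forall>w. w \<in> {0<..<x0} \<and> ?A u = ?B w \<longleftrightarrow> w = \<kappa> u"
    "\<And>a b. (?A has_real_derivative a) (at x) \<Longrightarrow> (?B has_real_derivative b) (at ?w) \<Longrightarrow> b \<noteq> 0 \<Longrightarrow>
       (\<kappa> has_real_derivative a / b) (at x)"
    by (rule solve_decreasing[OF w(3) contB decB DERIV_isCont[OF dA] w(4)]) blast+
  have "\<forall>\<^sub>F u in nhds x. u \<in> {0<..<x0}" using w by (intro eventually_nhds_in_open) auto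
  then have ev: "\<forall>\<^sub>F u in nhds x. shift u = u - \<kappa> u"
    using \<kappa>(2)
  proof eventually_elim
    case (elim u)
    then have "partners u (\<kappa> u)" unfolding partners_def by (smt (verit) greaterThanLessThan_iff)
    then show ?case by (simp add: partner_eqI shift_def)
  qed
  have "((\<lambda>u. u - \<kappa> u) has_real_derivative 1 - (h' x - 1) / (f' ?w - 1)) (at x)"
    using \<kappa>(3)[OF dA dB] nz by (auto intro!: derivative_eq_intros)
  then have "(shift has_real_derivative 1 - (h' x - 1) / (f' ?w - 1)) (at x)"
    using DERIV_cong_ev[OF refl ev refl] by simp
  then show ?thesis by (rule DERIV_cong) (use nz in \<open>simp add: field_simps\<close>)
qed

section \<open>Asymptotics of the translation parameter near 0\<close>

lemma exp_quotient: "((\<lambda>x. (f x - h x) / (c * x ^ N)) \<longlongrightarrow> 1) (at_right 0)"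
proof -
  have "((\<lambda>x. (f x - h x - c * x ^ N) / x ^ N) \<longlongrightarrow> 0) (at_right 0)"
    using exp by (rule smalloD_tendsto)
  then have "((\<lambda>x. 1 + (f x - h x - c * x ^ N) / x ^ N / c) \<longlongrightarrow> 1 + 0 / c) (at_right 0)"
    using sc by (intro tendsto_intros) auto
  moreover have "\<forall>\<^sub>F x in at_right 0. 1 + (f x - h x - c * x ^ N) / x ^ N / c = (f x - h x) / (c * x ^ N)"
    using near_0
  proof eventually_elim
    case (elim x)
    then have "c * x ^ N \<noteq> 0" using sc by auto
    then show ?case by (simp add: diff_divide_distrib mult.commute)
  qed
  ultimately show ?thesis by (simp add: tendsto_cong)
qed

lemma diff_bound: "\<forall>\<^sub>F x in at_right 0. \<bar>f x - h x\<bar> \<le> 2 * \<bar>c\<bar> * x ^ N"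
proof -
  have "\<forall>\<^sub>F x in at_right 0. (f x - h x) / (c * x ^ N) < 2"
    "\<forall>\<^sub>F x in at_right 0. 0 < (f x - h x) / (c * x ^ N)"
    using exp_quotient by (rule order_tendstoD, simp)+
  then show ?thesis using near_0
  proof eventually_elim
    case (elim x)
    then have "\<bar>(f x - h x) / (c * x ^ N)\<bar> \<le> 2" by simp
    moreover have "0 < \<bar>c\<bar>" using sc by (cases "c = 0") auto
    then have "0 < \<bar>c\<bar> * x ^ N" using elim by simp
    ultimately show ?case using elim by (simp add: abs_mult pos_divide_le_eq mult.assoc)
  qed
qed

lemma partner_le: "\<forall>\<^sub>F x in at_right 0. 0 < partner x \<and> partner x \<le> (1 + 2 * \<bar>c\<bar>) * x"
proof -
  have "\<forall>\<^sub>F x in at_right (0::real). x \<in> {0<..<1}" by (rule eventually_at_right_real) simp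
  then show ?thesis using partners_near_0 diff_bound
  proof eventually_elim
    case (elim x)
    have "x ^ N \<le> x ^ 1" using elim N by (intro power_decreasing) auto
    then have "2 * \<bar>c\<bar> * x ^ N \<le> 2 * \<bar>c\<bar> * x" by (simp add: mult_left_mono)
    then have "\<bar>shift x\<bar> \<le> 2 * \<bar>c\<bar> * x" using shift_bounds(2)[of x] elim by linarith
    then show ?case using elim by (auto simp: shift_def partners_def algebra_simps)
  qed
qed

lemma at_right_0_if_linear_bound:
  assumes "\<forall>\<^sub>F x in at_right 0. 0 < g x \<and> g x \<le> C * x"
  shows "filterlim g (at_right 0) (at_right (0::real))"
  unfolding filterlim_at
proof
  show "\<forall>\<^sub>F x in at_right 0. g x \<in> {0<..} \<and> g x \<noteq> 0" using assms by eventually_elim auto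
  show "filterlim g (nhds 0) (at_right 0)"
  proof (rule tendsto_sandwich)
    show "\<forall>\<^sub>F x in at_right 0. 0 \<le> g x" using assms by eventually_elim auto
    show "\<forall>\<^sub>F x in at_right 0. g x \<le> C * x" using assms by eventually_elim auto
    have "((\<lambda>x. C * x) \<longlongrightarrow> C * 0) (at_right 0)" by (intro tendsto_intros)
    then show "((\<lambda>x. C * x) \<longlongrightarrow> 0) (at_right 0)" by simp
  qed simp
qed

lemma filterlim_partner: "filterlim partner (at_right 0) (at_right 0)"
  using partner_le by (rule at_right_0_if_linear_bound)

text \<open>At one and the same point the expansion of \<open>f' - h'\<close> has leading term
  \<open>N * c * x ^ (N - 1)\<close>. Moving the argument of \<open>f'\<close> from \<open>x\<close>
  to \<open>partner x\<close> must cost less than this. For \<open>N = 1\<close> the limit of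
  \<open>f'\<close> at 0 suffices; for \<open>N \<ge> 2\<close> the Lipschitz bound on
  \<open>f'\<close> makes the cost of the order of \<open>shift x\<close>, that is of
  \<open>x ^ N\<close>.\<close>

lemma derivative_gap: "\<forall>\<^sub>F x in at_right 0. 0 < s * (f' (partner x) - h' x)"
proof -
  have small: "(\<lambda>x. f' (partner x) - f' x) \<in> o[at_right 0](\<lambda>x. x ^ (N - 1))"
  proof (cases "N = 1")
    case True
    have "((\<lambda>x. f' (partner x) - f' x) \<longlongrightarrow> \<alpha> - \<alpha>) (at_right 0)"
      by (intro tendsto_diff lim_f' filterlim_compose[OF lim_f' filterlim_partner])
    then show ?thesis using True by (intro smalloI_tendsto) auto
  next
    case False
    then have N2: "2 \<le> N" using N by simp
    then obtain L r where L: "0 < r" "\<And>x y. x \<in> {0<..<r} \<Longrightarrow> y \<in> {0<..<r} \<Longrightarrow> \<bar>f' x - f' y\<bar> \<le> L * \<bar>x - y\<bar>"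
      using lip_f' by blast
    have near: "\<forall>\<^sub>F x in at_right (0::real). x \<in> {0<..<r}" using L(1) by (rule eventually_at_right_real)
    then have near': "\<forall>\<^sub>F x in at_right (0::real). partner x \<in> {0<..<r}"
      using filterlim_partner by (rule eventually_compose_filterlim)
    have "(\<lambda>x. f' (partner x) - f' x) \<in> O[at_right 0](\<lambda>x. x ^ N)"
    proof (rule bigoI)
      show "\<forall>\<^sub>F x in at_right 0. norm (f' (partner x) - f' x) \<le> (\<bar>L\<bar> * (2 * \<bar>c\<bar>)) * norm (x ^ N)"
        using near near' partners_near_0 diff_bound near_0
      proof eventually_elim
        case (elim x)
        have "\<bar>f' (partner x) - f' x\<bar> \<le> L * \<bar>shift x\<bar>"
          using L(2)[of "partner x" x] elim by (auto simp: shift_def abs_minus_commute)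
        also have "\<dots> \<le> \<bar>L\<bar> * (2 * \<bar>c\<bar> * x ^ N)"
          using shift_bounds(2)[of x] elim by (intro mult_mono) auto
        finally show ?case using elim by simp
      qed
    qed
    moreover have "(\<lambda>x. x ^ N) \<in> o[at_right 0](\<lambda>x::real. x ^ (N - 1))"
    proof (rule smalloI_tendsto)
      have "((\<lambda>x::real. x) \<longlongrightarrow> 0) (at_right 0)" by (rule tendsto_ident_at)
      moreover have "\<forall>\<^sub>F x in at_right 0. (x::real) = x ^ N / x ^ (N - 1)"
        using near_0 by eventually_elim (use N in \<open>simp add: power_diff\<close>)
      ultimately show "((\<lambda>x::real. x ^ N / x ^ (N - 1)) \<longlongrightarrow> 0) (at_right 0)"
        by (rule Lim_transform_eventually)
      show "\<forall>\<^sub>F x in at_right (0::real). x ^ (N - 1) \<noteq> 0" using near_0 by eventually_elim simp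
    qed
    ultimately show ?thesis by (rule landau_o.big_small_trans)
  qed
  have "(\<lambda>x. (f' x - h' x - N * c * x ^ (N - 1)) + (f' (partner x) - f' x)) \<in> o[at_right 0](\<lambda>x. x ^ (N - 1))"
    by (rule sum_in_smallo(1)[OF exp' small])
  then have lim: "((\<lambda>x. ((f' x - h' x - N * c * x ^ (N - 1)) + (f' (partner x) - f' x)) / x ^ (N - 1)) \<longlongrightarrow> 0) (at_right 0)"
    by (rule smalloD_tendsto)
  have "((\<lambda>x. s * (N * c + ((f' x - h' x - N * c * x ^ (N - 1)) + (f' (partner x) - f' x)) / x ^ (N - 1))) \<longlongrightarrow> s * (N * c + 0)) (at_right 0)"
    by (intro tendsto_intros lim)
  moreover have "0 < s * (N * c + 0)" using sc N mult_pos_pos[of "real N" "s * c"] by (simp add: ac_simps)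
  ultimately have "\<forall>\<^sub>F x in at_right 0. 0 < s * (N * c + ((f' x - h' x - N * c * x ^ (N - 1)) + (f' (partner x) - f' x)) / x ^ (N - 1))"
    by (rule order_tendstoD)
  then show ?thesis using near_0
  proof eventually_elim
    case (elim x)
    have pos: "0 < x ^ (N - 1)" using elim by simp
    have "N * c + ((f' x - h' x - N * c * x ^ (N - 1)) + (f' (partner x) - f' x)) / x ^ (N - 1) = (f' (partner x) - h' x) / x ^ (N - 1)"
      using elim by (simp add: diff_divide_distrib)
    then have "0 < (s * (f' (partner x) - h' x)) / x ^ (N - 1)" using elim by simp
    then show ?case using pos elim by (simp add: zero_less_divide_iff)
  qed
qed


text \<open>Compares \<open>\<bar>shift x\<bar>\<close> with its expected leading term
  \<open>\<bar>c\<bar> / (1 - \<alpha>) * x ^ N\<close>. The position formula amounts to this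
  quotient tending to 1, and its refinement to an error of order \<open>x\<close> in the
  quotient.\<close>

definition ratio :: "real \<Rightarrow> real" where
  "ratio x = \<bar>shift x\<bar> * ((1 - \<alpha>) / \<bar>c\<bar>) / x ^ N"

text \<open>The mean value theorem for \<open>u - f u\<close> between \<open>x\<close> and
  \<open>partner x\<close>, which may come in either order.\<close>

lemma shift_mean_value:
  assumes p: "partners x (partner x)"
  shows "\<exists>\<xi>. 0 < \<xi> \<and> \<xi> \<le> max x (partner x) \<and> \<xi> < x0 \<and> \<bar>shift x\<bar> * (1 - f' \<xi>) = \<bar>f x - h x\<bar>"
proof -
  let ?w = "partner x" and ?g = "\<lambda>u. u - f u"
  have w: "0 < x" "x < x0" "0 < ?w" "?w < x0" "?g ?w - ?g x = f x - h x" using p by (auto simp: partners_def)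
  have ne: "?w \<noteq> x" using shift_bounds(1)[OF p] by (auto simp: shift_def)
  have mv: "\<exists>\<xi>. 0 < \<xi> \<and> \<xi> \<le> b \<and> \<xi> < x0 \<and> (b - a) * (1 - f' \<xi>) = \<bar>?g b - ?g a\<bar>"
    if ab: "0 < a" "a < b" "b < x0" for a b
  proof -
    have "\<exists>z. a < z \<and> z < b \<and> ?g b - ?g a = (b - a) * (1 - f' z)"
      by (rule MVT2[OF ab(2)]) (use ab df in \<open>auto intro!: derivative_eq_intros\<close>)
    then obtain z where z: "a < z" "z < b" "?g b - ?g a = (b - a) * (1 - f' z)" by blast
    have "0 \<le> ?g b - ?g a" using gap_expands[of a b] ab by simp
    then show ?thesis using z ab by (intro exI[of _ z]) auto
  qed
  show ?thesis
  proof (cases "?w < x")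
    case True
    then show ?thesis using mv[of ?w x] w by (auto simp: shift_def)
  next
    case False
    then show ?thesis using mv[of x ?w] w ne by (auto simp: shift_def)
  qed
qed

text \<open>The first factor measures the expansion of \<open>f - h\<close>, the second the
  variation of \<open>f'\<close> near 0; each tends to 1. The absolute values disappear because
  \<open>f x - h x\<close> and \<open>c\<close> both have the sign of \<open>s\<close>.\<close>

lemma ratio_factorisation:
  obtains \<xi> where "\<forall>\<^sub>F x in at_right 0. 0 < \<xi> x \<and> \<xi> x \<le> (1 + 2 * \<bar>c\<bar>) * x"
    "\<forall>\<^sub>F x in at_right 0. f' (\<xi> x) \<le> 0"
    "\<forall>\<^sub>F x in at_right 0. ratio x = (f x - h x) / (c * x ^ N) * ((1 - \<alpha>) / (1 - f' (\<xi> x)))"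
proof -
  have "\<exists>\<xi>. \<forall>x. partners x (partner x) \<longrightarrow>
      0 < \<xi> x \<and> \<xi> x \<le> max x (partner x) \<and> \<xi> x < x0 \<and> \<bar>shift x\<bar> * (1 - f' (\<xi> x)) = \<bar>f x - h x\<bar>"
    using shift_mean_value by metis
  then obtain \<xi> where \<xi>: "\<And>x. partners x (partner x) \<Longrightarrow>
      0 < \<xi> x \<and> \<xi> x \<le> max x (partner x) \<and> \<xi> x < x0 \<and> \<bar>shift x\<bar> * (1 - f' (\<xi> x)) = \<bar>f x - h x\<bar>"
    by blast
  show thesis
  proof (rule that)
    show "\<forall>\<^sub>F x in at_right 0. 0 < \<xi> x \<and> \<xi> x \<le> (1 + 2 * \<bar>c\<bar>) * x"
      using partners_near_0 partner_le near_0
    proof eventually_elim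
      case (elim x)
      have "x \<le> (1 + 2 * \<bar>c\<bar>) * x" using elim by (simp add: distrib_right)
      then show ?case using \<xi>[of x] elim by (auto intro: order_trans)
    qed
    show "\<forall>\<^sub>F x in at_right 0. f' (\<xi> x) \<le> 0"
      using partners_near_0 by eventually_elim (use \<xi> f'_nonpos in blast)
    show "\<forall>\<^sub>F x in at_right 0. ratio x = (f x - h x) / (c * x ^ N) * ((1 - \<alpha>) / (1 - f' (\<xi> x)))"
      using partners_near_0 near_0
    proof eventually_elim
      case (elim x)
      have f': "0 < 1 - f' (\<xi> x)" using \<xi>[of x] f'_nonpos[of "\<xi> x"] elim by auto
      have sh: "\<bar>shift x\<bar> = \<bar>f x - h x\<bar> / (1 - f' (\<xi> x))" using \<xi>[of x] f' elim by (auto simp: field_simps)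
      have "0 < s * (f x - h x)" using sep elim by simp
      then have "\<bar>f x - h x\<bar> / \<bar>c\<bar> = (f x - h x) / c" (is "?l = ?r")
        using s
      proof (elim disjE)
        assume "s = - 1"
        then have "\<bar>f x - h x\<bar> = - (f x - h x)" "\<bar>c\<bar> = - c" using \<open>0 < s * (f x - h x)\<close> sc by auto
        then show ?thesis by (simp only: minus_divide_divide)
      qed (use \<open>0 < s * (f x - h x)\<close> sc in auto)
      moreover have "ratio x = ?l * ((1 - \<alpha>) / (1 - f' (\<xi> x))) / x ^ N"
        unfolding ratio_def sh by (simp add: mult_ac)
      ultimately show ?case by simp
    qed
  qed
qed

lemma ratio_tendsto: "(ratio \<longlongrightarrow> 1) (at_right 0)"
proof -
  obtain \<xi> where \<xi>: "\<forall>\<^sub>F x in at_right 0. 0 < \<xi> x \<and> \<xi> x \<le> (1 + 2 * \<bar>c\<bar>) * x"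
    "\<forall>\<^sub>F x in at_right 0. ratio x = (f x - h x) / (c * x ^ N) * ((1 - \<alpha>) / (1 - f' (\<xi> x)))"
    by (rule ratio_factorisation)
  have "filterlim \<xi> (at_right 0) (at_right 0)" using \<xi>(1) by (rule at_right_0_if_linear_bound)
  then have "((\<lambda>x. f' (\<xi> x)) \<longlongrightarrow> \<alpha>) (at_right 0)" by (rule filterlim_compose[OF lim_f'])
  then have "((\<lambda>x. (f x - h x) / (c * x ^ N) * ((1 - \<alpha>) / (1 - f' (\<xi> x)))) \<longlongrightarrow> 1 * ((1 - \<alpha>) / (1 - \<alpha>))) (at_right 0)"
    using \<alpha>_nonpos by (intro tendsto_intros exp_quotient) auto
  then have "((\<lambda>x. (f x - h x) / (c * x ^ N) * ((1 - \<alpha>) / (1 - f' (\<xi> x)))) \<longlongrightarrow> 1) (at_right 0)"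
    using \<alpha>_nonpos by simp
  moreover have "\<forall>\<^sub>F x in at_right 0. (f x - h x) / (c * x ^ N) * ((1 - \<alpha>) / (1 - f' (\<xi> x))) = ratio x"
    using \<xi>(2) by eventually_elim simp
  ultimately show ?thesis by (rule Lim_transform_eventually)
qed

text \<open>Both factors equal 1 up to O(x): the first by the expansion of one order higher, the
  second by the linear bound on \<open>f' - \<alpha>\<close>, applied at a point
  \<open>\<xi> x\<close> that is itself O(x).\<close>

lemma ratio_bigo:
  assumes exp1: "(\<lambda>x. f x - h x - c * x ^ N) \<in> O[at_right 0](\<lambda>x. x ^ (N + 1))"
    and L: "0 < r" "\<And>x. x \<in> {0<..<r} \<Longrightarrow> \<bar>f' x - \<alpha>\<bar> \<le> L * x"
  shows "(\<lambda>x. ratio x - 1) \<in> O[at_right 0](\<lambda>x. x)"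
proof -
  obtain \<xi> where \<xi>: "\<forall>\<^sub>F x in at_right 0. 0 < \<xi> x \<and> \<xi> x \<le> (1 + 2 * \<bar>c\<bar>) * x"
    "\<forall>\<^sub>F x in at_right 0. f' (\<xi> x) \<le> 0"
    "\<forall>\<^sub>F x in at_right 0. ratio x = (f x - h x) / (c * x ^ N) * ((1 - \<alpha>) / (1 - f' (\<xi> x)))"
    by (rule ratio_factorisation)
  have "filterlim \<xi> (at_right 0) (at_right 0)" using \<xi>(1) by (rule at_right_0_if_linear_bound)
  moreover have "\<forall>\<^sub>F x in at_right (0::real). x \<in> {0<..<r}" using L(1) by (rule eventually_at_right_real)
  ultimately have near: "\<forall>\<^sub>F x in at_right 0. \<xi> x \<in> {0<..<r}" by (rule eventually_compose_filterlim[rotated])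
  from exp1 obtain C where C: "C > 0" "\<forall>\<^sub>F x in at_right 0. norm (f x - h x - c * x ^ N) \<le> C * norm (x ^ (N + 1))"
    by (rule landau_o.bigE)
  show ?thesis
  proof (rule bigoI)
    show "\<forall>\<^sub>F x in at_right 0. norm (ratio x - 1) \<le> (C / \<bar>c\<bar> * (1 - \<alpha>) + \<bar>L\<bar> * (1 + 2 * \<bar>c\<bar>)) * norm x"
      using \<xi> near C(2) near_0
    proof eventually_elim
      case (elim x)
      define a e where "a = (f x - h x) / (c * x ^ N)" and "e = (1 - \<alpha>) / (1 - f' (\<xi> x))"
      have c: "c \<noteq> 0" using sc by auto
      have x: "0 < x" "x ^ N \<noteq> 0" using elim by auto
      have "a - 1 = (f x - h x - c * x ^ N) / (c * x ^ N)"
        using c x by (simp add: a_def diff_divide_distrib)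
      then have "\<bar>a - 1\<bar> = \<bar>f x - h x - c * x ^ N\<bar> / (\<bar>c\<bar> * x ^ N)" using x by (simp add: abs_mult)
      also have "\<dots> \<le> (C * x ^ (N + 1)) / (\<bar>c\<bar> * x ^ N)"
        using elim x by (intro divide_right_mono) (auto simp: abs_mult)
      also have "\<dots> = C / \<bar>c\<bar> * x" using x c by (simp add: field_simps)
      finally have a: "\<bar>a - 1\<bar> \<le> C / \<bar>c\<bar> * x" .
      have e0: "0 \<le> e" "e \<le> 1 - \<alpha>" using \<alpha>_nonpos elim by (auto simp: e_def divide_simps mult_le_cancel_left1)
      have "e - 1 = (f' (\<xi> x) - \<alpha>) / (1 - f' (\<xi> x))" using elim by (simp add: e_def field_simps)
      then have "\<bar>e - 1\<bar> = \<bar>f' (\<xi> x) - \<alpha>\<bar> / (1 - f' (\<xi> x))" using elim by (simp add: abs_divide)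
      also have "\<dots> \<le> \<bar>f' (\<xi> x) - \<alpha>\<bar> / 1" using elim by (intro divide_left_mono) auto
      also have "\<dots> \<le> L * \<xi> x" using L(2) elim by simp
      also have "\<dots> \<le> \<bar>L\<bar> * ((1 + 2 * \<bar>c\<bar>) * x)" using elim by (intro mult_mono) auto
      finally have e: "\<bar>e - 1\<bar> \<le> \<bar>L\<bar> * ((1 + 2 * \<bar>c\<bar>) * x)" .
      have "ratio x - 1 = (a - 1) * e + (e - 1)" using elim by (simp add: a_def e_def algebra_simps)
      then have "\<bar>ratio x - 1\<bar> \<le> \<bar>a - 1\<bar> * e + \<bar>e - 1\<bar>"
        using e0 abs_triangle_ineq[of "(a - 1) * e" "e - 1"] by (simp add: abs_mult)
      also have "\<dots> \<le> (C / \<bar>c\<bar> * x) * (1 - \<alpha>) + \<bar>L\<bar> * ((1 + 2 * \<bar>c\<bar>) * x)"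
        using a e e0 C x by (intro add_mono mult_mono) auto
      finally show ?case using x by (simp add: algebra_simps)
    qed
  qed
qed

definition amplitude :: real where "amplitude = root N ((1 - \<alpha>) / \<bar>c\<bar>)"

lemma root_shift: "\<forall>\<^sub>F x in at_right 0. amplitude * root N \<bar>shift x\<bar> = x * root N (ratio x)"
  using near_0
proof eventually_elim
  case (elim x)
  have "(1 - \<alpha>) / \<bar>c\<bar> * \<bar>shift x\<bar> = x ^ N * ratio x" using elim by (simp add: ratio_def)
  then have "root N ((1 - \<alpha>) / \<bar>c\<bar>) * root N \<bar>shift x\<bar> = root N (x ^ N) * root N (ratio x)"
    by (metis real_root_mult)
  then show ?case using N elim by (simp add: amplitude_def real_root_pos2)
qed

lemma root_ratio_tendsto: "((\<lambda>x. root N (ratio x)) \<longlongrightarrow> 1) (at_right 0)"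
  using tendsto_real_root[OF ratio_tendsto, of N] N by simp

text \<open>Errors are found as functions of x but stated in terms of b; this turns orders of x into
  orders of the N-th root of the translation.\<close>

lemma position_bigo: "(\<lambda>x. x) \<in> O[at_right 0](\<lambda>x. root N \<bar>shift x\<bar>)"
proof (rule bigoI)
  have "\<forall>\<^sub>F x in at_right 0. 1 / 2 < root N (ratio x)"
    using root_ratio_tendsto by (rule order_tendstoD) simp
  then show "\<forall>\<^sub>F x in at_right 0. norm x \<le> (2 * amplitude) * norm (root N \<bar>shift x\<bar>)"
    using root_shift near_0
  proof eventually_elim
    case (elim x)
    have "x * (1 / 2) \<le> x * root N (ratio x)" using elim by (intro mult_left_mono) auto
    then have "x \<le> 2 * (amplitude * root N \<bar>shift x\<bar>)" using elim by simp
    moreover have "0 \<le> amplitude" using \<alpha>_nonpos N by (simp add: amplitude_def)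
    ultimately show ?case using elim N by (simp add: mult.assoc)
  qed
qed

lemma position_error: "\<forall>\<^sub>F x in at_right 0. x * (1 - root N (ratio x)) = x - amplitude * root N \<bar>shift x\<bar>"
  using root_shift by eventually_elim (simp add: algebra_simps)

lemma position_smallo: "(\<lambda>x. x - amplitude * root N \<bar>shift x\<bar>) \<in> o[at_right 0](\<lambda>x. root N \<bar>shift x\<bar>)"
proof -
  have "((\<lambda>x. 1 - root N (ratio x)) \<longlongrightarrow> 1 - 1) (at_right 0)"
    by (intro tendsto_intros root_ratio_tendsto)
  moreover have "\<forall>\<^sub>F x in at_right 0. 1 - root N (ratio x) = x * (1 - root N (ratio x)) / x"
    using near_0 by eventually_elim simp
  ultimately have "((\<lambda>x. x * (1 - root N (ratio x)) / x) \<longlongrightarrow> 1 - 1) (at_right 0)"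
    by (rule Lim_transform_eventually)
  then have "(\<lambda>x. x * (1 - root N (ratio x))) \<in> o[at_right 0](\<lambda>x. x)"
    by (intro smalloI_tendsto) (use near_0 in \<open>auto elim: eventually_mono\<close>)
  then have "(\<lambda>x. x * (1 - root N (ratio x))) \<in> o[at_right 0](\<lambda>x. root N \<bar>shift x\<bar>)"
    using position_bigo by (rule landau_o.small_big_trans)
  then show ?thesis using landau_o.small.in_cong[OF position_error] by simp
qed

text \<open>The error is \<open>x * (1 - root N (ratio x))\<close>: \<open>x\<close> contributes one
  factor of the size of the N-th root of the translation, the ratio the other.\<close>

lemma position_bigo_error:
  assumes "(\<lambda>x. f x - h x - c * x ^ N) \<in> O[at_right 0](\<lambda>x. x ^ (N + 1))"
    and "0 < r" "\<And>x. x \<in> {0<..<r} \<Longrightarrow> \<bar>f' x - \<alpha>\<bar> \<le> L * x"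
  shows "(\<lambda>x. x - amplitude * root N \<bar>shift x\<bar>) \<in> O[at_right 0](\<lambda>x. (root N \<bar>shift x\<bar>)\<^sup>2)"
proof -
  have "(\<lambda>x. 1 - root N (ratio x)) \<in> O[at_right 0](\<lambda>x. ratio x - 1)"
  proof (rule bigoI)
    show "\<forall>\<^sub>F x in at_right 0. norm (1 - root N (ratio x)) \<le> 1 * norm (ratio x - 1)"
      using near_0
    proof eventually_elim
      case (elim x)
      have "0 \<le> ratio x" using \<alpha>_nonpos elim by (simp add: ratio_def)
      then show ?case using abs_one_minus_root_le[OF N, of "ratio x"] by simp
    qed
  qed
  also have "(\<lambda>x. ratio x - 1) \<in> O[at_right 0](\<lambda>x. x)" by (rule ratio_bigo[OF assms])
  also note position_bigo
  finally have "(\<lambda>x. x * (1 - root N (ratio x))) \<in> O[at_right 0](\<lambda>x. root N \<bar>shift x\<bar> * root N \<bar>shift x\<bar>)"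
    by (rule landau_o.big_mult[OF position_bigo])
  then show ?thesis using landau_o.big.in_cong[OF position_error] by (simp add: power2_eq_square)
qed

text \<open>On a short interval \<open>\<beta>\<close>, the absolute value of \<open>shift\<close>,
  is strictly increasing and tends to 0 at 0, so it can be inverted; \<open>X\<close> is the inverse
  as a function of b. The conclusion on all partners below \<open>\<rho>\<close> is what yields
  uniqueness of the periodic orbit, and \<open>\<epsilon>\<close> lets the interval be shrunk at
  will.\<close>

lemma solve_shift:
  assumes \<epsilon>: "0 < \<epsilon>"
  obtains \<rho> b0 X where "0 < \<rho>" "\<rho> < \<epsilon>" "0 < b0" "b0 < \<epsilon>"
    "\<And>b. 0 < - (s * b) \<Longrightarrow> - (s * b) < b0 \<Longrightarrow>
       0 < X b \<and> X b < \<rho> \<and> partners (X b) (X b - b) \<and> 0 < s * (f' (X b - b) - h' (X b))"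
    "\<And>b x. 0 < - (s * b) \<Longrightarrow> - (s * b) < b0 \<Longrightarrow> x < \<rho> \<Longrightarrow> partners x (x - b) \<Longrightarrow> x = X b"
    "filterlim X (at_right 0) (at 0 within {b. 0 < - (s * b)})"
    "\<forall>\<^sub>F b in at 0 within {b. 0 < - (s * b)}. shift (X b) = b"
proof -
  have "\<forall>\<^sub>F x in at_right 0. partners x (partner x) \<and> 0 < s * (f' (partner x) - h' x)"
    using partners_near_0 derivative_gap by (rule eventually_conj)
  then obtain \<rho>0 where \<rho>0: "0 < \<rho>0"
    "\<And>x. 0 < x \<Longrightarrow> x < \<rho>0 \<Longrightarrow> partners x (partner x) \<and> 0 < s * (f' (partner x) - h' x)"
    unfolding eventually_at_right_field by auto
  define \<rho> where "\<rho> = min \<rho>0 \<epsilon> / 2"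
  have \<rho>: "0 < \<rho>" "\<rho> < \<rho>0" "\<rho> < \<epsilon>" using \<rho>0(1) \<epsilon> by (auto simp: \<rho>_def min_def)
  define \<beta> where "\<beta> x = - (s * shift x)" for x
  have part: "partners x (partner x)" and der: "0 < s * (f' (partner x) - h' x)" if "0 < x" "x \<le> \<rho>" for x
    using \<rho>0(2)[of x] \<rho> that by auto
  have pos: "0 < \<beta> x" if "0 < x" "x \<le> \<rho>" for x
    using shift_bounds(1)[OF part[OF that]] by (simp add: \<beta>_def)
  have d\<beta>: "\<exists>d. (\<beta> has_real_derivative d) (at x) \<and> 0 < d" if "0 < x" "x \<le> \<rho>" for x
  proof (intro exI conjI)
    let ?d = "- (s * ((f' (partner x) - h' x) / (f' (partner x) - 1)))"
    show "(\<beta> has_real_derivative ?d) (at x)"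
      unfolding \<beta>_def by (intro DERIV_minus DERIV_cmult shift_deriv part that)
    have "f' (partner x) \<le> 0" using part[OF that] by (intro f'_nonpos) (auto simp: partners_def)
    then have "0 < (s * (f' (partner x) - h' x)) / (1 - f' (partner x))" using der[OF that] by simp
    also have "\<dots> = ?d" by (metis minus_diff_eq minus_divide_right times_divide_eq_right)
    finally show "0 < ?d" .
  qed
  have mono: "\<beta> x < \<beta> y" if "0 < x" "x < y" "y \<le> \<rho>" for x y
    by (rule DERIV_pos_imp_increasing[OF that(2)]) (use d\<beta> that in auto)
  have inj: "x = y" if "0 < x" "x \<le> \<rho>" "0 < y" "y \<le> \<rho>" "\<beta> x = \<beta> y" for x y
    using mono[of x y] mono[of y x] that by (cases x y rule: linorder_cases) auto
  have \<beta>s: "\<beta> x = - (s * b) \<longleftrightarrow> shift x = b" for x b using s by (auto simp: \<beta>_def)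
  have lim: "(\<beta> \<longlongrightarrow> 0) (at_right 0)"
  proof (rule Lim_null_comparison)
    show "\<forall>\<^sub>F x in at_right 0. norm (\<beta> x) \<le> \<bar>f x - h x\<bar>"
      using partners_near_0
    proof eventually_elim
      case (elim x)
      have "\<bar>s\<bar> = 1" using s by auto
      then show ?case using shift_bounds(2)[OF elim] by (simp add: \<beta>_def abs_mult)
    qed
    have "((\<lambda>x. \<bar>f x - h x\<bar>) \<longlongrightarrow> \<bar>f 0 - h 0\<bar>) (at_right 0)"
      by (intro tendsto_intros tendsto_0 contf conth)
    then show "((\<lambda>x. \<bar>f x - h x\<bar>) \<longlongrightarrow> 0) (at_right 0)" using f0 h0 by simp
  qed
  \<comment> \<open>Below \<open>\<beta> \<rho>\<close>, so that every admissible b is attained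
    strictly inside the interval.\<close>
  define b0 where "b0 = min (\<beta> \<rho>) \<epsilon> / 2"
  have b0: "0 < b0" "b0 < \<beta> \<rho>" "b0 < \<epsilon>" using pos[of \<rho>] \<rho> \<epsilon> by (auto simp: b0_def min_def)
  have ex: "\<exists>x. 0 < x \<and> x < \<rho> \<and> shift x = b" if b: "0 < - (s * b)" "- (s * b) < b0" for b
  proof -
    have "\<forall>\<^sub>F x in at_right 0. \<beta> x < - (s * b)" using lim b(1) by (rule order_tendstoD)
    then have "\<forall>\<^sub>F x in at_right 0. \<beta> x < - (s * b) \<and> x \<in> {0<..<\<rho>}"
      using eventually_at_right_real[OF \<rho>(1)] by (rule eventually_conj)
    then obtain x1 where x1: "\<beta> x1 < - (s * b)" "0 < x1" "x1 < \<rho>"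
      using eventually_happens[of _ "at_right (0::real)"] by (auto simp: trivial_limit_at_right_real)
    have "\<exists>x. x1 \<le> x \<and> x \<le> \<rho> \<and> \<beta> x = - (s * b)"
    proof (rule IVT)
      show "\<forall>x. x1 \<le> x \<and> x \<le> \<rho> \<longrightarrow> isCont \<beta> x"
        using d\<beta> DERIV_isCont x1(2) by (meson less_le_trans)
    qed (use x1 b b0 in auto)
    then obtain x where x: "x1 \<le> x" "x \<le> \<rho>" "\<beta> x = - (s * b)" by blast
    then have "x \<noteq> \<rho>" using b b0 by auto
    then show ?thesis using x x1 \<beta>s by (intro exI[of _ x]) auto
  qed
  define X where "X b = (SOME x. 0 < x \<and> x < \<rho> \<and> shift x = b)" for b
  have X: "0 < X b" "X b < \<rho>" "shift (X b) = b" if "0 < - (s * b)" "- (s * b) < b0" for b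
    using someI_ex[OF ex[OF that]] by (auto simp: X_def)
  have near: "\<forall>\<^sub>F b in at 0 within {b. 0 < - (s * b)}. 0 < - (s * b) \<and> - (s * b) < t" if t: "0 < t" for t
    unfolding eventually_at using t s by (intro exI[of _ t]) (auto simp: dist_real_def)
  have limX: "filterlim X (at_right 0) (at 0 within {b. 0 < - (s * b)})"
    unfolding filterlim_at
  proof
    show "\<forall>\<^sub>F b in at 0 within {b. 0 < - (s * b)}. X b \<in> {0<..} \<and> X b \<noteq> 0"
      using near[OF b0(1)] by eventually_elim (use X in force)
    show "filterlim X (nhds 0) (at 0 within {b. 0 < - (s * b)})"
      unfolding tendsto_iff
    proof (intro allI impI)
      fix \<eta> :: real assume \<eta>: "0 < \<eta>"
      \<comment> \<open>Once \<open>- (s * b) < \<beta> u\<close>, monotonicity forces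
        \<open>X b \<le> u\<close>.\<close>
      define u where "u = min \<eta> \<rho> / 2"
      have u: "0 < u" "u < \<eta>" "u < \<rho>" using \<eta> \<rho> by (auto simp: u_def min_def)
      have "\<forall>\<^sub>F b in at 0 within {b. 0 < - (s * b)}. 0 < - (s * b) \<and> - (s * b) < min b0 (\<beta> u)"
        using pos[of u] u b0 by (intro near) auto
      then show "\<forall>\<^sub>F b in at 0 within {b. 0 < - (s * b)}. dist (X b) 0 < \<eta>"
      proof eventually_elim
        case (elim b)
        then have Xb: "0 < X b" "X b < \<rho>" "\<beta> (X b) < \<beta> u" using X[of b] \<beta>s[of "X b" b] by auto
        then have "X b \<le> u" using mono[of u "X b"] u by (cases "X b \<le> u") auto
        then show ?case using Xb u by simp
      qed
    qed
  qed
  show thesis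
  proof (rule that[OF \<rho>(1,3) b0(1,3) _ _ limX])
    fix b assume b: "0 < - (s * b)" "- (s * b) < b0"
    have "partner (X b) = X b - b" using X(3)[OF b] by (simp add: shift_def)
    then show "0 < X b \<and> X b < \<rho> \<and> partners (X b) (X b - b) \<and> 0 < s * (f' (X b - b) - h' (X b))"
      using X[OF b] part[of "X b"] der[of "X b"] by auto
    fix x assume x: "x < \<rho>" "partners x (x - b)"
    then have "shift x = b" by (simp add: partner_eqI shift_def)
    then have "\<beta> x = \<beta> (X b)" using X(3)[OF b] by (simp add: \<beta>_def)
    moreover have "0 < x" using x(2) by (simp add: partners_def)
    ultimately show "x = X b" using x(1) X(1,2)[OF b] inj[of x "X b"] by simp
  next
    show "\<forall>\<^sub>F b in at 0 within {b. 0 < - (s * b)}. shift (X b) = b"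
      using near[OF b0(1)] by eventually_elim (use X in blast)
  qed
qed

end

section \<open>Periodic orbits of the translated system\<close>

text \<open>For \<open>\<delta> = - 1\<close> both fields are reversed. After this the lower
  half-return map always runs with time and the upper one against it.\<close>

definition directed :: "real \<Rightarrow> plane_field \<Rightarrow> plane_field" where
  "directed \<delta> F = (if \<delta> = 1 then F else reverse_field F)"

lemma reverse_translate: "reverse_field (translate_field b F) = translate_field b (reverse_field F)"
  by (auto simp: reverse_field_def translate_field_def)

lemma directed_translate: "directed \<delta> (translate_field b F) = translate_field b (directed \<delta> F)"
  by (simp add: directed_def reverse_translate)

text \<open>Keeps the crossing points of the orbit: it enters the upper half-plane at
  \<open>u\<close> and the lower one at \<open>v\<close>. In an oriented system \<open>v\<close> is
  the position of an orbit near the origin.\<close>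

definition periodic_at :: "plane_field \<Rightarrow> plane_field \<Rightarrow> (real \<times> real) set \<Rightarrow> real \<Rightarrow> real \<Rightarrow> bool" where
  "periodic_at Fp Fm \<Gamma> u v \<longleftrightarrow> u \<noteq> v \<and>
     (\<exists>S T \<gamma> \<eta>. pos_arc Fp 1 u S v \<gamma> \<and> pos_arc Fm (- 1) v T u \<eta> \<and> \<Gamma> = \<gamma> ` {0..S} \<union> \<eta> ` {0..T})"

lemma crossing_periodic_orbit_iff:
  "crossing_periodic_orbit Fp Fm \<Gamma> \<longleftrightarrow> (\<exists>u v. periodic_at Fp Fm \<Gamma> u v)"
  unfolding crossing_periodic_orbit_def periodic_at_def
  by (simp add: pos_arc_iff upper_half_eq lower_half_eq) metis

lemma periodic_at_reverse:
  assumes "periodic_at Fp Fm \<Gamma> u v"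
  shows "periodic_at (reverse_field Fp) (reverse_field Fm) \<Gamma> v u"
proof -
  from assms obtain S T \<gamma> \<eta> where uv: "u \<noteq> v" and a: "pos_arc Fp 1 u S v \<gamma>"
    and b: "pos_arc Fm (- 1) v T u \<eta>" and \<Gamma>: "\<Gamma> = \<gamma> ` {0..S} \<union> \<eta> ` {0..T}"
    unfolding periodic_at_def by blast
  have im: "(\<lambda>t. g (R - t)) ` {0..R} = g ` {0..R}" for g :: "real \<Rightarrow> real \<times> real" and R
    by (simp add: image_image[symmetric, of g "\<lambda>t. R - t"] image_diff_atLeastAtMost)
  show ?thesis
    unfolding periodic_at_def using uv pos_arc_reverse[OF a] pos_arc_reverse[OF b] \<Gamma> im by metis
qed

lemma crossing_periodic_orbit_reverse:
  "crossing_periodic_orbit (reverse_field Fp) (reverse_field Fm) = crossing_periodic_orbit Fp Fm"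
  using periodic_at_reverse[of Fp Fm] periodic_at_reverse[of "reverse_field Fp" "reverse_field Fm"]
  by (simp add: crossing_periodic_orbit_iff fun_eq_iff) blast

lemma crossing_periodic_orbit_directed:
  "crossing_periodic_orbit (directed \<delta> Fp) (directed \<delta> Fm) = crossing_periodic_orbit Fp Fm"
  by (simp add: directed_def crossing_periodic_orbit_reverse)

lemma first_return_reverse:
  "first_return (reverse_field Fp) (reverse_field Fm) u w \<longleftrightarrow> first_return Fp Fm w u"
  unfolding first_return_def upper_half_eq lower_half_eq
  using half_return_reverse[of 1] half_return_reverse[of "- 1"] by auto

lemma first_return_reverse_eq:
  "first_return (reverse_field Fp) (reverse_field Fm) = (\<lambda>u w. first_return Fp Fm w u)"
  by (simp add: fun_eq_iff first_return_reverse)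

text \<open>Arcs touch the line at their ends only. The crossing points can thus be recovered from
  the set \<open>\<Gamma>\<close>, which is all that a crossing periodic orbit is given by.\<close>

lemma periodic_at_inter_line:
  assumes "periodic_at Fp Fm \<Gamma> u v"
  shows "\<Gamma> \<inter> switch_line = {(u, 0), (v, 0)}"
proof -
  from assms obtain S T \<gamma> \<eta> where a: "pos_arc Fp 1 u S v \<gamma>"
    and b: "pos_arc Fm (- 1) v T u \<eta>" and \<Gamma>: "\<Gamma> = \<gamma> ` {0..S} \<union> \<eta> ` {0..T}"
    unfolding periodic_at_def by blast
  have on_line: "g t = (p, 0) \<or> g t = (q, 0)"
    if g: "pos_arc F s p R q g" and t: "t \<in> {0..R}" "snd (g t) = 0" for F s p R q g t
  proof -
    have "0 < s * snd (g t)" if "0 < t \<and> t < R" using g that by (simp add: pos_arc_def)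
    then have "\<not> (0 < t \<and> t < R)" using t(2) by auto
    then have "t = 0 \<or> t = R" using t(1) by auto
    then show ?thesis using g by (auto simp: pos_arc_def)
  qed
  have "(u, 0) \<in> \<gamma> ` {0..S}" "(v, 0) \<in> \<gamma> ` {0..S}"
    using a unfolding pos_arc_def by (metis atLeastAtMost_iff image_eqI less_imp_le order_refl)+
  moreover have "z \<in> {(u, 0), (v, 0)}" if "z \<in> \<Gamma>" "snd z = 0" for z
  proof -
    from that \<Gamma> consider t where "t \<in> {0..S}" "z = \<gamma> t" | t where "t \<in> {0..T}" "z = \<eta> t" by blast
    then show ?thesis
    proof cases
      case (1 t)
      then show ?thesis using on_line[OF a, of t] that(2) by simp
    next
      case (2 t)
      then show ?thesis using on_line[OF b, of t] that(2) by auto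
    qed
  qed
  ultimately have "(u, 0) \<in> \<Gamma>" "(v, 0) \<in> \<Gamma>" "\<And>z. z \<in> \<Gamma> \<Longrightarrow> snd z = 0 \<Longrightarrow> z \<in> {(u, 0), (v, 0)}"
    using \<Gamma> by blast+
  then show ?thesis unfolding switch_line_def by (intro equalityI subsetI) auto
qed

section \<open>Periodic orbits and returns of an oriented system\<close>

locale oriented_system =
  M: return_family Ym "- 1" \<phi>m x0 + P: return_family "reverse_field Yp" 1 \<phi>p x0
  for Yp Ym :: plane_field and \<phi>p \<phi>m :: "real \<Rightarrow> real" and x0 :: real
begin

lemma upper_iff:
  "half_return (translate_field b Yp) (half_plane 1) u v \<longleftrightarrow> half_return (reverse_field Yp) (half_plane 1) (v - b) (u - b)"
  using half_return_translate[of 1 b Yp] half_return_reverse[of 1 Yp] by auto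

text \<open>The lower arc is determined forward from \<open>v\<close>, the upper one backward from
  \<open>v\<close> after undoing the translation.\<close>

lemma periodic_at_unique:
  assumes "periodic_at (translate_field b Yp) Ym \<Gamma> u v" "periodic_at (translate_field b Yp) Ym \<Gamma>' u' v"
  shows "\<Gamma> = \<Gamma>'"
proof -
  from assms(1) obtain S T \<gamma> \<eta> where a: "pos_arc (translate_field b Yp) 1 u S v \<gamma>"
    "pos_arc Ym (- 1) v T u \<eta>" "\<Gamma> = \<gamma> ` {0..S} \<union> \<eta> ` {0..T}" unfolding periodic_at_def by blast
  from assms(2) obtain S' T' \<gamma>' \<eta>' where b: "pos_arc (translate_field b Yp) 1 u' S' v \<gamma>'"
    "pos_arc Ym (- 1) v T' u' \<eta>'" "\<Gamma>' = \<gamma>' ` {0..S'} \<union> \<eta>' ` {0..T'}" unfolding periodic_at_def by blast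
  have low: "\<eta> ` {0..T} = \<eta>' ` {0..T'}" by (rule M.pos_arc_image_unique[OF a(2) b(2)])
  have "u = u'" by (rule M.pos_arc_unique(2)[OF a(2) b(2)])
  have im: "(\<lambda>t. g (R - t) - d) ` {0..R} = (\<lambda>z. z - d) ` g ` {0..R}" for g :: "real \<Rightarrow> real \<times> real" and R d
  proof -
    have "(\<lambda>t. g (R - t) - d) ` {0..R} = (\<lambda>z. z - d) ` g ` (\<lambda>t. R - t) ` {0..R}"
      by (simp only: image_image)
    also have "(\<lambda>t. R - t) ` {0..R} = {0..R}" by (simp add: image_diff_atLeastAtMost)
    finally show ?thesis .
  qed
  have "(\<lambda>z. z - (b, 0)) ` \<gamma> ` {0..S} = (\<lambda>z. z - (b, 0)) ` \<gamma>' ` {0..S'}"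
    using P.pos_arc_image_unique[OF pos_arc_reverse[OF a(1)[unfolded pos_arc_translate]]
        pos_arc_reverse[OF b(1)[unfolded pos_arc_translate]]]
    unfolding im .
  moreover have "inj (\<lambda>z::real \<times> real. z - (b, 0))" by (simp add: inj_def)
  ultimately have "\<gamma> ` {0..S} = \<gamma>' ` {0..S'}" by (simp add: inj_image_eq_iff)
  then show ?thesis using a b low by simp
qed

lemma lower_classification:
  assumes "periodic_at (translate_field b Yp) Ym \<Gamma> u v" "u \<in> map_region \<phi>m x0 \<or> v \<in> map_region \<phi>m x0"
  shows "0 < v \<and> v < x0 \<and> u = \<phi>m v"
proof -
  have "half_return Ym (half_plane (- 1)) v u" "v \<noteq> u"
    using assms(1) half_return_iff[of "- 1"] by (auto simp: periodic_at_def)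
  then show ?thesis using M.arc_classification assms(2) by blast
qed

lemma upper_classification:
  assumes "periodic_at (translate_field b Yp) Ym \<Gamma> u v" "u - b \<in> map_region \<phi>p x0 \<or> v - b \<in> map_region \<phi>p x0"
  shows "0 < v - b \<and> v - b < x0 \<and> u - b = \<phi>p (v - b)"
proof -
  have "half_return (translate_field b Yp) (half_plane 1) u v" "v - b \<noteq> u - b"
    using assms(1) half_return_iff[of 1] by (auto simp: periodic_at_def)
  then show ?thesis using P.arc_classification assms(2) upper_iff by blast
qed

lemma periodic_at_exists:
  assumes "0 < x" "x < x0" "0 < x - b" "x - b < x0" "\<phi>m x = b + \<phi>p (x - b)"
  shows "\<exists>\<Gamma>. periodic_at (translate_field b Yp) Ym \<Gamma> (\<phi>m x) x"
proof -
  have "half_return (translate_field b Yp) (half_plane 1) (\<phi>m x) x"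
    unfolding upper_iff using P.arc[of "x - b"] assms by simp
  then obtain S \<gamma> where "pos_arc (translate_field b Yp) 1 (\<phi>m x) S x \<gamma>" using half_return_iff[of 1] by auto
  moreover obtain T \<eta> where "pos_arc Ym (- 1) x T (\<phi>m x) \<eta>"
    using M.arc[of x] assms half_return_iff[of "- 1"] by auto
  moreover have "\<phi>m x \<noteq> x" using M.neg[of x] assms by auto
  ultimately show ?thesis unfolding periodic_at_def by blast
qed

text \<open>A return passing the upper half-plane before the lower one would make
  \<open>u - b\<close> an arrival point of the reversed upper family and \<open>w\<close> one of the
  lower family; \<open>no_arrival\<close> excludes either. Solving for \<open>w\<close> at given
  \<open>u\<close> yields the return map, solving for \<open>u\<close> at given \<open>w\<close> its
  inverse.\<close>

lemma first_return_near:
  assumes x: "0 < x" "x < x0" "0 < x - b" "x - b < x0" and eq: "\<phi>m x = b + \<phi>p (x - b)"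
  shows "\<forall>\<^sub>F u in nhds x. \<forall>w. first_return (translate_field b Yp) Ym u w \<longleftrightarrow>
      w \<in> {b<..<b + x0} \<and> \<phi>m u = b + \<phi>p (w - b)"
    and "\<forall>\<^sub>F w in nhds x. \<forall>u. first_return (translate_field b Yp) Ym u w \<longleftrightarrow>
      u \<in> {0<..<x0} \<and> \<phi>m u = b + \<phi>p (w - b)"
proof -
  have dom: "\<forall>\<^sub>F u in nhds x. u \<in> {0<..<x0}" "\<forall>\<^sub>F u in nhds x. u \<in> {b<..<b + x0}"
    using x by (intro eventually_nhds_in_open; simp)+
  have cm: "isCont \<phi>m x" using x by (intro M.isCont)
  have "isCont \<phi>p (x - b)" using x by (intro P.isCont)
  then have "isCont (\<lambda>w. \<phi>p (w - b)) x" by (intro isCont_o2[of x "\<lambda>w. w - b" \<phi>p]) simp_all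
  then have cp: "isCont (\<lambda>w. b + \<phi>p (w - b)) x"
    by (intro isCont_add continuous_const)
  have Rdef: "first_return (translate_field b Yp) Ym u w \<longleftrightarrow>
     (\<exists>v. half_return (reverse_field Yp) (half_plane 1) (v - b) (u - b) \<and> half_return Ym (half_plane (- 1)) v w) \<or>
     (\<exists>v. half_return Ym (half_plane (- 1)) u v \<and> half_return (reverse_field Yp) (half_plane 1) (w - b) (v - b))" for u w
    unfolding first_return_def upper_half_eq lower_half_eq upper_iff ..
  have intro_R: "first_return (translate_field b Yp) Ym u w"
    if "u \<in> {0<..<x0}" "w \<in> {b<..<b + x0}" "\<phi>m u = b + \<phi>p (w - b)" for u w
    unfolding Rdef using M.arc[of u] P.arc[of "w - b"] that by (intro disjI2 exI[of _ "\<phi>m u"]) auto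
  show "\<forall>\<^sub>F u in nhds x. \<forall>w. first_return (translate_field b Yp) Ym u w \<longleftrightarrow>
      w \<in> {b<..<b + x0} \<and> \<phi>m u = b + \<phi>p (w - b)"
  proof -
    \<comment> \<open>A point beyond \<open>x - b\<close>: for \<open>u\<close> near
      \<open>x\<close> the value \<open>\<phi>m u - b\<close> stays between \<open>\<phi>p y\<close>
      and 0, where \<open>\<phi>p\<close> has a preimage.\<close>
    define y where "y = (x - b + x0) / 2"
    have y: "x - b < y" "y < x0" "0 < y" using x by (auto simp: y_def)
    have "(\<phi>m \<longlongrightarrow> \<phi>m x) (nhds x)" using cm by (simp add: isCont_def tendsto_at_iff_tendsto_nhds)
    moreover have "b + \<phi>p y < \<phi>m x" "\<phi>m x < b" using P.strictly_decreasing[of "x - b" y] P.neg[of "x - b"] x y eq by auto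
    ultimately have "\<forall>\<^sub>F u in nhds x. b + \<phi>p y < \<phi>m u" "\<forall>\<^sub>F u in nhds x. \<phi>m u < b"
      by (auto intro: order_tendstoD)
    then show ?thesis using dom
    proof eventually_elim
      case (elim u)
      obtain z where z: "0 < z" "z < y" "\<phi>p z = \<phi>m u - b" using P.exists_preimage[of y "\<phi>m u - b"] elim y by auto
      show ?case
      proof (intro allI iffI)
        fix w assume "first_return (translate_field b Yp) Ym u w"
        then obtain v where v: "half_return Ym (half_plane (- 1)) u v"
            "half_return (reverse_field Yp) (half_plane 1) (w - b) (v - b)"
          unfolding Rdef using P.no_arrival[of "u - b"] elim by auto
        have "v = \<phi>m u" using M.half_return_unique[OF v(1)] M.arc[of u] elim by auto
        then have "w - b = z" using P.half_return_unique_start[of "w - b" "v - b" z] v(2) P.arc[of z] z y by auto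
        then show "w \<in> {b<..<b + x0} \<and> \<phi>m u = b + \<phi>p (w - b)" using z y by auto
      qed (use intro_R elim in blast)
    qed
  qed
  show "\<forall>\<^sub>F w in nhds x. \<forall>u. first_return (translate_field b Yp) Ym u w \<longleftrightarrow>
      u \<in> {0<..<x0} \<and> \<phi>m u = b + \<phi>p (w - b)"
  proof -
    define y where "y = (x + x0) / 2"
    have y: "x < y" "y < x0" "0 < y" using x by (auto simp: y_def)
    have "((\<lambda>w. b + \<phi>p (w - b)) \<longlongrightarrow> b + \<phi>p (x - b)) (nhds x)"
      using cp tendsto_at_iff_tendsto_nhds[of "\<lambda>w. b + \<phi>p (w - b)" x] by (simp add: isCont_def)
    moreover have "\<phi>m y < b + \<phi>p (x - b)" "b + \<phi>p (x - b) < 0"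
      using M.strictly_decreasing[of x y] M.neg[of x] x y eq by auto
    ultimately have "\<forall>\<^sub>F w in nhds x. \<phi>m y < b + \<phi>p (w - b)" "\<forall>\<^sub>F w in nhds x. b + \<phi>p (w - b) < 0"
      by (auto intro: order_tendstoD)
    then show ?thesis using dom
    proof eventually_elim
      case (elim w)
      obtain z where z: "0 < z" "z < y" "\<phi>m z = b + \<phi>p (w - b)"
        using M.exists_preimage[of y "b + \<phi>p (w - b)"] elim y by auto
      show ?case
      proof (intro allI iffI)
        fix u assume "first_return (translate_field b Yp) Ym u w"
        then obtain v where v: "half_return Ym (half_plane (- 1)) u v"
            "half_return (reverse_field Yp) (half_plane 1) (w - b) (v - b)"
          unfolding Rdef using M.no_arrival[of w] elim by auto
        have "v - b = \<phi>p (w - b)" using P.half_return_unique[OF v(2)] P.arc[of "w - b"] elim by auto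
        then have vz: "v = \<phi>m z" using z by simp
        then have "u = z" using M.half_return_unique_start[of u v z] v(1) M.arc[of z] z y by auto
        then show "u \<in> {0<..<x0} \<and> \<phi>m u = b + \<phi>p (w - b)" using z y by auto
      qed (use intro_R elim in blast)
    qed
  qed
qed

end

section \<open>The bifurcation in an oriented system\<close>

locale perturbed_system = oriented_system Yp Ym \<phi>p \<phi>m x0 + half_map_pair \<phi>p \<phi>m \<phi>p' \<phi>m' x0 s c \<alpha> N
  for Yp Ym :: plane_field and \<phi>p \<phi>m \<phi>p' \<phi>m' :: "real \<Rightarrow> real" and x0 s c \<alpha> :: real and N :: nat
begin

text \<open>The multiplier is the quotient of \<open>\<phi>m' x\<close> and
  \<open>\<phi>p' (x - b)\<close>, and \<open>gap\<close> orders these nonpositive numbers. For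
  \<open>s = - 1\<close> the return map contracts; for \<open>s = 1\<close> its inverse does, and
  the roles of the two half-return maps are exchanged.\<close>

lemma return_relation_hyperbolic:
  assumes x: "0 < x" "x < x0" "0 < x - b" "x - b < x0" and eq: "\<phi>m x = b + \<phi>p (x - b)"
    and gap: "0 < s * (\<phi>p' (x - b) - \<phi>m' x)"
  defines "R \<equiv> first_return (translate_field b Yp) Ym"
  shows "rel_hyperbolic R x \<and> rel_hyperbolic (\<lambda>u w. R w u) x \<and>
    (s = - 1 \<longrightarrow> rel_stable R x) \<and> (s = 1 \<longrightarrow> rel_stable (\<lambda>u w. R w u) x)"
proof -
  define B where "B w = b + \<phi>p (w - b)" for w
  have dom: "x \<in> {0<..<x0}" "x \<in> {b<..<b + x0}" using x by auto
  have cA: "continuous_on {0<..<x0} \<phi>m" by (rule continuous_on_subset[OF conth]) auto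
  have cB: "continuous_on {b<..<b + x0} B"
    unfolding B_def by (intro continuous_intros continuous_on_compose2[OF contf]) auto
  have decA: "\<phi>m v < \<phi>m u" if "0 < u" "u < v" "v < x0" for u v using dech that by simp
  have decB: "B v < B u" if "b < u" "u < v" "v < b + x0" for u v
    using decf[of "u - b" "v - b"] that by (simp add: B_def)
  have dA: "(\<phi>m has_real_derivative \<phi>m' x) (at x)" using dh x by simp
  have dB: "(B has_real_derivative \<phi>p' (x - b)) (at x)"
  proof -
    have "((\<lambda>w. \<phi>p (w - b)) has_real_derivative \<phi>p' (x - b) * 1) (at x)"
      by (rule DERIV_chain2[of \<phi>p]) (use df x in \<open>auto intro!: derivative_eq_intros\<close>)
    then show ?thesis unfolding B_def by (auto intro!: derivative_eq_intros)
  qed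
  have nonpos: "\<phi>m' x \<le> 0" "\<phi>p' (x - b) \<le> 0"
  proof -
    show "\<phi>p' (x - b) \<le> 0" using f'_nonpos x by simp
    show "\<phi>m' x \<le> 0"
    proof (rule ccontr)
      assume "\<not> \<phi>m' x \<le> 0"
      then obtain d where d: "d > 0" "\<And>h. 0 < h \<Longrightarrow> h < d \<Longrightarrow> \<phi>m x < \<phi>m (x + h)"
        using DERIV_pos_inc_right[OF dA] by auto
      define u where "u = min d (x0 - x) / 2"
      have "0 < u" "u < d" "x + u < x0" using d(1) x by (auto simp: u_def min_def field_simps)
      then show False using d(2)[of u] decA[of x "x + u"] x by auto
    qed
  qed
  have eqB: "\<phi>m x = B x" using eq by (simp add: B_def)
  have R1: "\<forall>\<^sub>F u in nhds x. \<forall>w. R u w \<longleftrightarrow> w \<in> {b<..<b + x0} \<and> \<phi>m u = B w"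
    and R2: "\<forall>\<^sub>F w in nhds x. \<forall>u. R u w \<longleftrightarrow> u \<in> {0<..<x0} \<and> \<phi>m u = B w"
    using first_return_near[OF x eq] by (simp_all add: R_def B_def)
  show ?thesis
    using s
  proof
    assume s: "s = - 1"
    then have "\<phi>p' (x - b) < \<phi>m' x" using gap by simp
    from implicit_return_map[OF dom cA cB decA decB eqB dA nonpos(1) dB this R1 R2]
    show ?thesis using s by simp
  next
    assume s: "s = 1"
    then have lt: "\<phi>m' x < \<phi>p' (x - b)" using gap by simp
    have R1': "\<forall>\<^sub>F u in nhds x. \<forall>w. R w u \<longleftrightarrow> w \<in> {0<..<x0} \<and> B u = \<phi>m w"
      using R2 by (simp add: eq_commute)
    have R2': "\<forall>\<^sub>F w in nhds x. \<forall>u. R w u \<longleftrightarrow> u \<in> {b<..<b + x0} \<and> B u = \<phi>m w"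
      using R1 by (simp add: eq_commute)
    from implicit_return_map[OF dom(2,1) cB cA decB decA eqB[symmetric] dB nonpos(2) dA lt R1' R2']
    show ?thesis using s by simp
  qed
qed


lemma partners_iff:
  "partners x (x - b) \<longleftrightarrow> 0 < x \<and> x < x0 \<and> 0 < x - b \<and> x - b < x0 \<and> \<phi>m x = b + \<phi>p (x - b)"
  by (auto simp: partners_def)

text \<open>For this sign of b the translation and the difference of the two maps act in the same
  direction, so the matching equation has no solution. What remains is that \<open>v\<close> ranges
  over the whole interval up to \<open>x0\<close>, so \<open>v - b\<close> may fall outside the
  domain of \<open>\<phi>p\<close>.\<close>

lemma no_periodic_orbit:
  assumes r: "\<And>p. \<bar>p\<bar> < r \<Longrightarrow> p \<in> map_region \<phi>p x0"
    and b: "0 < s * b" "\<bar>b\<bar> < r" "\<bar>b\<bar> < x0 / 2" "\<bar>b\<bar> < - \<phi>m (x0 / 2)"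
    and per: "periodic_at (translate_field b Yp) Ym \<Gamma> u v"
    and meets: "u \<in> {0..<x0} \<or> v \<in> {0..<x0}"
  shows False
proof -
  have "u \<in> map_region \<phi>m x0 \<or> v \<in> map_region \<phi>m x0" using meets by (auto simp: map_region_def)
  then have v: "0 < v" "v < x0" "u = \<phi>m v" using lower_classification[OF per] by auto
  have gap: "0 < s * (\<phi>p v - \<phi>m v)" using sep v by simp
  have not_upper: "\<not> (0 < v - b \<and> v - b < x0 \<and> u - b = \<phi>p (v - b))"
  proof
    assume w: "0 < v - b \<and> v - b < x0 \<and> u - b = \<phi>p (v - b)"
    show False
      using s
    proof (elim disjE)
      assume "s = 1"
      then show False using decf[of "v - b" v] w v gap b(1) by auto
    next
      assume "s = - 1"
      then show False using decf[of v "v - b"] w v gap b(1) by auto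
    qed
  qed
  have "u - b \<in> map_region \<phi>p x0 \<or> v - b \<in> map_region \<phi>p x0"
  proof (cases "v - b < x0")
    case True
    show ?thesis
    proof (cases "0 \<le> v - b")
      case True
      then show ?thesis using \<open>v - b < x0\<close> by (auto simp: map_region_def)
    next
      case False
      then have "\<bar>v - b\<bar> < r" using v b(2) by auto
      then show ?thesis using r by blast
    qed
  next
    \<comment> \<open>Here \<open>v\<close> is so far to the right that \<open>v - b\<close> is not
      below \<open>x0\<close>. The two bounds on \<open>\<bar>b\<bar>\<close> involving
      \<open>x0 / 2\<close> keep the other end \<open>u - b\<close> on the negative side, and there
      it lies in the image of \<open>\<phi>p\<close>.\<close>
    case False
    then have "b < 0" using v by simp
    then have s1: "s = - 1" using s b(1) by auto
    have "x0 / 2 < v" using False b(3) by auto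
    then have "\<phi>m v < \<phi>m (x0 / 2)" using dech[of "x0 / 2" v] v x0 by simp
    then have "u - b < 0" using b(4) v by auto
    moreover have "\<phi>p v < u - b" using gap s1 v \<open>b < 0\<close> by simp
    ultimately obtain z where "0 < z" "z < v" "\<phi>p z = u - b"
      using P.exists_preimage[of v "u - b"] v by auto
    then show ?thesis using v by (force simp: map_region_def)
  qed
  then show False using upper_classification[OF per] not_upper by blast
qed

lemma bifurcation:
  obtains b0 U X where "0 < b0" "open U" "(0, 0) \<in> U"
    "\<And>b. 0 < - (s * b) \<Longrightarrow> - (s * b) < b0 \<Longrightarrow> 0 < X b \<and>
      partners (X b) (X b - b) \<and> 0 < s * (\<phi>p' (X b - b) - \<phi>m' (X b))"
    "\<And>b. 0 < - (s * b) \<Longrightarrow> - (s * b) < b0 \<Longrightarrow>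
      \<exists>!\<Gamma>. crossing_periodic_orbit (translate_field b Yp) Ym \<Gamma> \<and> \<Gamma> \<inter> switch_line \<inter> U \<noteq> {}"
    "\<And>b \<Gamma>. 0 < - (s * b) \<Longrightarrow> - (s * b) < b0 \<Longrightarrow>
      crossing_periodic_orbit (translate_field b Yp) Ym \<Gamma> \<Longrightarrow> \<Gamma> \<inter> switch_line \<inter> U \<noteq> {} \<Longrightarrow>
      \<Gamma> \<inter> switch_line \<subseteq> U \<and> (X b, 0) \<in> \<Gamma> \<and> crossing_limit_cycle (translate_field b Yp) Ym \<Gamma>"
    "(\<lambda>b. X b - amplitude * root N \<bar>b\<bar>) \<in> o[at 0 within {b. 0 < - (s * b)}](\<lambda>b. root N \<bar>b\<bar>)"
    "\<And>r L. (\<lambda>x. \<phi>p x - \<phi>m x - c * x ^ N) \<in> O[at_right 0](\<lambda>x. x ^ (N + 1)) \<Longrightarrow> 0 < r \<Longrightarrow>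
      (\<And>x. x \<in> {0<..<r} \<Longrightarrow> \<bar>\<phi>p' x - \<alpha>\<bar> \<le> L * x) \<Longrightarrow>
      (\<lambda>b. X b - amplitude * root N \<bar>b\<bar>) \<in> O[at 0 within {b. 0 < - (s * b)}](\<lambda>b. (root N \<bar>b\<bar>)\<^sup>2)"
    "\<And>b \<Gamma>. 0 < s * b \<Longrightarrow> s * b < b0 \<Longrightarrow> crossing_periodic_orbit (translate_field b Yp) Ym \<Gamma> \<Longrightarrow>
      \<Gamma> \<inter> ({0..<x0} \<times> {0}) = {}"
proof -
  obtain rp where rp: "0 < rp" "\<And>p. \<bar>p\<bar> < rp \<Longrightarrow> p \<in> map_region \<phi>p x0" using P.ball_in_map_region by blast
  obtain rm where rm: "0 < rm" "\<And>p. \<bar>p\<bar> < rm \<Longrightarrow> p \<in> map_region \<phi>m x0" using M.ball_in_map_region by blast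
  \<comment> \<open>Half of the radii, since \<open>v\<close> and \<open>\<bar>b\<bar>\<close> will
    both be below \<open>r\<close> and \<open>v - b\<close> has to stay in the region of
    \<open>\<phi>p\<close>.\<close>
  define r where "r = min rp rm / 2"
  have r: "0 < r" "2 * r \<le> rp" "2 * r \<le> rm" using rp(1) rm(1) by (auto simp: r_def)
  have "(\<phi>m \<longlongrightarrow> 0) (at_right 0)" using tendsto_0[OF conth] h0 by simp
  then have "\<forall>\<^sub>F x in at_right 0. - r < \<phi>m x" using r by (intro order_tendstoD) auto
  moreover have pos: "0 < min (min r x0) (min (x0 / 2) (- \<phi>m (x0 / 2)))"
    using r x0 M.neg[of "x0 / 2"] by simp
  then have "\<forall>\<^sub>F x in at_right 0. x \<in> {0<..<min (min r x0) (min (x0 / 2) (- \<phi>m (x0 / 2)))}"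
    by (rule eventually_at_right_real)
  ultimately have "\<forall>\<^sub>F x in at_right 0. - r < \<phi>m x \<and> x \<in> {0<..<min (min r x0) (min (x0 / 2) (- \<phi>m (x0 / 2)))}"
    by (rule eventually_conj)
  then obtain \<epsilon> where \<epsilon>: "- r < \<phi>m \<epsilon>" "0 < \<epsilon>" "\<epsilon> < r" "\<epsilon> < x0" "\<epsilon> < x0 / 2" "\<epsilon> < - \<phi>m (x0 / 2)"
    using eventually_happens[of _ "at_right (0::real)"] by (auto simp: trivial_limit_at_right_real)
  obtain \<rho> b0 X where \<rho>: "0 < \<rho>" "\<rho> < \<epsilon>" and b0: "0 < b0" "b0 < \<epsilon>"
    and X: "\<And>b. 0 < - (s * b) \<Longrightarrow> - (s * b) < b0 \<Longrightarrow>
       0 < X b \<and> X b < \<rho> \<and> partners (X b) (X b - b) \<and> 0 < s * (\<phi>p' (X b - b) - \<phi>m' (X b))"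
    and X_unique: "\<And>b x. 0 < - (s * b) \<Longrightarrow> - (s * b) < b0 \<Longrightarrow> x < \<rho> \<Longrightarrow> partners x (x - b) \<Longrightarrow> x = X b"
    and X_lim: "filterlim X (at_right 0) (at 0 within {b. 0 < - (s * b)})"
    and X_shift: "\<forall>\<^sub>F b in at 0 within {b. 0 < - (s * b)}. shift (X b) = b"
    by (rule solve_shift[OF \<epsilon>(2)]) blast
  have \<phi>\<rho>: "- r < \<phi>m \<rho>" "\<phi>m \<rho> < 0" "\<rho> < x0" using dech[of \<rho> \<epsilon>] \<rho> \<epsilon> M.neg[of \<rho>] by auto
  \<comment> \<open>A vertical strip: (H1) makes the ends of the arcs tend to the origin but does
    not bound the arcs themselves, so closeness to the origin is measured on the switching line. As
    \<open>\<phi>m \<rho>\<close> and \<open>\<rho>\<close> are the ends of one lower arc, an orbit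
    with one crossing point in the strip has both there.\<close>
  define U :: "(real \<times> real) set" where "U = {\<phi>m \<rho><..<\<rho>} \<times> UNIV"
  have U: "open U" "(0, 0) \<in> U" using \<phi>\<rho> \<rho> by (auto simp: U_def intro: open_Times)
  have abs_b: "\<bar>b\<bar> = \<bar>s * b\<bar>" for b using s by (auto simp: abs_mult)
  have located: "u = \<phi>m (X b) \<and> v = X b"
    if b: "0 < - (s * b)" "- (s * b) < b0" and per: "periodic_at (translate_field b Yp) Ym \<Gamma> u v"
      and meets: "\<Gamma> \<inter> switch_line \<inter> U \<noteq> {}" for b \<Gamma> u v
  proof -
    have uv: "u \<in> {\<phi>m \<rho><..<\<rho>} \<or> v \<in> {\<phi>m \<rho><..<\<rho>}"
      using meets periodic_at_inter_line[OF per] by (auto simp: U_def)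
    have "\<bar>p\<bar> < rm" if "p \<in> {\<phi>m \<rho><..<\<rho>}" for p using that \<phi>\<rho> \<rho> \<epsilon> r by auto
    then have v: "0 < v" "v < x0" "u = \<phi>m v" using uv rm(2) lower_classification[OF per] by blast+
    have v\<rho>: "v < \<rho>"
    proof (rule ccontr)
      assume "\<not> v < \<rho>"
      then have "\<phi>m v \<le> \<phi>m \<rho>" using dech[of \<rho> v] v \<rho> by (cases "v = \<rho>") auto
      moreover have "\<phi>m v < 0" using M.neg v by simp
      ultimately show False using uv v(3) \<open>\<not> v < \<rho>\<close> by auto
    qed
    have "\<bar>b\<bar> < r" using abs_b[of b] b b0 \<epsilon> by auto
    then have "\<bar>v - b\<bar> < rp" using v v\<rho> \<rho> \<epsilon> r by auto
    then have "partners v (v - b)" using upper_classification[OF per] rp(2) v by (auto simp: partners_iff)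
    then show ?thesis using X_unique[OF b v\<rho>] v by simp
  qed
  have unique: "\<Gamma> = \<Gamma>'"
    if b: "0 < - (s * b)" "- (s * b) < b0"
      and "crossing_periodic_orbit (translate_field b Yp) Ym \<Gamma>" "\<Gamma> \<inter> switch_line \<inter> U \<noteq> {}"
      and "crossing_periodic_orbit (translate_field b Yp) Ym \<Gamma>'" "\<Gamma>' \<inter> switch_line \<inter> U \<noteq> {}" for b \<Gamma> \<Gamma>'
  proof -
    obtain u v u' v' where uv: "periodic_at (translate_field b Yp) Ym \<Gamma> u v" "periodic_at (translate_field b Yp) Ym \<Gamma>' u' v'"
      using \<open>crossing_periodic_orbit _ _ \<Gamma>\<close> \<open>crossing_periodic_orbit _ _ \<Gamma>'\<close> crossing_periodic_orbit_iff by blast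
    then have "v = v'" using located[OF b] that by blast
    then show ?thesis using periodic_at_unique uv by blast
  qed
  have inside: "\<Gamma> \<inter> switch_line \<subseteq> U \<and> (X b, 0) \<in> \<Gamma>"
    if b: "0 < - (s * b)" "- (s * b) < b0" and "periodic_at (translate_field b Yp) Ym \<Gamma> (\<phi>m (X b)) (X b)" for b \<Gamma>
  proof -
    have "0 < X b" "X b < \<rho>" using X[OF b] by auto
    then have "\<phi>m \<rho> < \<phi>m (X b)" "\<phi>m (X b) < 0" using dech[of "X b" \<rho>] M.neg[of "X b"] \<phi>\<rho> by auto
    then show ?thesis using periodic_at_inter_line[OF that(3)] \<open>0 < X b\<close> \<open>X b < \<rho>\<close> \<phi>\<rho> \<rho> by (auto simp: U_def)
  qed
  show thesis
  proof (rule that[OF b0(1) U])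
    fix b assume b: "0 < - (s * b)" "- (s * b) < b0"
    show "0 < X b \<and> partners (X b) (X b - b) \<and> 0 < s * (\<phi>p' (X b - b) - \<phi>m' (X b))"
      using X[OF b] by blast
    have "\<exists>\<Gamma>. periodic_at (translate_field b Yp) Ym \<Gamma> (\<phi>m (X b)) (X b)"
      using X[OF b] by (intro periodic_at_exists) (auto simp: partners_iff)
    then obtain \<Gamma> where \<Gamma>: "periodic_at (translate_field b Yp) Ym \<Gamma> (\<phi>m (X b)) (X b)" by blast
    have "\<Gamma> \<inter> switch_line \<inter> U \<noteq> {}" using inside[OF b \<Gamma>] periodic_at_inter_line[OF \<Gamma>] by blast
    moreover have "crossing_periodic_orbit (translate_field b Yp) Ym \<Gamma>" using \<Gamma> crossing_periodic_orbit_iff by blast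
    ultimately show "\<exists>!\<Gamma>. crossing_periodic_orbit (translate_field b Yp) Ym \<Gamma> \<and> \<Gamma> \<inter> switch_line \<inter> U \<noteq> {}"
      using unique[OF b] by blast
  next
    fix b \<Gamma> assume b: "0 < - (s * b)" "- (s * b) < b0"
      and \<Gamma>: "crossing_periodic_orbit (translate_field b Yp) Ym \<Gamma>" "\<Gamma> \<inter> switch_line \<inter> U \<noteq> {}"
    obtain u v where uv: "periodic_at (translate_field b Yp) Ym \<Gamma> u v" using \<Gamma>(1) crossing_periodic_orbit_iff by blast
    then have "periodic_at (translate_field b Yp) Ym \<Gamma> (\<phi>m (X b)) (X b)" using located[OF b uv \<Gamma>(2)] by simp
    then have in_U: "\<Gamma> \<inter> switch_line \<subseteq> U \<and> (X b, 0) \<in> \<Gamma>" by (rule inside[OF b])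
    have "crossing_limit_cycle (translate_field b Yp) Ym \<Gamma>"
      unfolding crossing_limit_cycle_def
    \<comment> \<open>The isolating set is the plane without the part of the switching line outside
      \<open>U\<close>. Every periodic orbit in it crosses the line inside \<open>U\<close>, where
      uniqueness applies.\<close>
    proof (intro conjI exI[of _ "- (switch_line \<inter> - U)"] allI impI \<Gamma>(1))
      have "closed switch_line" unfolding switch_line_def by (intro closed_Collect_eq continuous_intros)
      then show "open (- (switch_line \<inter> - U))" using U(1) by (auto intro!: open_Compl closed_Int)
      show "\<Gamma> \<subseteq> - (switch_line \<inter> - U)" using in_U by blast
      fix \<Gamma>' assume \<Gamma>': "crossing_periodic_orbit (translate_field b Yp) Ym \<Gamma>' \<and> \<Gamma>' \<subseteq> - (switch_line \<inter> - U)"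
      then obtain u' v' where "periodic_at (translate_field b Yp) Ym \<Gamma>' u' v'" using crossing_periodic_orbit_iff by blast
      then have "\<Gamma>' \<inter> switch_line \<noteq> {}" using periodic_at_inter_line by blast
      then have "\<Gamma>' \<inter> switch_line \<inter> U \<noteq> {}" using \<Gamma>' by blast
      then show "\<Gamma>' = \<Gamma>" using unique[OF b] \<Gamma> \<Gamma>' by blast
    qed
    then show "\<Gamma> \<inter> switch_line \<subseteq> U \<and> (X b, 0) \<in> \<Gamma> \<and> crossing_limit_cycle (translate_field b Yp) Ym \<Gamma>"
      using in_U by blast
  next
    \<comment> \<open>The expansion in x is composed with \<open>X\<close>, along which
      \<open>shift (X b)\<close> is \<open>b\<close>.\<close>
    have "(\<lambda>b. X b - amplitude * root N \<bar>shift (X b)\<bar>) \<in> o[at 0 within {b. 0 < - (s * b)}](\<lambda>b. root N \<bar>shift (X b)\<bar>)"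
      by (rule landau_o.small.compose[OF position_smallo X_lim])
    moreover have e1: "\<forall>\<^sub>F b in at 0 within {b. 0 < - (s * b)}.
        X b - amplitude * root N \<bar>shift (X b)\<bar> = X b - amplitude * root N \<bar>b\<bar>"
      and e2: "\<forall>\<^sub>F b in at 0 within {b. 0 < - (s * b)}. root N \<bar>shift (X b)\<bar> = root N \<bar>b\<bar>"
      using X_shift by (eventually_elim; simp)+
    ultimately show "(\<lambda>b. X b - amplitude * root N \<bar>b\<bar>) \<in> o[at 0 within {b. 0 < - (s * b)}](\<lambda>b. root N \<bar>b\<bar>)"
      by (simp only: landau_o.small.in_cong[OF e1] landau_o.small.cong[OF e2])
  next
    fix q L assume "(\<lambda>x. \<phi>p x - \<phi>m x - c * x ^ N) \<in> O[at_right 0](\<lambda>x. x ^ (N + 1))" "0 < q"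
      "\<And>x. x \<in> {0<..<q} \<Longrightarrow> \<bar>\<phi>p' x - \<alpha>\<bar> \<le> L * x"
    then have "(\<lambda>b. X b - amplitude * root N \<bar>shift (X b)\<bar>) \<in> O[at 0 within {b. 0 < - (s * b)}](\<lambda>b. (root N \<bar>shift (X b)\<bar>)\<^sup>2)"
      by (rule landau_o.big.compose[OF position_bigo_error X_lim])
    moreover have e1: "\<forall>\<^sub>F b in at 0 within {b. 0 < - (s * b)}.
        X b - amplitude * root N \<bar>shift (X b)\<bar> = X b - amplitude * root N \<bar>b\<bar>"
      and e2: "\<forall>\<^sub>F b in at 0 within {b. 0 < - (s * b)}. (root N \<bar>shift (X b)\<bar>)\<^sup>2 = (root N \<bar>b\<bar>)\<^sup>2"
      using X_shift by (eventually_elim; simp)+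
    ultimately show "(\<lambda>b. X b - amplitude * root N \<bar>b\<bar>) \<in> O[at 0 within {b. 0 < - (s * b)}](\<lambda>b. (root N \<bar>b\<bar>)\<^sup>2)"
      by (simp only: landau_o.big.in_cong[OF e1] landau_o.big.cong[OF e2])
  next
    fix b \<Gamma> assume b: "0 < s * b" "s * b < b0"
      and \<Gamma>: "crossing_periodic_orbit (translate_field b Yp) Ym \<Gamma>"
    obtain u v where uv: "periodic_at (translate_field b Yp) Ym \<Gamma> u v" using \<Gamma> crossing_periodic_orbit_iff by blast
    show "\<Gamma> \<inter> ({0..<x0} \<times> {0}) = {}"
    proof (rule ccontr)
      assume "\<Gamma> \<inter> ({0..<x0} \<times> {0}) \<noteq> {}"
      then obtain z where "(z, 0) \<in> \<Gamma>" "z \<in> {0..<x0}" by blast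
      moreover have "(z, 0) \<in> switch_line" by (simp add: switch_line_def)
      ultimately have "(z, 0) \<in> {(u, 0), (v, 0)}" using periodic_at_inter_line[OF uv] by blast
      then have meets: "u \<in> {0..<x0} \<or> v \<in> {0..<x0}" using \<open>z \<in> {0..<x0}\<close> by auto
      have "\<bar>b\<bar> < \<epsilon>" using abs_b[of b] b b0 by auto
      then have "\<bar>b\<bar> < rp" "\<bar>b\<bar> < x0 / 2" "\<bar>b\<bar> < - \<phi>m (x0 / 2)" using \<epsilon>(3,5,6) r by linarith+
      then show False using no_periodic_orbit[OF _ b(1) _ _ _ uv meets] rp(2) by blast
    qed
  qed
qed

end

section \<open>From (H1) and the expansions to an oriented system\<close>

lemma constant_sign:
  fixes g :: "real \<Rightarrow> real"
  assumes cont: "continuous_on {a<..<b} g" and nz: "\<And>x. x \<in> {a<..<b} \<Longrightarrow> g x \<noteq> 0"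
  shows "(\<forall>x\<in>{a<..<b}. 0 < g x) \<or> (\<forall>x\<in>{a<..<b}. g x < 0)"
proof (rule ccontr)
  assume "\<not> ?thesis"
  then obtain x y where xy: "x \<in> {a<..<b}" "y \<in> {a<..<b}" "g x < 0" "0 < g y"
    using nz by (metis linorder_neqE_linordered_idom)
  have "connected (g ` {a<..<b})" by (rule connected_continuous_image[OF cont]) simp
  then have "0 \<in> g ` {a<..<b}" using xy unfolding connected_iff_interval by (meson imageI less_imp_le)
  then show False using nz by auto
qed

text \<open>\<open>delta_sign\<close> is - 1 whenever its condition fails. That this means the
  opposite signs on the whole interval follows from the constant sign of \<open>\<tau>p\<close> and
  the negative product of the two times.\<close>

lemma H1_directed_arcs:
  assumes "H1 Zp Zm x0 \<tau>p \<tau>m \<phi>p \<phi>m" and \<delta>: "\<delta> = delta_sign x0 \<tau>p \<tau>m"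
  shows "\<delta> = 1 \<or> \<delta> = - 1"
    and "0 < x \<Longrightarrow> x < x0 \<Longrightarrow> half_return (directed \<delta> Zm) (half_plane (- 1)) x (\<phi>m x)"
    and "0 < x \<Longrightarrow> x < x0 \<Longrightarrow> half_return (reverse_field (directed \<delta> Zp)) (half_plane 1) x (\<phi>p x)"
proof -
  show \<delta>1: "\<delta> = 1 \<or> \<delta> = - 1" using \<delta> by (simp add: delta_sign_def)
  from assms(1) have x0: "0 < x0" and cont: "continuous_on {0<..<x0} \<tau>p" "continuous_on {0<..<x0} \<tau>m"
    and arcs: "\<And>x. x \<in> {0<..<x0} \<Longrightarrow> \<exists>\<gamma>. orbit_arc Zp upper_half x (\<tau>p x) (\<phi>p x) \<gamma>"
      "\<And>x. x \<in> {0<..<x0} \<Longrightarrow> \<exists>\<gamma>. orbit_arc Zm lower_half x (\<tau>m x) (\<phi>m x) \<gamma>"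
    and prod: "\<And>x. x \<in> {0<..<x0} \<Longrightarrow> \<tau>p x * \<tau>m x < 0"
    unfolding H1_def by auto
  have "\<tau>p x \<noteq> 0" "\<tau>m x \<noteq> 0" if "x \<in> {0<..<x0}" for x using prod[OF that] by auto
  then have cs: "(\<forall>x\<in>{0<..<x0}. 0 < \<tau>p x) \<or> (\<forall>x\<in>{0<..<x0}. \<tau>p x < 0)"
    using constant_sign[OF cont(1)] by blast
  have signs: "if \<delta> = 1 then \<tau>p x < 0 \<and> 0 < \<tau>m x else \<tau>m x < 0 \<and> 0 < \<tau>p x" if x: "x \<in> {0<..<x0}" for x
    using cs
  proof
    assume p: "\<forall>x\<in>{0<..<x0}. 0 < \<tau>p x"
    then have "\<not> (\<forall>x\<in>{0<..<x0}. \<tau>p x < 0 \<and> 0 < \<tau>m x)" using bspec[OF p x] x by (metis less_asym)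
    then have "\<delta> = - 1" unfolding \<delta> delta_sign_def by (rule if_not_P)
    then show ?thesis using bspec[OF p x] prod[OF x] by (simp add: mult_less_0_iff)
  next
    assume p: "\<forall>x\<in>{0<..<x0}. \<tau>p x < 0"
    then have "\<forall>x\<in>{0<..<x0}. \<tau>p x < 0 \<and> 0 < \<tau>m x" using prod by (force simp: mult_less_0_iff)
    then show ?thesis using x \<delta> by (simp add: delta_sign_def)
  qed
  have pos: "half_return F S x v" if "0 < T" "\<exists>\<gamma>. orbit_arc F S x T v \<gamma>" for F S x T v
    using that by (auto simp: half_return_def)
  {
    assume x: "0 < x" "x < x0"
    then have xi: "x \<in> {0<..<x0}" by simp
    show "half_return (directed \<delta> Zm) (half_plane (- 1)) x (\<phi>m x)"
    proof (cases "\<delta> = 1")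
      case True
      then show ?thesis using signs[OF xi] pos[OF _ arcs(2)[OF xi]] by (simp add: directed_def lower_half_eq)
    next
      case False
      then have "half_return Zm (half_plane (- 1)) (\<phi>m x) x"
        using signs[OF xi] arcs(2)[OF xi] half_return_negative_time[of "- 1" "\<tau>m x"] by (auto simp: lower_half_eq)
      then show ?thesis using False half_return_reverse[of "- 1"] by (simp add: directed_def)
    qed
    show "half_return (reverse_field (directed \<delta> Zp)) (half_plane 1) x (\<phi>p x)"
    proof (cases "\<delta> = 1")
      case True
      then have "half_return Zp (half_plane 1) (\<phi>p x) x"
        using signs[OF xi] arcs(1)[OF xi] half_return_negative_time[of 1 "\<tau>p x"] by (auto simp: upper_half_eq)
      then show ?thesis using True half_return_reverse[of 1] by (simp add: directed_def)
    next
      case False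
      then show ?thesis using signs[OF xi] pos[OF _ arcs(1)[OF xi]] by (simp add: directed_def upper_half_eq)
    qed
  }
qed

lemma hyperbolic_at_iff: "hyperbolic_at Fp Fm x \<longleftrightarrow> rel_hyperbolic (first_return Fp Fm) x"
  by (simp add: hyperbolic_at_def rel_hyperbolic_def first_return_map_def rel_return_map_def)

lemma stable_at_iff: "stable_at Fp Fm x \<longleftrightarrow> rel_stable (first_return Fp Fm) x"
  by (simp add: stable_at_def rel_stable_def first_return_map_def rel_return_map_def)

lemma unstable_at_iff: "unstable_at Fp Fm x \<longleftrightarrow> rel_stable (\<lambda>u w. first_return Fp Fm w u) x"
  unfolding unstable_at_def stable_at_iff first_return_reverse_eq[unfolded reverse_field_def] ..

lemma expansion_difference:
  fixes f g :: "real \<Rightarrow> real"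
  assumes f: "(\<lambda>x. f x - (\<Sum>i=1..N. \<alpha> i * x ^ i)) \<in> o[at_right 0](\<lambda>x. x ^ N)"
    and g: "(\<lambda>x. g x - (\<Sum>i=1..N. \<beta> i * x ^ i)) \<in> o[at_right 0](\<lambda>x. x ^ N)"
    and N: "1 \<le> N" and eq: "\<And>i. 1 \<le> i \<Longrightarrow> i < N \<Longrightarrow> \<alpha> i = \<beta> i"
  shows "(\<lambda>x. f x - g x - (\<alpha> N - \<beta> N) * x ^ N) \<in> o[at_right 0](\<lambda>x. x ^ N)"
proof -
  have "(\<Sum>i=1..<N. \<alpha> i * x ^ i) = (\<Sum>i=1..<N. \<beta> i * x ^ i)" for x :: real
    by (rule sum.cong) (use eq in auto)
  moreover have "{1..N} = insert N {1..<N}" using N by auto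
  ultimately have "(\<lambda>x. (f x - (\<Sum>i=1..N. \<alpha> i * x ^ i)) - (g x - (\<Sum>i=1..N. \<beta> i * x ^ i))) =
      (\<lambda>x. f x - g x - (\<alpha> N - \<beta> N) * x ^ N)"
    by (simp add: algebra_simps)
  then show ?thesis using sum_in_smallo(2)[OF f g] by simp
qed

lemma derivative_expansion_difference:
  fixes f g :: "real \<Rightarrow> real"
  assumes f: "(\<lambda>x. f x - (\<Sum>i<N. real (i + 1) * \<alpha> (i + 1) * x ^ i)) \<in> o[at_right 0](\<lambda>x. x ^ (N - 1))"
    and g: "(\<lambda>x. g x - (\<Sum>i<N. real (i + 1) * \<beta> (i + 1) * x ^ i)) \<in> o[at_right 0](\<lambda>x. x ^ (N - 1))"
    and N: "1 \<le> N" and eq: "\<And>i. 1 \<le> i \<Longrightarrow> i < N \<Longrightarrow> \<alpha> i = \<beta> i"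
  shows "(\<lambda>x. f x - g x - N * (\<alpha> N - \<beta> N) * x ^ (N - 1)) \<in> o[at_right 0](\<lambda>x. x ^ (N - 1))"
proof -
  obtain M where M: "N = Suc M" using N by (cases N) auto
  have "(\<Sum>i<M. real (i + 1) * \<alpha> (i + 1) * x ^ i) = (\<Sum>i<M. real (i + 1) * \<beta> (i + 1) * x ^ i)" for x :: real
    by (rule sum.cong) (use eq M in auto)
  then have "(\<lambda>x. (f x - (\<Sum>i<N. real (i + 1) * \<alpha> (i + 1) * x ^ i)) - (g x - (\<Sum>i<N. real (i + 1) * \<beta> (i + 1) * x ^ i))) =
      (\<lambda>x. f x - g x - N * (\<alpha> N - \<beta> N) * x ^ (N - 1))"
    unfolding M by (simp add: algebra_simps)
  then show ?thesis using sum_in_smallo(2)[OF f g] by (simp only:)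
qed

text \<open>The terms of order \<open>N + 1\<close> need not agree, but their difference is absorbed
  by the bound.\<close>

lemma expansion_difference_bigo:
  fixes f g :: "real \<Rightarrow> real"
  assumes f: "(\<lambda>x. f x - (\<Sum>i=1..N + 1. \<alpha> i * x ^ i)) \<in> o[at_right 0](\<lambda>x. x ^ (N + 1))"
    and g: "(\<lambda>x. g x - (\<Sum>i=1..N + 1. \<beta> i * x ^ i)) \<in> o[at_right 0](\<lambda>x. x ^ (N + 1))"
    and N: "1 \<le> N" and eq: "\<And>i. 1 \<le> i \<Longrightarrow> i < N \<Longrightarrow> \<alpha> i = \<beta> i"
  shows "(\<lambda>x. f x - g x - (\<alpha> N - \<beta> N) * x ^ N) \<in> O[at_right 0](\<lambda>x. x ^ (N + 1))"
proof -
  have "(\<Sum>i=1..<N. \<alpha> i * x ^ i) = (\<Sum>i=1..<N. \<beta> i * x ^ i)" for x :: real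
    by (rule sum.cong) (use eq in auto)
  moreover have "{1..N + 1} = insert (N + 1) (insert N {1..<N})" using N by auto
  ultimately have eq: "(\<lambda>x. (f x - (\<Sum>i=1..N + 1. \<alpha> i * x ^ i)) - (g x - (\<Sum>i=1..N + 1. \<beta> i * x ^ i)) + (\<alpha> (N + 1) - \<beta> (N + 1)) * x ^ (N + 1)) =
      (\<lambda>x. f x - g x - (\<alpha> N - \<beta> N) * x ^ N)"
    by (simp add: algebra_simps)
  have "(\<lambda>x. (f x - (\<Sum>i=1..N + 1. \<alpha> i * x ^ i)) - (g x - (\<Sum>i=1..N + 1. \<beta> i * x ^ i))) \<in> O[at_right 0](\<lambda>x. x ^ (N + 1))"
    by (rule landau_o.small_imp_big[OF sum_in_smallo(2)[OF f g]])
  then have "(\<lambda>x. (f x - (\<Sum>i=1..N + 1. \<alpha> i * x ^ i)) - (g x - (\<Sum>i=1..N + 1. \<beta> i * x ^ i)) + (\<alpha> (N + 1) - \<beta> (N + 1)) * x ^ (N + 1)) \<in> O[at_right 0](\<lambda>x. x ^ (N + 1))"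
    by (rule sum_in_bigo(1)) simp
  then show ?thesis unfolding eq .
qed

text \<open>\<open>s * c\<close> is the limit of \<open>s * d x / x ^ N\<close>, hence nonnegative,
  and \<open>nz\<close> excludes 0.\<close>

lemma leading_coefficient_sign:
  fixes d :: "real \<Rightarrow> real"
  assumes exp: "(\<lambda>x. d x - c * x ^ N) \<in> o[at_right 0](\<lambda>x. x ^ N)"
    and x0: "0 < x0" and pos: "\<And>x. 0 < x \<Longrightarrow> x < x0 \<Longrightarrow> 0 < s * d x" and nz: "s * c \<noteq> 0"
  shows "0 < s * c"
proof -
  have "((\<lambda>x. (d x - c * x ^ N) / x ^ N) \<longlongrightarrow> 0) (at_right 0)" using exp by (rule smalloD_tendsto)
  then have lim: "((\<lambda>x. s * (c + (d x - c * x ^ N) / x ^ N)) \<longlongrightarrow> s * (c + 0)) (at_right 0)"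
    by (intro tendsto_intros)
  have "\<forall>\<^sub>F x in at_right 0. 0 \<le> s * (c + (d x - c * x ^ N) / x ^ N)"
    using eventually_at_right_real[OF x0]
  proof eventually_elim
    case (elim x)
    then have "0 < x ^ N" "0 < s * d x" using pos by auto
    moreover have "s * (c + (d x - c * x ^ N) / x ^ N) = s * d x / x ^ N"
      using \<open>0 < x ^ N\<close> elim by (simp add: diff_divide_distrib)
    ultimately show ?case by simp
  qed
  from tendsto_lowerbound[OF lim this] have "0 \<le> s * c" by simp
  then show ?thesis using nz by (metis less_le)
qed

lemma half_field_directed:
  "half_field F s \<Longrightarrow> half_field (directed \<delta> F) s"
  by (simp add: directed_def half_field.reverse)

theorem theorem2:
  fixes Zp Zm :: plane_field
    and x0 \<delta> \<sigma> \<mu> :: real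
    and \<tau>p \<tau>m \<phi>p \<phi>m :: "real \<Rightarrow> real"
    and k :: enat
    and \<alpha>p \<alpha>m V :: "nat \<Rightarrow> real"
    and N :: nat
  assumes "locally_lipschitz_field upper_half Zp"
    and "locally_lipschitz_field lower_half Zm"
    and "H1 Zp Zm x0 \<tau>p \<tau>m \<phi>p \<phi>m"
    and "\<delta> = delta_sign x0 \<tau>p \<tau>m"
    and "\<sigma> = sigma_sign x0 (displacement \<delta> \<phi>p \<phi>m)"
    and "\<mu> = - \<sigma> * \<delta>"
    and "k \<ge> 1"
    and "C_half_open k 0 x0 \<phi>p"
    and "C_half_open k 0 x0 \<phi>m"
    and "expansion_at_0 k \<alpha>p \<phi>p"
    and "expansion_at_0 k \<alpha>m \<phi>m"
    and "\<And>i. V i = \<delta> * (\<alpha>p i - \<alpha>m i)"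
    and "\<exists>i\<ge>1. enat i \<le> k \<and> V i \<noteq> 0"
    and "N = (LEAST i. 1 \<le> i \<and> enat i \<le> k \<and> V i \<noteq> 0)"
  shows "\<exists>b0>0. \<exists>U. \<exists>x :: real \<Rightarrow> real. open U \<and> (0, 0) \<in> U \<and>
     (\<forall>b. 0 < \<mu> * b \<and> \<mu> * b < b0 \<longrightarrow>
        0 < x b \<and>
        (\<exists>!\<Gamma>. crossing_periodic_orbit (translate_field b Zp) Zm \<Gamma> \<and> \<Gamma> \<inter> switch_line \<inter> U \<noteq> {}) \<and>
        (\<forall>\<Gamma>. crossing_periodic_orbit (translate_field b Zp) Zm \<Gamma> \<and> \<Gamma> \<inter> switch_line \<inter> U \<noteq> {} \<longrightarrow>
           \<Gamma> \<inter> switch_line \<subseteq> U \<and>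
           (x b, 0) \<in> \<Gamma> \<and>
           crossing_limit_cycle (translate_field b Zp) Zm \<Gamma> \<and>
           hyperbolic_at (translate_field b Zp) Zm (x b) \<and>
           (V N < 0 \<longrightarrow> stable_at (translate_field b Zp) Zm (x b)) \<and>
           (V N > 0 \<longrightarrow> unstable_at (translate_field b Zp) Zm (x b)))) \<and>
     (\<lambda>b. x b - root N ((1 - \<alpha>p 1) / \<bar>V N\<bar>) * root N \<bar>b\<bar>)
        \<in> o[at 0 within {b. 0 < \<mu> * b}](\<lambda>b. root N \<bar>b\<bar>) \<and>
     (enat N < k \<longrightarrow>
       (\<lambda>b. x b - root N ((1 - \<alpha>p 1) / \<bar>V N\<bar>) * root N \<bar>b\<bar>)
          \<in> O[at 0 within {b. 0 < \<mu> * b}](\<lambda>b. (root N \<bar>b\<bar>)\<^sup>2)) \<and>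
     (\<forall>b. - b0 < \<mu> * b \<and> \<mu> * b < 0 \<longrightarrow>
        \<not> (\<exists>\<Gamma>. crossing_periodic_orbit (translate_field b Zp) Zm \<Gamma> \<and>
               \<Gamma> \<inter> ({0..<x0} \<times> {0}) \<noteq> {}))"
proof -
  note H = assms(3)[unfolded H1_def]
  have x0: "0 < x0" and neg: "\<And>x. 0 < x \<Longrightarrow> x < x0 \<Longrightarrow> \<phi>p x < 0 \<and> \<phi>m x < 0 \<and> \<phi>p x \<noteq> \<phi>m x"
    and zero: "\<phi>p 0 = 0" "\<phi>m 0 = 0"
    using H by auto
  have \<delta>: "\<delta> = 1 \<or> \<delta> = - 1" by (rule H1_directed_arcs(1)[OF assms(3,4)])
  have N: "1 \<le> N" "enat N \<le> k" "V N \<noteq> 0"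
    using LeastI_ex[OF assms(13)] assms(14) by auto
  have below_N: "\<alpha>p i = \<alpha>m i" if "1 \<le> i" "i < N" for i
  proof -
    have "enat i \<le> k" using that(2) N(2) by (meson enat_ord_simps(1) less_imp_le order_trans)
    then have "V i = 0" using not_less_Least[of i "\<lambda>i. 1 \<le> i \<and> enat i \<le> k \<and> V i \<noteq> 0"] that assms(14) by auto
    then show ?thesis using assms(12)[of i] \<delta> by auto
  qed
  obtain \<phi>p' where
    p: "\<And>x. 0 < x \<Longrightarrow> x < x0 \<Longrightarrow> (\<phi>p has_real_derivative \<phi>p' x) (at x)"
      "continuous_on {0..<x0} \<phi>p" "(\<phi>p' \<longlongrightarrow> \<alpha>p 1) (at_right 0)"
      "\<And>n. 1 \<le> n \<Longrightarrow> enat n \<le> k \<Longrightarrow>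
         (\<lambda>x. \<phi>p' x - (\<Sum>i<n. real (i + 1) * \<alpha>p (i + 1) * x ^ i)) \<in> o[at_right 0](\<lambda>x. x ^ (n - 1))"
      "2 \<le> k \<Longrightarrow> \<exists>L r. 0 < r \<and>
         (\<forall>x\<in>{0<..<r}. \<bar>\<phi>p' x - \<alpha>p 1\<bar> \<le> L * x \<and> (\<forall>y\<in>{0<..<r}. \<bar>\<phi>p' x - \<phi>p' y\<bar> \<le> L * \<bar>x - y\<bar>))"
    using expansion_of_derivative[OF assms(8) x0 assms(7,10) zero(1)] by blast
  obtain \<phi>m' where
    m: "\<And>x. 0 < x \<Longrightarrow> x < x0 \<Longrightarrow> (\<phi>m has_real_derivative \<phi>m' x) (at x)"
      "continuous_on {0..<x0} \<phi>m" "(\<phi>m' \<longlongrightarrow> \<alpha>m 1) (at_right 0)"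
      "\<And>n. 1 \<le> n \<Longrightarrow> enat n \<le> k \<Longrightarrow>
         (\<lambda>x. \<phi>m' x - (\<Sum>i<n. real (i + 1) * \<alpha>m (i + 1) * x ^ i)) \<in> o[at_right 0](\<lambda>x. x ^ (n - 1))"
      "2 \<le> k \<Longrightarrow> \<exists>L r. 0 < r \<and>
         (\<forall>x\<in>{0<..<r}. \<bar>\<phi>m' x - \<alpha>m 1\<bar> \<le> L * x \<and> (\<forall>y\<in>{0<..<r}. \<bar>\<phi>m' x - \<phi>m' y\<bar> \<le> L * \<bar>x - y\<bar>))"
    using expansion_of_derivative[OF assms(9) x0 assms(7,11) zero(2)] by blast
  have expansions: "(\<lambda>x. \<phi>p x - (\<Sum>i=1..n. \<alpha>p i * x ^ i)) \<in> o[at_right 0](\<lambda>x. x ^ n)"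
      "(\<lambda>x. \<phi>m x - (\<Sum>i=1..n. \<alpha>m i * x ^ i)) \<in> o[at_right 0](\<lambda>x. x ^ n)" if "enat n \<le> k" for n
    using assms(10,11) that by (auto simp: expansion_at_0_def)
  define c where "c = \<alpha>p N - \<alpha>m N"
  \<comment> \<open>Since \<open>\<delta>\<close> squares to 1, this is the sign of
    \<open>\<phi>p - \<phi>m\<close>, free of the direction of time. It equals
    \<open>- \<mu>\<close>.\<close>
  define s where "s = \<sigma> * \<delta>"
  have Vc: "V N = \<delta> * c" using assms(12) by (simp add: c_def)
  have \<sigma>: "\<sigma> = 1 \<or> \<sigma> = - 1" using assms(5) by (simp add: sigma_sign_def)
  have s: "s = 1 \<or> s = - 1" using \<sigma> \<delta> by (auto simp: s_def)
  have \<mu>: "\<mu> * b = - (s * b)" for b using assms(6) by (simp add: s_def)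
  have sep: "0 < s * (\<phi>p x - \<phi>m x)" if x: "0 < x" "x < x0" for x
  proof -
    let ?\<Delta> = "displacement \<delta> \<phi>p \<phi>m"
    have "(\<forall>x\<in>{0<..<x0}. 0 < ?\<Delta> x) \<or> (\<forall>x\<in>{0<..<x0}. ?\<Delta> x < 0)"
    proof (rule constant_sign)
      show "continuous_on {0<..<x0} ?\<Delta>" unfolding displacement_def
        by (intro continuous_intros continuous_on_subset[OF p(2)] continuous_on_subset[OF m(2)]) auto
      show "?\<Delta> x \<noteq> 0" if "x \<in> {0<..<x0}" for x
        using that neg[of x] \<delta> by (auto simp: displacement_def)
    qed
    then have "0 < \<sigma> * ?\<Delta> x"
    proof
      assume "\<forall>x\<in>{0<..<x0}. 0 < ?\<Delta> x"
      then show ?thesis using x assms(5) by (simp add: sigma_sign_def)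
    next
      assume neg\<Delta>: "\<forall>x\<in>{0<..<x0}. ?\<Delta> x < 0"
      \<comment> \<open>\<open>sigma_sign\<close> takes the value - 1 by default, so the failure of
        its condition has to be derived.\<close>
      then have "\<not> (\<forall>x\<in>{0<..<x0}. 0 < ?\<Delta> x)" using x by (meson greaterThanLessThan_iff less_asym)
      then have "\<sigma> = - 1" unfolding assms(5) sigma_sign_def by (rule if_not_P)
      then show ?thesis using neg\<Delta> x by simp
    qed
    then show ?thesis by (simp add: s_def displacement_def mult.assoc)
  qed
  have exp: "(\<lambda>x. \<phi>p x - \<phi>m x - c * x ^ N) \<in> o[at_right 0](\<lambda>x. x ^ N)"
    unfolding c_def by (rule expansion_difference[OF expansions[OF N(2)] N(1) below_N])
  have sc: "0 < s * c"
    by (rule leading_coefficient_sign[OF exp x0 sep]) (use N(3) Vc s in auto)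
  have fields: "half_field (directed \<delta> Zm) (- 1)" "half_field (reverse_field (directed \<delta> Zp)) 1"
    by (intro half_field_directed half_field.reverse half_field.intro;
        use assms(1,2) in \<open>simp add: upper_half_eq lower_half_eq\<close>)+
  interpret M: return_family "directed \<delta> Zm" "- 1" \<phi>m x0
    using fields(1) H1_directed_arcs(2)[OF assms(3,4)] x0 neg zero m(2)
    by (simp add: return_family_def return_family_axioms_def)
  interpret P: return_family "reverse_field (directed \<delta> Zp)" 1 \<phi>p x0
    using fields(2) H1_directed_arcs(3)[OF assms(3,4)] x0 neg zero p(2)
    by (simp add: return_family_def return_family_axioms_def)
  interpret perturbed_system "directed \<delta> Zp" "directed \<delta> Zm" \<phi>p \<phi>m \<phi>p' \<phi>m' x0 s c "\<alpha>p 1" N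
  proof
    show "(\<lambda>x. \<phi>p' x - \<phi>m' x - real N * c * x ^ (N - 1)) \<in> o[at_right 0](\<lambda>x. x ^ (N - 1))"
      unfolding c_def by (rule derivative_expansion_difference[OF p(4)[OF N(1,2)] m(4)[OF N(1,2)] N(1) below_N])
    show "\<exists>L r. 0 < r \<and> (\<forall>x\<in>{0<..<r}. \<forall>y\<in>{0<..<r}. \<bar>\<phi>p' x - \<phi>p' y\<bar> \<le> L * \<bar>x - y\<bar>)" if "2 \<le> N"
    proof -
      have "enat 2 \<le> enat N" using that by simp
      then have "enat 2 \<le> k" using N(2) by (rule order_trans)
      then show ?thesis using p(5) by (simp add: numeral_eq_enat) blast
    qed
  qed (fact x0 s zero p m sep N exp sc P.strictly_decreasing M.strictly_decreasing)+
  obtain b0 U X where b0: "0 < b0" and U: "open U" "(0, 0) \<in> U"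
    and X: "\<And>b. 0 < - (s * b) \<Longrightarrow> - (s * b) < b0 \<Longrightarrow> 0 < X b \<and>
      partners (X b) (X b - b) \<and> 0 < s * (\<phi>p' (X b - b) - \<phi>m' (X b))"
    and ex1: "\<And>b. 0 < - (s * b) \<Longrightarrow> - (s * b) < b0 \<Longrightarrow>
      \<exists>!\<Gamma>. crossing_periodic_orbit (translate_field b (directed \<delta> Zp)) (directed \<delta> Zm) \<Gamma> \<and> \<Gamma> \<inter> switch_line \<inter> U \<noteq> {}"
    and cycle: "\<And>b \<Gamma>. 0 < - (s * b) \<Longrightarrow> - (s * b) < b0 \<Longrightarrow>
      crossing_periodic_orbit (translate_field b (directed \<delta> Zp)) (directed \<delta> Zm) \<Gamma> \<Longrightarrow> \<Gamma> \<inter> switch_line \<inter> U \<noteq> {} \<Longrightarrow>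
      \<Gamma> \<inter> switch_line \<subseteq> U \<and> (X b, 0) \<in> \<Gamma> \<and> crossing_limit_cycle (translate_field b (directed \<delta> Zp)) (directed \<delta> Zm) \<Gamma>"
    and small: "(\<lambda>b. X b - amplitude * root N \<bar>b\<bar>) \<in> o[at 0 within {b. 0 < - (s * b)}](\<lambda>b. root N \<bar>b\<bar>)"
    and big: "\<And>r L. (\<lambda>x. \<phi>p x - \<phi>m x - c * x ^ N) \<in> O[at_right 0](\<lambda>x. x ^ (N + 1)) \<Longrightarrow> 0 < r \<Longrightarrow>
      (\<And>x. x \<in> {0<..<r} \<Longrightarrow> \<bar>\<phi>p' x - \<alpha>p 1\<bar> \<le> L * x) \<Longrightarrow>
      (\<lambda>b. X b - amplitude * root N \<bar>b\<bar>) \<in> O[at 0 within {b. 0 < - (s * b)}](\<lambda>b. (root N \<bar>b\<bar>)\<^sup>2)"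
    and none: "\<And>b \<Gamma>. 0 < s * b \<Longrightarrow> s * b < b0 \<Longrightarrow>
      crossing_periodic_orbit (translate_field b (directed \<delta> Zp)) (directed \<delta> Zm) \<Gamma> \<Longrightarrow> \<Gamma> \<inter> ({0..<x0} \<times> {0}) = {}"
    by (rule bifurcation) blast
  have orbits: "crossing_periodic_orbit (translate_field b (directed \<delta> Zp)) (directed \<delta> Zm) =
      crossing_periodic_orbit (translate_field b Zp) Zm" for b
    unfolding directed_translate[symmetric] by (rule crossing_periodic_orbit_directed)
  have cycles: "crossing_limit_cycle (translate_field b (directed \<delta> Zp)) (directed \<delta> Zm) =
      crossing_limit_cycle (translate_field b Zp) Zm" for b
    unfolding crossing_limit_cycle_def[abs_def] orbits ..
  have amp: "amplitude = root N ((1 - \<alpha>p 1) / \<bar>V N\<bar>)"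
    unfolding amplitude_def using \<delta> Vc by auto
  have stability: "hyperbolic_at (translate_field b Zp) Zm (X b) \<and>
      (V N < 0 \<longrightarrow> stable_at (translate_field b Zp) Zm (X b)) \<and>
      (V N > 0 \<longrightarrow> unstable_at (translate_field b Zp) Zm (X b))"
    if b: "0 < - (s * b)" "- (s * b) < b0" for b
  proof -
    let ?R = "first_return (translate_field b (directed \<delta> Zp)) (directed \<delta> Zm)"
    let ?Z = "first_return (translate_field b Zp) Zm"
    have rel: "rel_hyperbolic ?R (X b) \<and> rel_hyperbolic (\<lambda>u w. ?R w u) (X b) \<and>
        (s = - 1 \<longrightarrow> rel_stable ?R (X b)) \<and> (s = 1 \<longrightarrow> rel_stable (\<lambda>u w. ?R w u) (X b))"
      using X[OF b] by (intro return_relation_hyperbolic) (auto simp: partners_iff)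
    show ?thesis
      unfolding hyperbolic_at_iff stable_at_iff unstable_at_iff
      using \<delta>
    proof (elim disjE)
      assume d: "\<delta> = 1"
      then have "?R = ?Z" by (simp add: directed_def)
      moreover have "V N < 0 \<Longrightarrow> s = - 1" "V N > 0 \<Longrightarrow> s = 1" using d Vc sc s by auto
      ultimately show "rel_hyperbolic ?Z (X b) \<and> (V N < 0 \<longrightarrow> rel_stable ?Z (X b)) \<and>
          (0 < V N \<longrightarrow> rel_stable (\<lambda>u w. ?Z w u) (X b))" using rel by auto
    next
      \<comment> \<open>The oriented system runs backward here, so its return relation is the
        converse of the actual one. As \<open>V N = - c\<close> changes sign too, the two reversals
        cancel in the stability statement.\<close>
      assume d: "\<delta> = - 1"
      then have "?R = (\<lambda>u w. ?Z w u)"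
        by (simp add: directed_def first_return_reverse fun_eq_iff flip: reverse_translate)
      moreover have "V N < 0 \<Longrightarrow> s = 1" "V N > 0 \<Longrightarrow> s = - 1" using d Vc sc s by auto
      ultimately show "rel_hyperbolic ?Z (X b) \<and> (V N < 0 \<longrightarrow> rel_stable ?Z (X b)) \<and>
          (0 < V N \<longrightarrow> rel_stable (\<lambda>u w. ?Z w u) (X b))" using rel by auto
    qed
  qed
  have bigo: "(\<lambda>b. X b - amplitude * root N \<bar>b\<bar>) \<in> O[at 0 within {b. 0 < - (s * b)}](\<lambda>b. (root N \<bar>b\<bar>)\<^sup>2)"
    if "enat N < k"
  proof -
    \<comment> \<open>One order beyond \<open>N\<close> is available. As \<open>N \<ge> 1\<close>,
      this also gives \<open>2 \<le> k\<close>, which the linear bound on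
      \<open>\<phi>p' x - \<alpha>p 1\<close> requires.\<close>
    have N1: "enat (N + 1) \<le> k" using that Suc_ile_eq by simp
    have "enat 2 \<le> enat (N + 1)" using N(1) by simp
    then have "2 \<le> k" using N1 by (metis numeral_eq_enat order_trans)
    then obtain L r where L: "0 < r" "\<forall>x\<in>{0<..<r}. \<bar>\<phi>p' x - \<alpha>p 1\<bar> \<le> L * x" using p(5) by blast
    have "(\<lambda>x. \<phi>p x - \<phi>m x - c * x ^ N) \<in> O[at_right 0](\<lambda>x. x ^ (N + 1))"
      unfolding c_def by (rule expansion_difference_bigo[OF expansions[OF N1] N(1) below_N])
    then show ?thesis using L by (intro big[of r L]) auto
  qed
  show ?thesis
  proof (intro exI[of _ b0] exI[of _ U] exI[of _ X] conjI allI impI b0 U)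
    fix b assume "0 < \<mu> * b \<and> \<mu> * b < b0"
    then have b: "0 < - (s * b)" "- (s * b) < b0" by (auto simp: \<mu>)
    show "0 < X b" using X[OF b] by blast
    show "\<exists>!\<Gamma>. crossing_periodic_orbit (translate_field b Zp) Zm \<Gamma> \<and> \<Gamma> \<inter> switch_line \<inter> U \<noteq> {}"
      using ex1[OF b] unfolding orbits .
    fix \<Gamma> assume \<Gamma>: "crossing_periodic_orbit (translate_field b Zp) Zm \<Gamma> \<and> \<Gamma> \<inter> switch_line \<inter> U \<noteq> {}"
    then have c: "\<Gamma> \<inter> switch_line \<subseteq> U \<and> (X b, 0) \<in> \<Gamma> \<and> crossing_limit_cycle (translate_field b Zp) Zm \<Gamma>"
      using cycle[OF b, of \<Gamma>] unfolding orbits cycles by blast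
    show "\<Gamma> \<inter> switch_line \<subseteq> U" "(X b, 0) \<in> \<Gamma>" "crossing_limit_cycle (translate_field b Zp) Zm \<Gamma>"
      using c by auto
    show "hyperbolic_at (translate_field b Zp) Zm (X b)" using stability[OF b] by blast
    show "stable_at (translate_field b Zp) Zm (X b)" if "V N < 0" using stability[OF b] that by blast
    show "unstable_at (translate_field b Zp) Zm (X b)" if "V N > 0" using stability[OF b] that by blast
  next
    show "(\<lambda>b. X b - root N ((1 - \<alpha>p 1) / \<bar>V N\<bar>) * root N \<bar>b\<bar>) \<in> o[at 0 within {b. 0 < \<mu> * b}](\<lambda>b. root N \<bar>b\<bar>)"
      using small unfolding \<mu> amp .
  next
    assume "enat N < k"
    then show "(\<lambda>b. X b - root N ((1 - \<alpha>p 1) / \<bar>V N\<bar>) * root N \<bar>b\<bar>) \<in> O[at 0 within {b. 0 < \<mu> * b}](\<lambda>b. (root N \<bar>b\<bar>)\<^sup>2)"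
      using bigo unfolding \<mu> amp by blast
  next
    fix b assume "- b0 < \<mu> * b \<and> \<mu> * b < 0"
    then have b: "0 < s * b" "s * b < b0" by (auto simp: \<mu>)
    show "\<not> (\<exists>\<Gamma>. crossing_periodic_orbit (translate_field b Zp) Zm \<Gamma> \<and> \<Gamma> \<inter> ({0..<x0} \<times> {0}) \<noteq> {})"
      using none[OF b] unfolding orbits by blast
  qed
qed

end
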